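(* (1) There exist an entire function $f_1$ and an invariant Baker domain $U_1$ of $f_1$ such that $U_1$ is simply parabolic, $f_1|_{U_1}$ is not univalent (that is, not injective), and, for a conformal map $\phi_1:\mathbb{D}\to U_1$ of the unit disk $\mathbb{D}$ onto $U_1$, the set $\Xi$ of all $\xi\in\partial\mathbb{D}$ such that $\infty$ belongs to the cluster set of $\phi_1$ at $\xi$ satisfies $\Xi\neq\partial\mathbb{D}$. (2) There exist an entire function $f_2$ and an invariant Baker domain $U_2$ of $f_2$ such that $U_2$ is hyperbolic, $f_2|_{U_2}$ is not univalent, and, for a conformal map $\phi_2:\mathbb{D}\to U_2$ of $\mathbb{D}$ onto $U_2$, the set $\Xi$ of all $\xi\in\partial\mathbb{D}$ such that $\infty$ belongs to the cluster set of $\phi_2$ at $\xi$ satisfies $\Xi\neq\partial\mathbb{D}$.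
   Context: Let $f$ be an entire function. The Fatou set $\mathcal{F}(f)$ is the subset of $\mathbb{C}$ where the iterates $f^n$ of $f$ form a normal family (in the sense of Montel, with limits allowed to be $\infty$). Its connected components are called Fatou components. A Baker domain of a (transcendental) entire function $f$ is a periodic Fatou component $U$ such that $f^n|_U\to\infty$ locally uniformly as $n\to\infty$. It is invariant if $f(U)\subset U$. Baker domains of entire functions are known to be simply connected (so conformal maps $\phi:\mathbb{D}\to U$ onto $U$ exist), and $f$ has no fixed point in a Baker domain. For a conformal map $\phi:\mathbb{D}\to U$ and $\xi\in\partial\mathbb{D}$, the cluster set of $\phi$ at $\xi$ is the set of all $w\in\mathbb{C}\cup\{\infty\}$ for which there is a sequence $(z_n)$ in $\mathbb{D}$ with $z_n\to\xi$ and $\phi(z_n)\to w$. Whether $\Xi=\partial\mathbb{D}$ does not depend on the choice of the conformal map $\phi$ onto $U$. Classification. Let $U\subsetneq\mathbb{C}$ be a simply connected domain and $f:U\to U$ holomorphic without fixed point in $U$ (for example, $U$ an invariant Baker domain of $f$). Call $u,v\in U$ equivalent if $f^m(u)=f^n(v)$ for some $m,n\in\mathbb{N}$, and let $U/f$ be the set of equivalence classes. It is known that $U/f$ is a Riemann surface conformally equivalent to exactly one of the following: (a) $\{z\in\mathbb{C}:-s<\operatorname{Im} z<s\}/\mathbb{Z}$ for some $s>0$; (b) $\{z\in\mathbb{C}:\operatorname{Im} z>0\}/\mathbb{Z}$; (c) $\mathbb{C}/\mathbb{Z}$. One calls $U$ (or $f:U\to U$) hyperbolic in case (a), simply parabolic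 in case (b), doubly parabolic in case (c). Equivalent description of the types. Let $\mathbb{H}=\{z\in\mathbb{C}:\operatorname{Re} z>0\}$. A subdomain $V\subset U$ is absorbing for $f:U\to U$ if $V$ is simply connected, $f(V)\subset V$, and for every compact $K\subset U$ there is $n=n(K)$ with $f^n(K)\subset V$. An eventual conjugacy of $f$ in $U$ is a tuple $(V,\varphi,T,\Omega)$ such that $V$ is absorbing for $f$; $\varphi:U\to\Omega\in\{\mathbb{H},\mathbb{C}\}$ is holomorphic, and univalent in $V$; $T$ is a Möbius transformation mapping $\Omega$ onto itself and $\varphi(V)$ is absorbing for $T:\Omega\to\Omega$; and $\varphi(f(z))=T(\varphi(z))$ for all $z\in U$. It is known that there is an eventual conjugacy in which $(\Omega,T)$ is of exactly one of the following forms: (a) $\Omega=\mathbb{H}$, $T(z)=\lambda z$ with $\lambda>1$; (b) $\Omega=\mathbb{H}$, $T(z)=z+i$ or $T(z)=z-i$; (c) $\Omega=\mathbb{C}$, $T(z)=z+1$. These cases correspond precisely to hyperbolic, simply parabolic and doubly parabolic, respectively. *)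

theory Defs
  imports "HOL-Complex_Analysis.Complex_Analysis"
begin

section \<open>Iteration of entire functions\<close>

definition transcendental_entire :: "(complex \<Rightarrow> complex) \<Rightarrow> bool" where
  "transcendental_entire f \<longleftrightarrow>
     f holomorphic_on UNIV \<and> (\<nexists>p :: complex poly. \<forall>z. f z = poly p z)"

text \<open>For open \<open>D\<close>, locally uniform convergence is uniform convergence on compact subsets.\<close>

definition loc_unif_tendsto ::
    "complex set \<Rightarrow> (nat \<Rightarrow> complex \<Rightarrow> complex) \<Rightarrow> (complex \<Rightarrow> complex) \<Rightarrow> bool" where
  "loc_unif_tendsto D g h \<longleftrightarrow>
     (\<forall>K. compact K \<and> K \<subseteq> D \<longrightarrow> uniform_limit K g h sequentially)"

definition loc_unif_tendsto_infinity ::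
    "complex set \<Rightarrow> (nat \<Rightarrow> complex \<Rightarrow> complex) \<Rightarrow> bool" where
  "loc_unif_tendsto_infinity D g \<longleftrightarrow>
     (\<forall>K. compact K \<and> K \<subseteq> D \<longrightarrow>
        (\<forall>M::real. \<forall>\<^sub>F n in sequentially. \<forall>z\<in>K. norm (g n z) > M))"

text \<open>To be applied to open connected \<open>D\<close>: there a locally uniform limit, with respect to the
  spherical metric, of holomorphic functions is either holomorphic or identically infinite.\<close>

definition normal_on :: "complex set \<Rightarrow> (complex \<Rightarrow> complex) set \<Rightarrow> bool" where
  "normal_on D \<F> \<longleftrightarrow>
     (\<forall>g :: nat \<Rightarrow> complex \<Rightarrow> complex. range g \<subseteq> \<F> \<longrightarrow>
        (\<exists>r :: nat \<Rightarrow> nat. strict_mono r \<and>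
           ((\<exists>h. h holomorphic_on D \<and> loc_unif_tendsto D (g \<circ> r) h) \<or>
            loc_unif_tendsto_infinity D (g \<circ> r))))"

definition fatou_set :: "(complex \<Rightarrow> complex) \<Rightarrow> complex set" where
  "fatou_set f =
     {z. \<exists>D. open D \<and> connected D \<and> z \<in> D \<and> normal_on D (range (\<lambda>n. f ^^ n))}"

definition baker_domain :: "(complex \<Rightarrow> complex) \<Rightarrow> complex set \<Rightarrow> bool" where
  "baker_domain f U \<longleftrightarrow>
     transcendental_entire f \<and>
     U \<in> components (fatou_set f) \<and>
     (\<exists>p\<ge>1. (f ^^ p) ` U \<subseteq> U) \<and>
     loc_unif_tendsto_infinity U (\<lambda>n. f ^^ n)"

definition invariant_baker_domain :: "(complex \<Rightarrow> complex) \<Rightarrow> complex set \<Rightarrow> bool" where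
  "invariant_baker_domain f U \<longleftrightarrow> baker_domain f U \<and> f ` U \<subseteq> U"

section \<open>Quotients of plane domains as Riemann surfaces\<close>

text \<open>A quotient \<^term>\<open>D // R\<close> of an open set \<open>D\<close> carries the structure that makes the projection
  \<open>z \<mapsto> R `` {z}\<close> a quotient map: a set of classes is open iff its preimage in \<open>D\<close> is open, and a
  complex function on an open set of classes is holomorphic iff its pullback to \<open>D\<close> is. For both
  kinds of quotient below this is the usual Riemann surface structure, that is, the unique one for
  which the projection is holomorphic.\<close>

definition quotient_preimage ::
    "complex set \<Rightarrow> (complex \<times> complex) set \<Rightarrow> complex set set \<Rightarrow> complex set" where
  "quotient_preimage D R W = {z \<in> D. R `` {z} \<in> W}"

definition quotient_open ::
    "complex set \<Rightarrow> (complex \<times> complex) set \<Rightarrow> complex set set \<Rightarrow> bool" where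
  "quotient_open D R W \<longleftrightarrow> W \<subseteq> D // R \<and> open (quotient_preimage D R W)"

definition quotient_holomorphic_on ::
    "complex set \<Rightarrow> (complex \<times> complex) set \<Rightarrow> (complex set \<Rightarrow> complex) \<Rightarrow> complex set set \<Rightarrow> bool"
  where
  "quotient_holomorphic_on D R h W \<longleftrightarrow>
     (\<lambda>z. h (R `` {z})) holomorphic_on quotient_preimage D R W"

text \<open>A conformal equivalence is a homeomorphism under which the holomorphic functions on open
  subsets of the two surfaces correspond.\<close>

definition conformally_equivalent ::
    "complex set \<Rightarrow> (complex \<times> complex) set \<Rightarrow> complex set \<Rightarrow> (complex \<times> complex) set \<Rightarrow> bool"
  where
  "conformally_equivalent D R E S \<longleftrightarrow>
     (\<exists>\<Phi>. bij_betw \<Phi> (D // R) (E // S) \<and>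
        (\<forall>W. W \<subseteq> E // S \<longrightarrow>
           (quotient_open E S W \<longleftrightarrow> quotient_open D R {X \<in> D // R. \<Phi> X \<in> W})) \<and>
        (\<forall>W h. quotient_open E S W \<longrightarrow>
           (quotient_holomorphic_on E S h W \<longleftrightarrow>
            quotient_holomorphic_on D R (h \<circ> \<Phi>) {X \<in> D // R. \<Phi> X \<in> W})))"

definition orbit_rel :: "(complex \<Rightarrow> complex) \<Rightarrow> complex set \<Rightarrow> (complex \<times> complex) set" where
  "orbit_rel f U = {(u, v). u \<in> U \<and> v \<in> U \<and> (\<exists>m n. (f ^^ m) u = (f ^^ n) v)}"

definition int_translation_rel :: "complex set \<Rightarrow> (complex \<times> complex) set" where
  "int_translation_rel E = {(z, w). z \<in> E \<and> w \<in> E \<and> (\<exists>k::int. w = z + of_int k)}"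

definition hyperbolic_type :: "(complex \<Rightarrow> complex) \<Rightarrow> complex set \<Rightarrow> bool" where
  "hyperbolic_type f U \<longleftrightarrow>
     (\<exists>s>0. let E = {z. - s < Im z \<and> Im z < s}
            in conformally_equivalent U (orbit_rel f U) E (int_translation_rel E))"

definition simply_parabolic_type :: "(complex \<Rightarrow> complex) \<Rightarrow> complex set \<Rightarrow> bool" where
  "simply_parabolic_type f U \<longleftrightarrow>
     (let E = {z. Im z > 0}
      in conformally_equivalent U (orbit_rel f U) E (int_translation_rel E))"

section \<open>Boundary behaviour of conformal maps of the disk\<close>

definition conformal_map_from_disk :: "(complex \<Rightarrow> complex) \<Rightarrow> complex set \<Rightarrow> bool" where
  "conformal_map_from_disk \<phi> U \<longleftrightarrow>
     \<phi> holomorphic_on ball 0 1 \<and> inj_on \<phi> (ball 0 1) \<and> \<phi> ` ball 0 1 = U"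

text \<open>The extended plane is the one-point compactification, with \<^const>\<open>None\<close> as \<open>\<infinity>\<close>.\<close>

definition cluster_set :: "(complex \<Rightarrow> complex) \<Rightarrow> complex \<Rightarrow> complex option set" where
  "cluster_set \<phi> \<xi> =
     {w. \<exists>z :: nat \<Rightarrow> complex. (\<forall>n. z n \<in> ball 0 1) \<and> z \<longlonglongrightarrow> \<xi> \<and>
           limitin (Alexandroff_compactification euclidean) (\<lambda>n. Some (\<phi> (z n))) w sequentially}"

definition infinity_cluster_points :: "(complex \<Rightarrow> complex) \<Rightarrow> complex set" where
  "infinity_cluster_points \<phi> = {\<xi> \<in> sphere 0 1. None \<in> cluster_set \<phi> \<xi>}"

end

theory Submission
  imports Defs "HOL-Real_Asymp.Real_Asymp"
begin

text \<open>
  Both examples have the form \<open>f z = z + 1 + h z\<close>, where \<open>h\<close> is the exponential of an entire function.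
  In the parabolic example \<open>h\<close> is a constant multiple of \<open>exp (\<i> z^3 - z)\<close>; as \<open>Re z\<close> tends to \<open>\<infinity>\<close>, it is tiny
  slightly above the real axis, still decays like \<open>exp (- x)\<close> on the axis, and is enormous slightly below it. In the
  hyperbolic example \<open>h\<close> is a constant multiple of \<open>exp (- exp z - 2 z)\<close>, which behaves in the same way
  with respect to both boundary lines of the strip \<open>E = {|Im z| < pi/2}\<close>; in the parabolic example \<open>E\<close>
  is the upper half-plane.

  Let \<open>U\<close> be the Fatou component that contains a suitable convex domain \<open>V\<close>, on which \<open>f\<close> is close to the
  translation by \<open>1\<close>. There are fixed points of \<open>f\<close> within bounded distance of all large integers, and on \<open>U\<close> all
  iterates omit them. By Schottky's theorem the functions \<open>N n z = f^n z - n\<close> are locally bounded on \<open>U\<close>; they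
  converge to a function \<open>\<psi>\<close> with \<open>\<psi> (f z) = \<psi> z + 1\<close>. A value of \<open>\<psi>\<close> just outside the closure of \<open>E\<close> would force \<open>h\<close> to be
  large along an orbit, contrary to the boundedness of \<open>N\<close>. As \<open>\<psi>(U)\<close> is open and connected, \<open>\<psi>\<close> maps \<open>U\<close> into \<open>E\<close>, every
  orbit in \<open>U\<close> enters \<open>V\<close>, and \<open>\<psi>\<close> induces a conformal equivalence of \<open>U/f\<close> with \<open>E/\<int>\<close>
  (lemmas \<open>\<psi>_E\<close>, \<open>U_A\<close>, \<open>orbit_space\<close>). Since \<open>V\<close> is convex, the maximum principle shows that \<open>U\<close> is simply
  connected.

  The constants in \<open>h\<close> are chosen such that \<open>f\<close> has a critical point whose orbit enters \<open>V\<close> and which can be joined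
  to \<open>V\<close> within \<open>U\<close>; so \<open>f\<close> is not injective on \<open>U\<close>.

  Because \<open>h\<close> decays even on the boundary line of \<open>E\<close>, backward iteration along translation orbits
  yields a right inverse \<open>G\<close> of \<open>\<psi>\<close> on a whole half-disk \<open>\<Omega>\<close> in \<open>E\<close> that rests on this line, and \<open>G\<close> is bounded
  (lemma \<open>translation_orbits_shadowed\<close>). Let \<open>\<phi>\<close> be a Riemann map of \<open>U\<close>. Then \<open>\<phi>\<^sup>-\<^sup>1 \<circ> G\<close> is a right
  inverse of \<open>\<psi> \<circ> \<phi>\<close>, and such a right inverse covers a neighbourhood, relative to the disk, of some point \<open>\<xi>\<close> of
  the circle (lemma \<open>half_disc_right_inverse_covers\<close>). So \<open>\<phi>\<close> is bounded near \<open>\<xi>\<close>, and \<open>\<infinity>\<close> is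
  not in its cluster set there.
\<close>

section \<open>Sequences omitting two values\<close>

text \<open>A quantitative form of Montel's criterion. The omitted values may vary with the function as long
  as they stay bounded and apart; Schottky's theorem applies after an affine change of variable.\<close>

lemma omitting_two_values_bounded_near:
  fixes N :: "nat \<Rightarrow> complex \<Rightarrow> complex"
  assumes hol: "\<And>n. N n holomorphic_on cball z R" and R: "R > 0"
    and om: "\<And>n w. w \<in> cball z R \<Longrightarrow> N n w \<noteq> \<alpha> n \<and> N n w \<noteq> \<beta> n"
    and bd: "\<And>n. norm (\<alpha> n) \<le> C" "\<And>n. norm (\<beta> n) \<le> C"
    and sep: "\<And>n. 1 \<le> norm (\<beta> n - \<alpha> n)"
    and B: "\<And>n. norm (N n z) \<le> B"
  obtains B' where "\<And>n w. w \<in> cball z (R/2) \<Longrightarrow> norm (N n w) \<le> B'"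
proof
  define M where "M = exp (pi * exp (pi * (2 + 2 * (B + C) + 12 * (1/2) / (1 - 1/2 :: real))))"
  fix n w assume w: "w \<in> cball z (R/2)"
  define g where "g = (\<lambda>\<zeta>::complex. (N n (z + R * \<zeta>) - \<alpha> n) / (\<beta> n - \<alpha> n))"
  have ne: "\<beta> n - \<alpha> n \<noteq> 0" using sep[of n] by auto
  have in_ball: "z + R * \<zeta> \<in> cball z R" if "\<zeta> \<in> cball 0 1" for \<zeta> :: complex
    using that R by (simp add: dist_norm norm_mult mult_left_le)
  have holg: "g holomorphic_on cball 0 1"
    unfolding g_def
    by (intro holomorphic_intros holomorphic_on_compose_gen[OF _ hol[of n], unfolded o_def])
       (use ne in_ball in auto)
  have g01: "\<not> (g \<zeta> = 0 \<or> g \<zeta> = 1)" if "\<zeta> \<in> cball 0 1" for \<zeta>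
    using om[OF in_ball[OF that], of n] ne by (auto simp: g_def field_simps)
  have "norm (g 0) = norm (N n z - \<alpha> n) / norm (\<beta> n - \<alpha> n)"
    by (simp add: g_def norm_divide)
  also have "\<dots> \<le> norm (N n z - \<alpha> n)"
    using sep[of n] by (simp add: divide_le_eq mult_left_le_one_le order.trans[OF _ sep] mult_le_cancel_left1)
  also have "\<dots> \<le> B + C"
    using norm_triangle_ineq4[of "N n z" "\<alpha> n"] B[of n] bd(1)[of n] by linarith
  finally have g0: "norm (g 0) \<le> B + C" .
  define \<zeta> where "\<zeta> = (w - z) / R"
  have z1: "norm \<zeta> \<le> 1/2"
    using w R by (simp add: \<zeta>_def norm_divide dist_norm norm_minus_commute field_simps)
  have wz: "w = z + R * \<zeta>" using R by (simp add: \<zeta>_def)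
  have "norm (g \<zeta>) \<le> M"
    unfolding M_def by (rule Schottky[OF holg g0 g01]) (use z1 in auto)
  moreover have "N n w = g \<zeta> * (\<beta> n - \<alpha> n) + \<alpha> n"
    using ne by (simp add: g_def wz)
  moreover have "norm (\<beta> n - \<alpha> n) \<le> 2 * C"
    using norm_triangle_ineq4[of "\<beta> n" "\<alpha> n"] bd(1)[of n] bd(2)[of n] by linarith
  ultimately have "norm (N n w) \<le> M * (2 * C) + C"
    using norm_triangle_ineq[of "g \<zeta> * (\<beta> n - \<alpha> n)" "\<alpha> n"] bd(1)[of n]
      mult_mono[of "norm (g \<zeta>)" M "norm (\<beta> n - \<alpha> n)" "2 * C"]
    by (simp add: norm_mult M_def)
  then show "norm (N n w) \<le> M * (2 * C) + C" .
qed

text \<open>Boundedness at a single point spreads over a connected open set, because the set of points near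
  which the sequence is bounded is open and relatively closed.\<close>

lemma omitting_two_values_locally_bounded:
  fixes N :: "nat \<Rightarrow> complex \<Rightarrow> complex"
  assumes U: "open U" "connected U" and hol: "\<And>n. N n holomorphic_on U"
    and om: "\<And>n w. w \<in> U \<Longrightarrow> N n w \<noteq> \<alpha> n \<and> N n w \<noteq> \<beta> n"
    and bd: "\<And>n. norm (\<alpha> n) \<le> C" "\<And>n. norm (\<beta> n) \<le> C"
    and sep: "\<And>n. 1 \<le> norm (\<beta> n - \<alpha> n)"
    and z0: "z0 \<in> U" and B: "\<And>n. norm (N n z0) \<le> B"
    and K: "compact K" "K \<subseteq> U"
  obtains B' where "\<And>n w. w \<in> K \<Longrightarrow> norm (N n w) \<le> B'"
proof -
  \<comment> \<open>\<open>Q z \<rho>\<close>: the sequence is uniformly bounded on the disk of radius \<open>\<rho>\<close> about \<open>z\<close>.\<close>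
  define Q where "Q = (\<lambda>z \<rho>. \<rho> > 0 \<and> ball z \<rho> \<subseteq> U \<and> (\<exists>B. \<forall>n. \<forall>w\<in>ball z \<rho>. norm (N n w) \<le> B))"
  define S where "S = {z. \<exists>\<rho>. Q z \<rho>}"
  have step: "\<exists>B'. \<forall>n. \<forall>w\<in>cball z (R/2). norm (N n w) \<le> B'"
    if "R > 0" "cball z R \<subseteq> U" "\<And>n. norm (N n z) \<le> B" for z R B
    by (rule omitting_two_values_bounded_near[of N z R \<alpha> \<beta> C B])
       (use that hol om bd sep holomorphic_on_subset in \<open>blast+\<close>)
  have SU: "S \<subseteq> U" by (force simp: S_def Q_def)
  have openS: "open S"
    unfolding open_contains_ball
  proof
    fix z assume "z \<in> S"
    then obtain \<rho> B where r: "\<rho> > 0" "ball z \<rho> \<subseteq> U" and B: "\<forall>n. \<forall>w\<in>ball z \<rho>. norm (N n w) \<le> B"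
      by (auto simp: S_def Q_def)
    show "\<exists>e>0. ball z e \<subseteq> S"
    proof (intro exI[of _ "\<rho>/2"] conjI subsetI)
      fix w assume "w \<in> ball z (\<rho>/2)"
      then have sub: "ball w (\<rho>/2) \<subseteq> ball z \<rho>"
        by (smt (verit, best) dist_triangle mem_ball subsetI field_sum_of_halves)
      have "Q w (\<rho>/2)" unfolding Q_def using sub r B by (intro conjI exI[of _ B]) auto
      then show "w \<in> S" by (auto simp: S_def)
    qed (use r in auto)
  qed
  have bdS: "\<exists>B. \<forall>n. norm (N n z) \<le> B" if "z \<in> S" for z
    using that by (force simp: S_def Q_def)
  have z0S: "z0 \<in> S"
  proof -
    obtain R where R: "R > 0" "cball z0 R \<subseteq> U" using U(1) z0 open_contains_cball by blast
    from step[OF R B] obtain B' where "\<forall>n. \<forall>w\<in>cball z0 (R/2). norm (N n w) \<le> B'" by blast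
    with R have "Q z0 (R/2)" unfolding Q_def by (intro conjI exI[of _ B']) auto
    then show ?thesis by (auto simp: S_def)
  qed
  have clos: "z \<in> S" if zU: "z \<in> U" and zc: "z \<in> closure S" for z
  proof -
    obtain R where R: "R > 0" "cball z R \<subseteq> U" using U(1) zU open_contains_cball by blast
    obtain y where y: "y \<in> S" "dist y z < R/8" using zc R(1)
      by (meson closure_approachable zero_less_divide_iff zero_less_numeral)
    obtain B where B: "\<And>n. norm (N n y) \<le> B" using bdS[OF y(1)] by blast
    have "cball y (R/2) \<subseteq> cball z R"
    proof
      fix x assume "x \<in> cball y (R/2)"
      then show "x \<in> cball z R" using dist_triangle[of z x y] y(2) R(1) by (auto simp: dist_commute)
    qed
    then have "cball y (R/2) \<subseteq> U" using R by blast
    from step[OF _ this B] R obtain B' where B': "\<forall>n. \<forall>w\<in>cball y (R/2/2). norm (N n w) \<le> B'" by auto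
    have sub: "ball z (R/8) \<subseteq> cball y (R/2/2)"
    proof
      fix x assume "x \<in> ball z (R/8)"
      then show "x \<in> cball y (R/2/2)" using dist_triangle[of y x z] y(2) R(1) by (auto simp: dist_commute)
    qed
    have "Q z (R/8)" unfolding Q_def using sub B' R by (intro conjI exI[of _ B']) auto
    then show ?thesis by (auto simp: S_def)
  qed
  have "S = U"
  proof -
    have "openin (top_of_set U) S" using openS SU by (simp add: open_subset)
    moreover have "closedin (top_of_set U) S"
      using clos SU closure_subset
      by (subst closedin_closed) (intro exI[of _ "closure S"], auto)
    ultimately show ?thesis using U(2) z0S unfolding connected_clopen by blast
  qed
  have "\<forall>z\<in>U. \<exists>\<rho>. Q z \<rho>" using \<open>S = U\<close> by (auto simp: S_def)
  then obtain c where c: "\<And>z. z \<in> U \<Longrightarrow> Q z (c z)" using bchoice[of U Q] by blast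
  have "K \<subseteq> (\<Union>z\<in>K. ball z (c z))" using c K(2) by (force simp: Q_def)
  then obtain T where T: "T \<subseteq> K" "finite T" "K \<subseteq> (\<Union>z\<in>T. ball z (c z))"
    using compactE_image[OF K(1), of K "\<lambda>z. ball z (c z)"] by (metis open_ball)
  have "\<forall>z\<in>T. \<exists>B. \<forall>n. \<forall>w\<in>ball z (c z). norm (N n w) \<le> B" using c T(1) K(2) by (auto simp: Q_def)
  then obtain b where b: "\<forall>z\<in>T. \<forall>n. \<forall>w\<in>ball z (c z). norm (N n w) \<le> b z" by metis
  show ?thesis
  proof
    fix n w assume "w \<in> K"
    then obtain z where z: "z \<in> T" "w \<in> ball z (c z)" using T by blast
    have "norm (N n w) \<le> b z" using b z by blast
    also have "b z \<le> (\<Sum>z\<in>T. \<bar>b z\<bar>)"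
      using member_le_sum[of z T "\<lambda>z. \<bar>b z\<bar>"] z T by auto
    finally show "norm (N n w) \<le> (\<Sum>z\<in>T. \<bar>b z\<bar>)" .
  qed
qed

section \<open>A maximum principle and a covering lemma\<close>

text \<open>A convex open set is cut out by half-planes, and on each of them the maximum principle applies
  to the exponential of a linear functional.\<close>

lemma maximum_principle_convex:
  fixes g :: "complex \<Rightarrow> complex"
  assumes S: "bounded S" "open S" and g: "g holomorphic_on S" "continuous_on (closure S) g"
    and V: "convex V" "open V" and fr: "\<And>z. z \<in> frontier S \<Longrightarrow> g z \<in> V"
    and z: "z \<in> S"
  shows "g z \<in> V"
proof (rule ccontr)
  assume "g z \<notin> V"
  then have "V \<inter> {g z} = {}" by auto
  have cf: "compact (frontier S)" using S compact_frontier_bounded by blast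
  have fne: "frontier S \<noteq> {}"
    using S z by (metis empty_iff frontier_eq_empty not_bounded_UNIV)
  then have Vne: "V \<noteq> {}" using fr by auto
  from separating_hyperplane_sets[OF V(1) convex_singleton Vne _ \<open>V \<inter> {g z} = {}\<close>]
  obtain a b where ab: "a \<noteq> 0" "\<forall>x\<in>V. a \<bullet> x \<le> b" "b \<le> a \<bullet> g z" by auto
  have strict: "a \<bullet> v < b" if vV: "v \<in> V" for v
  proof -
    obtain e where e: "e > 0" "cball v e \<subseteq> V"
      using V(2) vV unfolding open_contains_cball by metis
    define v' where "v' = v + (e / norm a) *\<^sub>R a"
    have "v' \<in> cball v e" using ab(1) e(1) by (simp add: v'_def dist_norm)
    then have "a \<bullet> v' \<le> b" using e ab by blast
    moreover have "a \<bullet> v' = a \<bullet> v + e / norm a * (a \<bullet> a)" by (simp add: v'_def inner_add_right)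
    moreover have "e / norm a * (a \<bullet> a) > 0" using ab(1) e(1) by simp
    ultimately show ?thesis by linarith
  qed
  have re: "Re (cnj a * w) = a \<bullet> w" for w by (simp add: inner_complex_def)
  have "continuous_on (frontier S) (\<lambda>x. a \<bullet> g x)"
    by (intro continuous_intros continuous_on_subset[OF g(2)]) (auto simp: frontier_def)
  then obtain y where y: "y \<in> frontier S" "\<forall>x\<in>frontier S. a \<bullet> g x \<le> a \<bullet> g y"
    using continuous_attains_sup[OF cf fne] by blast
  have "norm (exp (cnj a * g z)) \<le> exp (a \<bullet> g y)"
  proof (rule maximum_modulus_frontier[where f = "\<lambda>x. exp (cnj a * g x)" and S = S])
    show "(\<lambda>x. exp (cnj a * g x)) holomorphic_on interior S"
      using S g by (auto intro!: holomorphic_intros simp: interior_open)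
    show "continuous_on (closure S) (\<lambda>x. exp (cnj a * g x))"
      using g by (auto intro!: continuous_intros)
  qed (use S z y re in auto)
  then have "a \<bullet> g z \<le> a \<bullet> g y" by (simp only: norm_exp_eq_Re re exp_le_cancel_iff)
  with strict[OF fr[OF y(1)]] ab show False by linarith
qed

text \<open>A Bloch-type covering lemma: if \<open>q\<close> moves fast compared with its distance to the vertical line
  \<open>{Re = ln |d|}\<close>, then its image of a disk contains one of the logarithms of \<open>d\<close>, which lie on
  this line with spacing \<open>2 pi\<close>. It produces fixed points.\<close>

lemma exp_composite_surj_on_ball:
  fixes q :: "complex \<Rightarrow> complex"
  assumes hol: "q holomorphic_on cball a r" and r: "r > 0"
    and le: "\<And>z. z \<in> ball a r \<Longrightarrow> norm (deriv q z) \<le> 2 * norm (deriv q a)"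
    and d: "d \<noteq> 0"
    and big: "\<bar>Re (q a) - ln (norm d)\<bar> + pi < (3 - 2 * sqrt 2) * r * norm (deriv q a)"
  obtains b where "b \<in> ball a r" "exp (q b) = d"
proof -
  \<comment> \<open>\<open>t\<close> is the logarithm of \<open>d\<close> whose imaginary part is closest to that of \<open>q a\<close>.\<close>
  define m where "m = round (Im (q a - Ln d) / (2 * pi))"
  define t where "t = Ln d + 2 * of_int m * pi * \<i>"
  have "\<bar>of_int m - Im (q a - Ln d) / (2 * pi)\<bar> \<le> 1/2"
    unfolding m_def by (rule of_int_round_abs_le)
  then have "\<bar>of_int m - Im (q a - Ln d) / (2 * pi)\<bar> * (2 * pi) \<le> 1/2 * (2 * pi)"
    by (intro mult_right_mono) auto
  also have "\<bar>of_int m - Im (q a - Ln d) / (2 * pi)\<bar> * (2 * pi)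
     = \<bar>(of_int m - Im (q a - Ln d) / (2 * pi)) * (2 * pi)\<bar>"
    by (simp add: abs_mult)
  also have "(of_int m - Im (q a - Ln d) / (2 * pi)) * (2 * pi) = Im (t - q a)"
    by (simp add: t_def field_simps)
  finally have im: "\<bar>Im (t - q a)\<bar> \<le> pi" by simp
  have "norm (t - q a) \<le> \<bar>Re (t - q a)\<bar> + \<bar>Im (t - q a)\<bar>" by (rule cmod_le)
  also have "Re (t - q a) = - (Re (q a) - ln (norm d))" using d by (simp add: t_def)
  finally have "norm (t - q a) < (3 - 2 * sqrt 2) * r * norm (deriv q a)"
    using im big by linarith
  then have "t \<in> ball (q a) ((3 - 2 * sqrt 2) * r * norm (deriv q a))"
    by (simp add: dist_norm norm_minus_commute)
  then obtain b where b: "b \<in> ball a r" "q b = t"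
    using Bloch_lemma[OF hol r le] by (metis (no_types, lifting) imageE subsetD)
  have "exp t = d"
    using d by (simp add: t_def exp_add exp_eq_1 mult.assoc)
  with b that show ?thesis by metis
qed

section \<open>Right inverses on half-disks and the unit circle\<close>

lemma Schwarz_Pick_deriv:
  assumes k: "k holomorphic_on ball w \<rho>" and \<rho>: "\<rho> > 0"
    and into: "\<And>z. z \<in> ball w \<rho> \<Longrightarrow> norm (k z) < 1"
  shows "norm (deriv k w) * \<rho> \<le> 1 - (norm (k w))\<^sup>2"
proof -
  define p where "p = k w"
  define F where "F = (\<lambda>\<zeta>. Moebius_function 0 p (k (w + of_real \<rho> * \<zeta>)))"
  have p: "norm p < 1" using into \<rho> by (simp add: p_def)
  have inb: "w + of_real \<rho> * \<zeta> \<in> ball w \<rho>" if "norm \<zeta> < 1" for \<zeta> :: complex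
    using that \<rho> by (simp add: dist_norm norm_mult)
  have holk: "(\<lambda>\<zeta>. k (w + of_real \<rho> * \<zeta>)) holomorphic_on ball 0 1"
    by (intro holomorphic_on_compose_gen[OF _ k, unfolded o_def] holomorphic_intros) (use inb in auto)
  have holF: "F holomorphic_on ball 0 1"
    unfolding F_def
    by (rule holomorphic_on_compose_gen[OF holk Moebius_function_holomorphic[OF p], unfolded o_def])
       (use inb into in auto)
  have F0: "F 0 = 0" by (simp add: F_def p_def Moebius_function_def)
  have F1: "norm (F \<zeta>) < 1" if "norm \<zeta> < 1" for \<zeta>
    unfolding F_def by (rule Moebius_function_norm_lt_1[OF p into[OF inb[OF that]]])
  have "norm (deriv F 0) \<le> 1"
    by (rule Schwarz_Lemma(2)[OF holF F0 F1, of 0]) auto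
  have pp: "1 - cnj p * p = of_real (1 - (norm p)\<^sup>2)"
    using complex_norm_square[of p] by (simp add: mult.commute)
  have pos: "1 - (norm p)\<^sup>2 > 0" using p by (simp add: abs_square_less_1)
  define kk where "kk = (\<lambda>\<zeta>. k (w + of_real \<rho> * \<zeta>))"
  define d where "d = deriv k w * of_real \<rho>"
  have dk: "(k has_field_derivative deriv k w) (at w)"
    using k \<rho> by (intro holomorphic_derivI[OF k]) auto
  have "((\<lambda>\<zeta>. k (w + of_real \<rho> * \<zeta>)) has_field_derivative deriv k w * of_real \<rho>) (at 0)"
    by (rule DERIV_chain'[where g = k and f = "\<lambda>\<zeta>. w + of_real \<rho> * \<zeta>"])
       (use dk in \<open>auto intro!: derivative_eq_intros\<close>)
  then have dkk: "(kk has_field_derivative d) (at 0)" by (simp add: kk_def d_def)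
  have "kk 0 = p" by (simp add: kk_def p_def)
  have ne: "1 - cnj p * p \<noteq> 0" unfolding pp using pos by (simp del: of_real_diff)
  have "((\<lambda>\<zeta>. (kk \<zeta> - p) / (1 - cnj p * kk \<zeta>)) has_field_derivative
      ((d - 0) * (1 - cnj p * kk 0) - (kk 0 - p) * (0 - d * cnj p)) / ((1 - cnj p * kk 0) * (1 - cnj p * kk 0))) (at 0)"
    by (intro DERIV_divide DERIV_diff DERIV_const DERIV_cmult_right dkk DERIV_cmult[OF dkk, THEN DERIV_cong])
       (use ne \<open>kk 0 = p\<close> in \<open>auto simp: mult.commute\<close>)
  moreover have "F = (\<lambda>\<zeta>. (kk \<zeta> - p) / (1 - cnj p * kk \<zeta>))"
    by (simp add: F_def kk_def Moebius_function_simple fun_eq_iff)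
  ultimately have "(F has_field_derivative deriv k w * of_real \<rho> / (1 - cnj p * p)) (at 0)"
    using ne \<open>kk 0 = p\<close> by (simp add: d_def)
  then have "deriv F 0 = deriv k w * of_real \<rho> / (1 - cnj p * p)"
    by (rule DERIV_imp_deriv)
  then have "norm (deriv F 0) = norm (deriv k w) * \<rho> / (1 - (norm p)\<^sup>2)"
    unfolding pp using pos \<rho> by (simp add: norm_divide norm_mult del: of_real_diff)
  with \<open>norm (deriv F 0) \<le> 1\<close> pos show ?thesis by (simp add: p_def divide_le_eq)
qed

text \<open>Harnack's inequality for the positive harmonic function \<open>Im \<beta>\<close>, from the Schwarz lemma for the
  composition of \<open>\<beta>\<close> with the Cayley transform that sends \<open>\<beta> 0\<close> to \<open>0\<close>.\<close>

lemma upper_half_plane_map_growth: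
  assumes \<beta>: "\<beta> holomorphic_on ball 0 1" and im: "\<And>z. norm z < 1 \<Longrightarrow> Im (\<beta> z) > 0"
    and z: "norm z < 1"
  shows "1 - norm z \<le> 4 / Im (\<beta> 0) * Im (\<beta> z)"
proof -
  define p where "p = \<beta> 0"
  define m where "m = (\<lambda>z. (\<beta> z - p) / (\<beta> z - cnj p))"
  have p: "Im p > 0" using im by (simp add: p_def)
  have den: "\<beta> \<zeta> - cnj p \<noteq> 0" if "norm \<zeta> < 1" for \<zeta>
    using im[OF that] p by (auto simp: complex_eq_iff)
  have sq: "(norm (\<beta> \<zeta> - cnj p))\<^sup>2 = (norm (\<beta> \<zeta> - p))\<^sup>2 + 4 * Im p * Im (\<beta> \<zeta>)" for \<zeta>
    unfolding cmod_power2 by (simp add: power2_eq_square algebra_simps)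
  have m1: "norm (m \<zeta>) < 1" if "norm \<zeta> < 1" for \<zeta>
  proof -
    have "(norm (\<beta> \<zeta> - p))\<^sup>2 < (norm (\<beta> \<zeta> - cnj p))\<^sup>2"
      using sq[of \<zeta>] mult_pos_pos[OF p im[OF that]] by linarith
    then have "norm (\<beta> \<zeta> - p) < norm (\<beta> \<zeta> - cnj p)" by (simp add: power2_less_imp_less)
    then show ?thesis using den[OF that] by (simp add: m_def norm_divide)
  qed
  have "norm (m z) \<le> norm z"
    by (rule Schwarz_Lemma(1)[OF _ _ m1 z])
       (use den in \<open>auto simp: m_def p_def intro!: holomorphic_intros \<beta>\<close>)
  then have "1 - norm z \<le> 1 - norm (m z)" by simp
  also have "\<dots> \<le> 1 - (norm (m z))\<^sup>2"
    using m1[OF z] by (simp add: power2_eq_square mult_left_le_one_le)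
  also have "\<dots> = 4 * Im p * Im (\<beta> z) / (norm (\<beta> z - cnj p))\<^sup>2"
  proof -
    have "(norm (\<beta> z - cnj p))\<^sup>2 \<noteq> 0" using den[OF z] by simp
    then have "1 - (norm (m z))\<^sup>2 = ((norm (\<beta> z - cnj p))\<^sup>2 - (norm (\<beta> z - p))\<^sup>2) / (norm (\<beta> z - cnj p))\<^sup>2"
      by (subst diff_divide_distrib) (simp add: m_def norm_divide power_divide)
    then show ?thesis by (simp add: sq)
  qed
  also have "\<dots> \<le> 4 * Im p * Im (\<beta> z) / (Im p)\<^sup>2"
  proof (rule divide_left_mono)
    have "Im p \<le> \<bar>Im (\<beta> z - cnj p)\<bar>" using im[OF z] p by simp
    also have "\<dots> \<le> norm (\<beta> z - cnj p)" by (rule abs_Im_le_cmod)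
    finally show "(Im p)\<^sup>2 \<le> (norm (\<beta> z - cnj p))\<^sup>2" using p by (intro power_mono) auto
  qed (use p im[OF z] den[OF z] in auto)
  also have "\<dots> = 4 / Im p * Im (\<beta> z)" using p by (simp add: power2_eq_square field_simps)
  finally show ?thesis by (simp add: p_def)
qed

text \<open>This lemma replaces Caratheodory's theory of prime ends. If a holomorphic map \<open>\<beta>\<close> of the unit disk into
  the upper half-plane has a holomorphic right inverse \<open>k\<close> on a half-disk resting on the real axis,
  then the image of \<open>k\<close> contains a full neighbourhood, relative to the disk, of some point of the unit
  circle. Indeed \<open>1 - |k w| \<le> A Im w\<close> by the growth lemma, so \<open>k\<close> has bounded derivative by Schwarz-Pick
  and extends to a Lipschitz map \<open>K\<close> of the closed half-disk which sends the diameter into the circle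
  and is not constant there. Take \<open>\<xi>\<close> to be a value of \<open>K\<close> on a subinterval different from
  the values at its two ends: then \<open>\<xi>\<close> has positive distance from the image of the half-circle over
  this subinterval.\<close>

lemma half_disc_right_inverse_covers:
  fixes \<beta> k :: "complex \<Rightarrow> complex" and a r :: real
  defines "\<Omega> \<equiv> ball (of_real a) r \<inter> {w. Im w > 0}"
  assumes \<beta>: "\<beta> holomorphic_on ball 0 1" and im: "\<And>z. norm z < 1 \<Longrightarrow> Im (\<beta> z) > 0"
    and r: "r > 0"
    and k: "k holomorphic_on \<Omega>" and k1: "\<And>w. w \<in> \<Omega> \<Longrightarrow> norm (k w) < 1"
    and inv: "\<And>w. w \<in> \<Omega> \<Longrightarrow> \<beta> (k w) = w"
  obtains \<xi> \<epsilon> where "norm \<xi> = 1" "\<epsilon> > 0" "ball \<xi> \<epsilon> \<inter> ball 0 1 \<subseteq> k ` \<Omega>"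
proof -
  define A where "A = 4 / Im (\<beta> 0)"
  define H where "H = {w. Im w > 0}"
  define \<Omega>' where "\<Omega>' = ball (of_real a) (r/2) \<inter> H"
  have A: "A > 0" using im[of 0] by (simp add: A_def)
  have openH: "open H" "convex H" unfolding H_def
    by (simp_all add: open_halfspace_Im_gt convex_halfspace_Im_gt)
  have sub: "\<Omega>' \<subseteq> \<Omega>" using r by (auto simp: \<Omega>'_def \<Omega>_def H_def)
  have o': "open \<Omega>'" "convex \<Omega>'" using openH by (auto simp: \<Omega>'_def intro: convex_Int)
  have injk: "inj_on k \<Omega>" using inv by (metis inj_onI)
  have b1: "1 - norm (k w) \<le> A * Im w" if "w \<in> \<Omega>" for w
    using upper_half_plane_map_growth[OF \<beta> im k1[OF that]] inv[OF that] by (simp add: A_def)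
  have dk: "norm (deriv k w) \<le> 2 * A" if w: "w \<in> \<Omega>'" for w
  proof -
    have Iw: "Im w > 0" and dw: "dist (of_real a) w < r/2" using w by (auto simp: \<Omega>'_def H_def)
    have "\<bar>Im (w - of_real a)\<bar> \<le> norm (w - of_real a)" by (rule abs_Im_le_cmod)
    then have Iw2: "Im w < r/2" using dw by (simp add: dist_norm norm_minus_commute)
    have bsub: "ball w (Im w) \<subseteq> \<Omega>"
    proof
      fix x assume "x \<in> ball w (Im w)"
      then have x: "dist w x < Im w" by simp
      have "\<bar>Im (w - x)\<bar> \<le> norm (w - x)" by (rule abs_Im_le_cmod)
      then have "Im x > 0" using x by (simp add: dist_norm)
      moreover have "dist (of_real a) x < r" using dist_triangle[of "of_real a" x w] x Iw2 dw by linarith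
      ultimately show "x \<in> \<Omega>" by (simp add: \<Omega>_def)
    qed
    have wO: "w \<in> \<Omega>" using w sub by auto
    have "norm (deriv k w) * Im w \<le> 1 - (norm (k w))\<^sup>2"
      by (rule Schwarz_Pick_deriv) (use k bsub k1 Iw holomorphic_on_subset in \<open>blast+\<close>)
    also have "\<dots> = (1 - norm (k w)) * (1 + norm (k w))" by (simp add: power2_eq_square algebra_simps)
    also have "\<dots> \<le> (A * Im w) * 2"
      using b1[OF wO] k1[OF wO] by (intro mult_mono) auto
    finally show ?thesis using Iw by (simp add: mult.commute[of _ "Im w"] mult.assoc mult.left_commute[of _ "Im w"])
  qed
  have lip: "norm (k x - k y) \<le> 2 * A * norm (x - y)" if "x \<in> \<Omega>'" "y \<in> \<Omega>'" for x y
  proof (rule field_differentiable_bound[OF o'(2)])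
    show "(k has_field_derivative deriv k z) (at z within \<Omega>')" if "z \<in> \<Omega>'" for z
      using that k sub o' by (meson holomorphic_derivI holomorphic_on_subset has_field_derivative_at_within)
  qed (use dk that in auto)
  have "(2 * A)-lipschitz_on \<Omega>' k"
    using lip A by (intro lipschitz_onI) (auto simp: dist_norm)
  then have "uniformly_continuous_on \<Omega>' k" by (rule lipschitz_on_uniformly_continuous)
  then obtain K where K: "uniformly_continuous_on (closure \<Omega>') K" "\<And>x. x \<in> \<Omega>' \<Longrightarrow> k x = K x"
    using uniformly_continuous_on_extension_on_closure[of \<Omega>' k] by metis
  have contK: "continuous_on (closure \<Omega>') K" using K(1) by (rule uniformly_continuous_imp_continuous)
  have real_closure: "of_real x \<in> closure \<Omega>'" if "\<bar>x - a\<bar> < r/2" for x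
    unfolding closure_approachable
  proof (intro allI impI)
    fix e :: real assume e: "e > 0"
    define d where "d = min e (r/2 - \<bar>x - a\<bar>) / 2"
    have d: "d > 0" "d < e" "d < r/2 - \<bar>x - a\<bar>" using e that by (auto simp: d_def min_def)
    have "of_real a - (of_real x + \<i> * of_real d) = complex_of_real (a - x) - \<i> * of_real d" by simp
    also have "norm \<dots> \<le> norm (complex_of_real (a - x)) + norm (\<i> * complex_of_real d)" by (rule norm_triangle_ineq4)
    also have "\<dots> = \<bar>x - a\<bar> + d" using d by (simp add: norm_mult abs_minus_commute del: of_real_diff)
    finally have "norm (of_real a - (of_real x + \<i> * of_real d)) \<le> \<bar>x - a\<bar> + d" .
    then have "of_real x + \<i> * of_real d \<in> \<Omega>'" using d by (simp add: \<Omega>'_def H_def dist_norm)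
    moreover have "dist (of_real x + \<i> * of_real d) (of_real x) < e" using d by (simp add: dist_norm norm_mult)
    ultimately show "\<exists>y\<in>\<Omega>'. dist y (of_real x) < e" by blast
  qed
  have K1: "norm (K x) = 1" if x: "x \<in> closure \<Omega>'" "Im x = 0" for x
  proof -
    obtain u where u: "\<And>n. u n \<in> \<Omega>'" "u \<longlonglongrightarrow> x" using x(1) by (auto simp: closure_sequential)
    have uK: "(\<lambda>n. norm (k (u n))) \<longlonglongrightarrow> norm (K x)"
    proof -
      have "u n \<in> closure \<Omega>'" for n using u(1) closure_subset by blast
      then have "(\<lambda>n. K (u n)) \<longlonglongrightarrow> K x" using continuous_on_tendsto_compose[OF contK u(2) x(1)] by simp
      then show ?thesis using K(2)[OF u(1)] by (simp add: tendsto_norm)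
    qed
    have "(\<lambda>n. A * Im (u n)) \<longlonglongrightarrow> A * Im x" by (intro tendsto_intros u)
    then have "(\<lambda>n. 1 - A * Im (u n)) \<longlonglongrightarrow> 1 - 0" using x by (intro tendsto_intros) auto
    then have "1 - 0 \<le> norm (K x)"
    proof (rule LIMSEQ_le[OF _ uK], intro exI[of _ 0] allI impI)
      fix n show "1 - A * Im (u n) \<le> norm (k (u n))" using b1[OF subsetD[OF sub u(1)], of n] by simp
    qed
    moreover have "norm (K x) \<le> 1"
    proof (rule LIMSEQ_le_const2[OF uK], intro exI[of _ 0] allI impI)
      fix n show "norm (k (u n)) \<le> 1" using k1[OF subsetD[OF sub u(1)], of n] by simp
    qed
    ultimately show ?thesis by simp
  qed
  \<comment> \<open>If \<open>K\<close> were constant on the diameter, reflection would make \<open>k\<close> constant near it, but \<open>k\<close> is injective.\<close>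
  have nonconst: "\<exists>x1 x2. \<bar>x1 - a\<bar> < r/2 \<and> \<bar>x2 - a\<bar> < r/2 \<and> x1 < x2 \<and> K (of_real x1) \<noteq> K (of_real x2)"
  proof (rule ccontr)
    assume neg: "\<not> ?thesis"
    then have eq: "K (of_real x1) = K (of_real x2)" if "\<bar>x1 - a\<bar> < r/2" "\<bar>x2 - a\<bar> < r/2" "x1 < x2" for x1 x2
      using that by blast
    have aa: "\<bar>a - a\<bar> < r/2" using r by simp
    have const: "K (of_real x) = K (of_real a)" if xa: "\<bar>x - a\<bar> < r/2" for x
      using eq[OF xa aa] eq[OF aa xa] less_linear[of x a] by metis
    define L where "L = (\<lambda>z. K z - K (of_real a))"
    define S where "S = ball (complex_of_real a) (r/2)"
    define M where "M = (\<lambda>z. if 0 \<le> Im z then L z else cnj (L (cnj z)))"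
    have Sc: "z \<in> closure \<Omega>'" if "z \<in> S" "0 \<le> Im z" for z
    proof (cases "Im z = 0")
      case True
      then have "z = of_real (Re z)" by (simp add: complex_eq_iff)
      moreover have "norm (of_real a - z) < r/2" using that by (simp add: S_def dist_norm)
      ultimately have "\<bar>Re z - a\<bar> < r/2"
        by (metis abs_minus_commute norm_of_real of_real_diff)
      then show ?thesis using real_closure \<open>z = of_real (Re z)\<close> by metis
    next
      case False
      then have "z \<in> \<Omega>'" using that by (simp add: S_def \<Omega>'_def H_def)
      then show ?thesis using closure_subset by blast
    qed
    have real0: "L z = 0" if "z \<in> S" "z \<in> \<real>" for z
    proof -
      obtain x where x: "z = of_real x" using \<open>z \<in> \<real>\<close> by (auto elim: Reals_cases)
      have "norm (complex_of_real (a - x)) < r/2" using that by (simp add: S_def dist_norm x)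
      then have "\<bar>x - a\<bar> < r/2" by (simp only: norm_of_real abs_minus_commute)
      then show ?thesis using const x by (simp add: L_def)
    qed
    have SO: "S \<inter> {z. 0 < Im z} = \<Omega>'" by (auto simp: S_def \<Omega>'_def H_def)
    have holM: "M holomorphic_on S"
      unfolding M_def
    proof (rule Schwarz_reflection)
      show "open S" by (simp add: S_def)
      show "cnj ` S \<subseteq> S"
      proof
        fix y assume "y \<in> cnj ` S"
        then obtain z where z: "y = cnj z" "z \<in> S" by auto
        have "norm (of_real a - cnj z) = norm (cnj (of_real a - z))" by simp
        also have "\<dots> = norm (of_real a - z)" by (rule complex_mod_cnj)
        finally show "y \<in> S" using z by (simp add: S_def dist_norm)
      qed
      have "K holomorphic_on \<Omega>'"
        using holomorphic_on_subset[OF k sub] K(2) by (subst holomorphic_cong[OF refl, of _ _ k]) auto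
      then show "L holomorphic_on S \<inter> {z. 0 < Im z}"
        unfolding SO L_def by (intro holomorphic_intros)
      show "continuous_on (S \<inter> {z. 0 \<le> Im z}) L"
        unfolding L_def by (intro continuous_intros continuous_on_subset[OF contK]) (use Sc in auto)
      show "L z \<in> \<real>" if "z \<in> S" "z \<in> \<real>" for z using real0 that by simp
    qed
    have lim: "of_real a islimpt S \<inter> \<real>"
      unfolding islimpt_approachable
    proof (intro allI impI)
      fix e :: real assume e: "e > 0"
      define d where "d = min e (r/2) / 2"
      have d: "d > 0" "d < e" "d < r/2" using e r by (auto simp: d_def min_def)
      show "\<exists>x'\<in>S \<inter> \<real>. x' \<noteq> of_real a \<and> dist x' (of_real a) < e"
        by (rule bexI[of _ "of_real (a + d)"]) (use d in \<open>auto simp: S_def dist_norm\<close>)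
    qed
    have M0: "M w = 0" if "w \<in> S" for w
    proof (rule analytic_continuation[OF holM _ _ _ _ lim _ that])
      show "M z = 0" if "z \<in> S \<inter> \<real>" for z
        using real0[of z] that by (auto simp: M_def complex_is_Real_iff)
    qed (use r in \<open>auto simp: S_def\<close>)
    have constk: "k w = K (of_real a)" if "w \<in> \<Omega>'" for w
      using M0[of w] that K(2)[OF that] by (auto simp: M_def L_def S_def \<Omega>'_def H_def)
    define w1 where "w1 = of_real a + \<i> * of_real (r/8)"
    define w2 where "w2 = of_real a + \<i> * of_real (r/4)"
    have "w1 \<in> \<Omega>'" "w2 \<in> \<Omega>'" using r by (auto simp: w1_def w2_def \<Omega>'_def H_def dist_norm norm_mult)
    then have "w1 = w2" using constk inv sub by (metis subsetD)
    then show False using r by (simp add: w1_def w2_def)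
  qed
  then obtain x1 x2 where x: "\<bar>x1 - a\<bar> < r/2" "\<bar>x2 - a\<bar> < r/2" "x1 < x2"
      "K (of_real x1) \<noteq> K (of_real x2)" by blast
  have btw: "\<bar>x - a\<bar> < r/2" if "x1 \<le> x" "x \<le> x2" for x using that x by (auto simp: abs_if split: if_splits)
  define \<delta> where "\<delta> = dist (K (of_real x1)) (K (of_real x2))"
  have \<delta>: "\<delta> > 0" using x by (simp add: \<delta>_def)
  have "continuous_on {x1..x2} (\<lambda>x. dist (K (of_real x1)) (K (of_real x)))"
    by (intro continuous_intros continuous_on_compose2[OF contK]) (use btw real_closure in auto)
  \<comment> \<open>At half the distance from \<open>K x1\<close> to \<open>K x2\<close>, the value \<open>K x0\<close> differs from both.\<close>
  then obtain x0 where x0: "x1 \<le> x0" "x0 \<le> x2" "dist (K (of_real x1)) (K (of_real x0)) = \<delta>/2"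
    using IVT'[of "\<lambda>x. dist (K (of_real x1)) (K (of_real x))" x1 "\<delta>/2" x2] \<delta> x by (auto simp: \<delta>_def)
  define \<xi> where "\<xi> = K (of_real x0)"
  have \<xi>1: "\<xi> \<noteq> K (of_real x1)" using x0 \<delta> by (auto simp: \<xi>_def)
  have \<xi>2: "\<xi> \<noteq> K (of_real x2)" using x0 \<delta> by (auto simp: \<xi>_def \<delta>_def)
  then have x0s: "x1 < x0" "x0 < x2" using \<xi>1 x0 by (auto simp: \<xi>_def less_le)
  define m where "m = (x1 + x2) / 2"
  define \<rho> where "\<rho> = (x2 - x1) / 2"
  have \<rho>: "\<rho> > 0" using x by (simp add: \<rho>_def)
  define \<Omega>2 where "\<Omega>2 = ball (of_real m) \<rho> \<inter> H"
  have ma: "\<bar>m - a\<bar> + \<rho> < r/2" using x by (auto simp: m_def \<rho>_def abs_if field_simps split: if_splits)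
  have cb: "cball (of_real m) \<rho> \<subseteq> ball (complex_of_real a) (r/2)"
  proof
    fix z assume "z \<in> cball (complex_of_real m) \<rho>"
    then show "z \<in> ball (of_real a) (r/2)"
      using dist_triangle[of "of_real a" z "of_real m"] ma by (simp add: dist_of_real dist_real_def abs_minus_commute)
  qed
  have sub2: "\<Omega>2 \<subseteq> \<Omega>'" using cb by (auto simp: \<Omega>2_def \<Omega>'_def)
  have clsub: "closure \<Omega>2 \<subseteq> closure \<Omega>'" by (rule closure_mono[OF sub2])
  have clO: "dist (of_real m) z \<le> \<rho> \<and> Im z \<ge> 0" if "z \<in> closure \<Omega>2" for z
  proof -
    have "\<Omega>2 \<subseteq> cball (of_real m) \<rho> \<inter> {z. Im z \<ge> 0}" by (auto simp: \<Omega>2_def H_def)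
    then have "closure \<Omega>2 \<subseteq> cball (of_real m) \<rho> \<inter> {z. Im z \<ge> 0}"
      by (rule closure_minimal) (auto intro!: closed_Int closed_halfspace_Im_ge)
    then show ?thesis using that by auto
  qed
  \<comment> \<open>The closed half-circle over \<open>[x1, x2]\<close>.\<close>
  define \<Gamma> where "\<Gamma> = closure \<Omega>2 - ball (of_real m) \<rho>"
  have comp: "compact (closure \<Omega>2)" by (simp add: \<Omega>2_def bounded_Int compact_closure)
  have compG: "compact \<Gamma>" unfolding \<Gamma>_def by (intro compact_diff comp) auto
  have "\<xi> \<notin> K ` \<Gamma>"
  proof
    assume "\<xi> \<in> K ` \<Gamma>"
    then obtain z where z: "z \<in> closure \<Omega>2" "dist (of_real m) z \<ge> \<rho>" "\<xi> = K z" by (auto simp: \<Gamma>_def)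
    have dz: "dist (of_real m) z = \<rho>" "Im z \<ge> 0" using clO[OF z(1)] z(2) by auto
    have n1: "norm \<xi> = 1" unfolding \<xi>_def
      by (rule K1) (use real_closure btw x0s in auto)
    show False
    proof (cases "Im z = 0")
      case True
      then have zr: "z = of_real (Re z)" by (simp add: complex_eq_iff)
      then have "\<bar>m - Re z\<bar> = \<rho>" using dz(1) by (metis dist_of_real dist_real_def)
      then have "Re z = x1 \<or> Re z = x2" by (auto simp: m_def \<rho>_def abs_if field_simps split: if_splits)
      then show False using \<xi>1 \<xi>2 z(3) zr by metis
    next
      case False
      then have "z \<in> \<Omega>'" using cb dz by (auto simp: \<Omega>'_def H_def)
      then have "norm (K z) < 1" using K(2) k1 sub by (metis subsetD)
      then show False using n1 z(3) by simp
    qed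
  qed
  then have "K ` \<Gamma> \<subseteq> - {\<xi>}" by auto
  moreover have "closed (K ` \<Gamma>)"
    by (intro compact_imp_closed compact_continuous_image[OF _ compG] continuous_on_subset[OF contK])
       (use clsub in \<open>auto simp: \<Gamma>_def\<close>)
  ultimately obtain \<epsilon> where \<epsilon>: "\<epsilon> > 0" "ball \<xi> \<epsilon> \<subseteq> - (K ` \<Gamma>)"
    using open_contains_ball[of "- (K ` \<Gamma>)"] by (metis ComplI \<open>\<xi> \<notin> K ` \<Gamma>\<close> open_Compl)
  have openW: "open (k ` \<Omega>2)"
  proof (rule open_mapping_thm3)
    show "open \<Omega>2" using openH by (auto simp: \<Omega>2_def)
    show "k holomorphic_on \<Omega>2" using k sub sub2 holomorphic_on_subset by blast
    show "inj_on k \<Omega>2" using injk sub sub2 inj_on_subset by blast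
  qed
  have x0cl: "of_real x0 \<in> closure \<Omega>'" using real_closure btw x0s by auto
  have n1: "norm \<xi> = 1" unfolding \<xi>_def by (rule K1) (use x0cl in auto)
  have "ball \<xi> \<epsilon> \<inter> ball 0 1 \<subseteq> k ` \<Omega>2"
  proof (rule ccontr)
    assume neg: "\<not> ?thesis"
    \<comment> \<open>A frontier point of the image inside the unit disk can only come from the half-circle \<open>\<Gamma>\<close>.\<close>
    have "(ball \<xi> \<epsilon> \<inter> ball 0 1) \<inter> frontier (k ` \<Omega>2) \<noteq> {}"
    proof (rule connected_Int_frontier)
      show "connected (ball \<xi> \<epsilon> \<inter> ball 0 1)" by (intro convex_connected convex_Int convex_ball)
      show "(ball \<xi> \<epsilon> \<inter> ball 0 1) - k ` \<Omega>2 \<noteq> {}" using neg by auto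
      show "(ball \<xi> \<epsilon> \<inter> ball 0 1) \<inter> k ` \<Omega>2 \<noteq> {}"
      proof -
        obtain d where d: "d > 0" "\<And>z. z \<in> closure \<Omega>' \<Longrightarrow> dist z (of_real x0) < d \<Longrightarrow> dist (K z) \<xi> < \<epsilon>"
          using contK x0cl \<epsilon>(1) unfolding continuous_on_iff \<xi>_def by metis
        have ab: "\<bar>m - x0\<bar> < \<rho>" using x0s by (auto simp: m_def \<rho>_def abs_if field_simps)
        define t where "t = min d (\<rho> - \<bar>m - x0\<bar>) / 2"
        have t: "t > 0" "t < d" "t < \<rho> - \<bar>m - x0\<bar>" using d(1) ab by (auto simp: t_def min_def)
        define z where "z = of_real x0 + \<i> * of_real t"
        have "dist (of_real m) z \<le> dist (complex_of_real m) (of_real x0) + dist (of_real x0) z"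
          by (rule dist_triangle)
        also have "\<dots> = \<bar>m - x0\<bar> + t" using t by (simp add: z_def dist_of_real) (simp add: dist_norm norm_mult)
        finally have zO: "z \<in> \<Omega>2" using t by (simp add: \<Omega>2_def H_def) (simp add: z_def)
        have zO': "z \<in> \<Omega>'" using zO sub2 by blast
        have "dist z (of_real x0) < d" using t by (simp add: z_def dist_norm norm_mult)
        then have "dist (K z) \<xi> < \<epsilon>" using d(2) zO' closure_subset by blast
        then have "k z \<in> ball \<xi> \<epsilon> \<inter> ball 0 1" using K(2)[OF zO'] k1[OF subsetD[OF sub zO']] by (simp add: dist_commute)
        then show ?thesis using zO by blast
      qed
    qed
    then obtain p where p: "p \<in> ball \<xi> \<epsilon>" "norm p < 1" "p \<in> closure (k ` \<Omega>2)" "p \<notin> k ` \<Omega>2"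
      using openW by (auto simp: frontier_def interior_open)
    have "closure (k ` \<Omega>2) \<subseteq> K ` closure \<Omega>2"
    proof (rule closure_minimal)
      show "k ` \<Omega>2 \<subseteq> K ` closure \<Omega>2" using K(2) sub2 closure_subset by (metis image_mono image_cong subsetD subsetI)
      show "closed (K ` closure \<Omega>2)"
        by (intro compact_imp_closed compact_continuous_image[OF _ comp] continuous_on_subset[OF contK clsub])
    qed
    then obtain z where z: "z \<in> closure \<Omega>2" "p = K z" using p by auto
    have "z \<notin> \<Gamma>" using p(1) z \<epsilon>(2) by auto
    then have zb: "dist (of_real m) z < \<rho>" using z by (auto simp: \<Gamma>_def)
    show False
    proof (cases "Im z = 0")
      case True
      then have "norm p = 1" using K1 z clsub by auto
      then show False using p by simp
    next
      case False
      then have "z \<in> \<Omega>2" using clO[OF z(1)] zb by (auto simp: \<Omega>2_def H_def)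
      then show False using p(4) z(2) K(2) sub2 by (metis imageI subsetD)
    qed
  qed
  then have "ball \<xi> \<epsilon> \<inter> ball 0 1 \<subseteq> k ` \<Omega>" using sub sub2 by blast
  with n1 \<epsilon>(1) that show ?thesis by blast
qed

section \<open>Backward iteration along translation orbits\<close>

text \<open>Brouwer's theorem gives the preimages, and the derivative bound makes \<open>w \<mapsto> w + \<eta> w\<close> injective.\<close>

lemma perturbed_identity_inverse:
  fixes \<eta> :: "complex \<Rightarrow> complex"
  assumes D: "open D" "convex D" and \<eta>: "\<eta> holomorphic_on D" and \<epsilon>: "\<epsilon> > 0"
    and small: "\<And>w. w \<in> D \<Longrightarrow> norm (\<eta> w) \<le> \<epsilon>"
    and contr: "\<And>w. w \<in> D \<Longrightarrow> norm (deriv \<eta> w) \<le> 1/2"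
    and D': "\<And>w. w \<in> D' \<Longrightarrow> cball w \<epsilon> \<subseteq> D"
  obtains g where "g holomorphic_on D'"
    "\<And>w. w \<in> D' \<Longrightarrow> g w \<in> D \<and> g w + \<eta> (g w) = w \<and> norm (g w - w) \<le> \<epsilon>"
proof -
  define F where "F = (\<lambda>w. w + \<eta> w)"
  have holF: "F holomorphic_on D" unfolding F_def by (intro holomorphic_intros \<eta>)
  have inj: "inj_on F D"
  proof (rule inj_onI)
    fix x y assume xy: "x \<in> D" "y \<in> D" "F x = F y"
    have "norm (\<eta> x - \<eta> y) \<le> 1/2 * norm (x - y)"
    proof (rule field_differentiable_bound[OF D(2)])
      show "(\<eta> has_field_derivative deriv \<eta> z) (at z within D)" if "z \<in> D" for z
        using that \<eta> D by (meson holomorphic_derivI has_field_derivative_at_within)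
    qed (use contr xy in auto)
    moreover have "\<eta> x - \<eta> y = - (x - y)" using xy(3) by (simp add: F_def algebra_simps)
    ultimately have "norm (x - y) \<le> 1/2 * norm (x - y)" by (metis norm_minus_cancel)
    then show "x = y" by simp
  qed
  obtain g where g: "g holomorphic_on (F ` D)" "\<And>z. z \<in> D \<Longrightarrow> g (F z) = z"
    using holomorphic_has_inverse[OF holF D(1) inj] by metis
  have ex: "\<exists>v\<in>D. F v = w \<and> norm (v - w) \<le> \<epsilon>" if w: "w \<in> D'" for w
  proof -
    have "continuous_on (cball w \<epsilon>) (\<lambda>v. w - \<eta> v)"
      using holomorphic_on_imp_continuous_on[OF \<eta>] D'[OF w]
      by (intro continuous_intros) (auto intro: continuous_on_subset)
    moreover have "(\<lambda>v. w - \<eta> v) \<in> cball w \<epsilon> \<rightarrow> cball w \<epsilon>"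
      using D'[OF w] small by (auto simp: dist_norm)
    ultimately obtain v where v: "v \<in> cball w \<epsilon>" "w - \<eta> v = v"
      using brouwer_ball[OF \<epsilon>] by metis
    then have "F v = w" by (metis F_def diff_add_cancel)
    with v D'[OF w] show ?thesis by (auto simp: dist_norm norm_minus_commute)
  qed
  show ?thesis
  proof
    have "D' \<subseteq> F ` D" using ex by blast
    then show "g holomorphic_on D'" using g holomorphic_on_subset by blast
    show "g w \<in> D \<and> g w + \<eta> (g w) = w \<and> norm (g w - w) \<le> \<epsilon>" if "w \<in> D'" for w
      using ex[OF that] g(2) by (auto simp: F_def)
  qed
qed

text \<open>Backward iteration along translation orbits. Put \<open>F k w = w + h (w + k)\<close>, so that
  \<open>f (w + k) = F k w + (k + 1)\<close>. By assumption \<open>F k\<close> moves points of the neighbourhood \<open>D k\<close> of \<open>\<Omega>\<close>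
  by at most the difference of the radii \<open>c exp (- k)\<close> and \<open>c exp (- (k + 1))\<close>, so it has a holomorphic
  inverse \<open>g k\<close> from \<open>D (k + 1)\<close> into \<open>D k\<close>. The compositions \<open>g 0 \<circ> \<dots> \<circ> g (n - 1)\<close> stay within
  distance \<open>c\<close> of the identity, and a limit function \<open>G\<close> of theirs assigns to \<open>w\<close> a point whose
  \<open>f\<close>-orbit is asymptotic to \<open>w + m\<close>.\<close>

lemma translation_orbits_shadowed:
  fixes h :: "complex \<Rightarrow> complex" and c :: real and \<Omega> :: "complex set"
  defines "f \<equiv> \<lambda>z. z + 1 + h z"
    and "D \<equiv> \<lambda>k::nat. \<Union>u\<in>\<Omega>. ball u (c * exp (- real k))"
  assumes h: "h holomorphic_on UNIV" and \<Omega>: "open \<Omega>" "convex \<Omega>" and c: "c > 0"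
    and small: "\<And>k w. w \<in> D k \<Longrightarrow> norm (h (w + of_nat k)) \<le> c * (exp (- real k) - exp (- real (Suc k)))"
    and contr: "\<And>k w. w \<in> D k \<Longrightarrow> norm (deriv h (w + of_nat k)) \<le> 1/2"
  obtains G where "G holomorphic_on \<Omega>"
    "\<And>w m. w \<in> \<Omega> \<Longrightarrow> norm ((f ^^ m) (G w) - (w + of_nat m)) \<le> c * exp (- real m)"
proof -
  define \<epsilon> where "\<epsilon> = (\<lambda>k::nat. c * (exp (- real k) - exp (- real (Suc k))))"
  have \<epsilon>: "\<epsilon> k > 0" for k using c by (simp add: \<epsilon>_def)
  have openD: "open (D k)" for k by (auto simp: D_def)
  have convD: "convex (D k)" for k
  proof -
    have "D k = (\<Union>x\<in>\<Omega>. \<Union>y\<in>ball 0 (c * exp (- real k)). {x + y})"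
    proof (intro equalityI subsetI)
      fix w assume "w \<in> D k"
      then obtain u where "u \<in> \<Omega>" "dist u w < c * exp (- real k)" by (auto simp: D_def)
      then have "w = u + (w - u)" "w - u \<in> ball 0 (c * exp (- real k))" by (auto simp: dist_norm norm_minus_commute)
      then show "w \<in> (\<Union>x\<in>\<Omega>. \<Union>y\<in>ball 0 (c * exp (- real k)). {x + y})" using \<open>u \<in> \<Omega>\<close> by blast
    next
      fix w assume "w \<in> (\<Union>x\<in>\<Omega>. \<Union>y\<in>ball 0 (c * exp (- real k)). {x + y})"
      then obtain u y where "u \<in> \<Omega>" "norm y < c * exp (- real k)" "w = u + y" by auto
      then show "w \<in> D k" unfolding D_def by (intro UN_I[of u]) (auto simp: dist_norm)
    qed
    then show ?thesis using convex_sums[OF \<Omega>(2) convex_ball] by metis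
  qed
  have subD: "cball w (\<epsilon> k) \<subseteq> D k" if wD: "w \<in> D (Suc k)" for w k
  proof
    fix x assume x: "x \<in> cball w (\<epsilon> k)"
    obtain u where u: "u \<in> \<Omega>" "dist u w < c * exp (- real (Suc k))"
      using wD unfolding D_def mem_ball UN_iff by blast
    have "dist u x < c * exp (- real k)"
      using dist_triangle[of u x w] x u by (simp add: \<epsilon>_def algebra_simps)
    then show "x \<in> D k" using u by (auto simp: D_def)
  qed
  have "\<exists>g. g holomorphic_on D (Suc k) \<and> (\<forall>w\<in>D (Suc k). g w \<in> D k \<and>
      g w + h (g w + of_nat k) = w \<and> norm (g w - w) \<le> \<epsilon> k)" for k
  proof -
    have der: "deriv (\<lambda>w. h (w + of_nat k)) w = deriv h (w + of_nat k)" for w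
    proof (rule DERIV_imp_deriv)
      have "(h has_field_derivative deriv h (w + of_nat k)) (at (w + of_nat k))"
        using h by (intro holomorphic_derivI[OF h]) auto
      then have "((\<lambda>w. h (w + of_nat k)) has_field_derivative deriv h (w + of_nat k) * 1) (at w)"
        by (intro DERIV_chain'[where g = h and f = "\<lambda>w. w + of_nat k"]) (auto intro!: derivative_eq_intros)
      then show "((\<lambda>w. h (w + of_nat k)) has_field_derivative deriv h (w + of_nat k)) (at w)" by simp
    qed
    have "(\<lambda>w. h (w + of_nat k)) holomorphic_on D k"
      by (intro holomorphic_on_compose_gen[OF _ h, unfolded o_def] holomorphic_intros) auto
    then show ?thesis
      using perturbed_identity_inverse[OF openD convD _ \<epsilon>, of "\<lambda>w. h (w + of_nat k)" k k "D (Suc k)"]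
        small contr subD der by (metis \<epsilon>_def)
  qed
  then obtain g where g: "\<And>k. g k holomorphic_on D (Suc k)"
    "\<And>k w. w \<in> D (Suc k) \<Longrightarrow> g k w \<in> D k \<and> g k w + h (g k w + of_nat k) = w \<and> norm (g k w - w) \<le> \<epsilon> k"
    by metis
  define P where "P = rec_nat id (\<lambda>n p. p \<circ> g n)"
  have P0: "P 0 = id" and PS: "P (Suc n) = P n \<circ> g n" for n by (simp_all add: P_def)
  have holP: "P n holomorphic_on D n" for n
  proof (induction n)
    case (Suc n)
    then show ?case unfolding PS
      by (rule holomorphic_on_compose_gen[OF g(1)]) (use g(2) in auto)
  qed (simp add: P0 id_def)
  have orbit: "(f ^^ n) (P n w) = w + of_nat n" if "w \<in> D n" for n w
    using that
  proof (induction n arbitrary: w)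
    case (Suc n)
    have "(f ^^ Suc n) (P (Suc n) w) = f ((f ^^ n) (P n (g n w)))" by (simp add: PS)
    also have "\<dots> = f (g n w + of_nat n)" using Suc g(2) by simp
    also have "\<dots> = (g n w + h (g n w + of_nat n)) + of_nat (Suc n)" by (simp add: f_def algebra_simps)
    also have "\<dots> = w + of_nat (Suc n)" using g(2)[OF Suc.prems] by simp
    finally show ?case .
  qed (simp add: P0)
  have shadow: "norm ((f ^^ m) (P n w) - (w + of_nat m)) \<le> c * (exp (- real m) - exp (- real n))"
    if "w \<in> D n" "m \<le> n" for n m w
    using that
  proof (induction n arbitrary: w)
    case 0
    then show ?case using orbit[of w 0] by simp
  next
    case (Suc n)
    show ?case
    proof (cases "m = Suc n")
      case True
      then show ?thesis using orbit[OF Suc.prems(1)] by simp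
    next
      case False
      define v where "v = g n w"
      have v: "v \<in> D n" "norm (v - w) \<le> \<epsilon> n" using g(2)[OF Suc.prems(1)] by (auto simp: v_def)
      have "(f ^^ m) (P (Suc n) w) - (w + of_nat m) = ((f ^^ m) (P n v) - (v + of_nat m)) + (v - w)"
        by (simp add: PS v_def)
      also have "norm \<dots> \<le> norm ((f ^^ m) (P n v) - (v + of_nat m)) + norm (v - w)" by (rule norm_triangle_ineq)
      also have "\<dots> \<le> c * (exp (- real m) - exp (- real n)) + \<epsilon> n"
        using Suc.IH[OF v(1)] v(2) Suc.prems(2) False by (intro add_mono) auto
      also have "\<dots> = c * (exp (- real m) - exp (- real (Suc n)))" by (simp add: \<epsilon>_def algebra_simps)
      finally show ?thesis .
    qed
  qed
  have OD: "\<Omega> \<subseteq> D n" for n using c by (force simp: D_def)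
  have near: "norm (P n w) \<le> norm w + c" if "w \<in> \<Omega>" for n w
  proof -
    have "norm (P n w - w) \<le> c * (exp (- real 0) - exp (- real n))"
      using shadow[of w n 0] that OD by auto
    also have "\<dots> \<le> c" using c by (simp add: algebra_simps)
    finally show ?thesis using norm_triangle_ineq2[of "P n w" w] by linarith
  qed
  obtain G r where G: "G holomorphic_on \<Omega>" "strict_mono (r :: nat \<Rightarrow> nat)"
    "\<And>w. w \<in> \<Omega> \<Longrightarrow> (\<lambda>n. P (r n) w) \<longlonglongrightarrow> G w"
  proof (rule Montel[OF \<Omega>(1), of "range P" P])
    show "p holomorphic_on \<Omega>" if "p \<in> range P" for p using that holP OD holomorphic_on_subset by blast
    show "\<exists>B. \<forall>h\<in>range P. \<forall>z\<in>K. norm (h z) \<le> B" if K: "compact K" "K \<subseteq> \<Omega>" for K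
    proof -
      obtain b where "\<forall>z\<in>K. norm z \<le> b" using compact_imp_bounded[OF K(1)] by (auto simp: bounded_iff)
      then have "norm (P n z) \<le> b + c" if "z \<in> K" for n z
        using near[OF subsetD[OF K(2) that], of n] that by force
      then show ?thesis by (intro exI[of _ "b + c"]) auto
    qed
  qed auto
  have holf: "f holomorphic_on UNIV" unfolding f_def by (intro holomorphic_intros h)
  have contf: "continuous_on UNIV (f ^^ m)" for m
  proof (induction m)
    case (Suc m)
    then show ?case
      using continuous_on_compose[OF Suc, of f] holomorphic_on_imp_continuous_on[OF holf]
        continuous_on_subset by (auto simp: o_def)
  qed (simp add: id_def)
  show ?thesis
  proof
    fix w m assume w: "w \<in> \<Omega>"
    have "(\<lambda>n. (f ^^ m) (P (r n) w)) \<longlonglongrightarrow> (f ^^ m) (G w)"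
      by (rule continuous_on_tendsto_compose[OF contf G(3)[OF w]]) auto
    then have lim: "(\<lambda>n. norm ((f ^^ m) (P (r n) w) - (w + of_nat m))) \<longlonglongrightarrow> norm ((f ^^ m) (G w) - (w + of_nat m))"
      by (intro tendsto_intros)
    show "norm ((f ^^ m) (G w) - (w + of_nat m)) \<le> c * exp (- real m)"
    proof (rule LIMSEQ_le_const2[OF lim], intro exI[of _ m] allI impI)
      fix n assume "m \<le> n"
      then have "m \<le> r n" using seq_suble[OF G(2), of n] by linarith
      then have "norm ((f ^^ m) (P (r n) w) - (w + of_nat m)) \<le> c * (exp (- real m) - exp (- real (r n)))"
        using shadow w OD by blast
      also have "\<dots> \<le> c * exp (- real m)" using c by simp
      finally show "norm ((f ^^ m) (P (r n) w) - (w + of_nat m)) \<le> c * exp (- real m)" .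
    qed
  qed (use G in auto)
qed

lemma continuous_near_identity_surj:
  fixes \<psi> :: "complex \<Rightarrow> complex"
  assumes "\<rho> > 0" "continuous_on (cball w \<rho>) \<psi>" "\<And>z. z \<in> cball w \<rho> \<Longrightarrow> norm (\<psi> z - z) \<le> \<rho>"
  obtains u where "u \<in> cball w \<rho>" "\<psi> u = w"
proof -
  have 1: "continuous_on (cball w \<rho>) (\<lambda>z. w - (\<psi> z - z))" by (intro continuous_intros assms)
  have 2: "(\<lambda>z. w - (\<psi> z - z)) \<in> cball w \<rho> \<rightarrow> cball w \<rho>"
    using assms(3) by (auto simp: dist_norm)
  obtain u where u: "u \<in> cball w \<rho>" "w - (\<psi> u - u) = u"
    by (rule brouwer_ball[OF assms(1) 1 2])
  have "w = u + (\<psi> u - u)" using u(2) by (simp only: diff_eq_eq)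
  then have "\<psi> u = w" by simp
  with u(1) show thesis by (rule that)
qed

section \<open>Escaping orbits, Fatou components and cluster sets\<close>

lemma monoseq_nat_cases:
  fixes s :: "nat \<Rightarrow> nat"
  assumes "monoseq s"
  shows "(\<exists>N. \<forall>\<^sub>F j in sequentially. s j = N) \<or> (\<forall>N. \<forall>\<^sub>F j in sequentially. s j \<ge> N)"
proof (cases "decseq s")
  case True
  define N where "N = (LEAST x. x \<in> range s)"
  have "N \<in> range s" unfolding N_def by (rule LeastI_ex) auto
  then obtain i where i: "s i = N" by auto
  have "s j = N" if "j \<ge> i" for j
    using decseqD[OF True that] i Least_le[of "\<lambda>x. x \<in> range s" "s j"] by (auto simp: N_def)
  then show ?thesis unfolding eventually_sequentially by blast
next
  case False
  then have inc: "incseq s" using assms by (auto simp: monoseq_iff)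
  show ?thesis
  proof (cases "\<forall>N. \<exists>i. s i \<ge> N")
    case True
    have "\<forall>\<^sub>F j in sequentially. s j \<ge> N" for N
    proof -
      obtain i where "s i \<ge> N" using True by blast
      then show ?thesis unfolding eventually_sequentially using inc by (meson incseqD order_trans)
    qed
    then show ?thesis by blast
  next
    case False
    then obtain B where B: "\<And>i. s i < B" by (meson not_le)
    then have "range s \<subseteq> {..<B}" by auto
    then have fin: "finite (range s)" by (rule finite_subset) simp
    define N where "N = Max (range s)"
    have "N \<in> range s" unfolding N_def using fin by (intro Max_in) auto
    then obtain i where i: "s i = N" by auto
    have "s j = N" if "j \<ge> i" for j
      using incseqD[OF inc that] i Max_ge[OF fin, of "s j"] by (auto simp: N_def)
    then show ?thesis unfolding eventually_sequentially by blast
  qed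
qed

lemma holomorphic_on_funpow:
  assumes "f holomorphic_on UNIV"
  shows "(f ^^ n) holomorphic_on S"
proof (induction n)
  case (Suc n)
  have "(f \<circ> f ^^ n) holomorphic_on S"
    by (rule holomorphic_on_compose_gen[OF Suc assms]) auto
  then show ?case by (simp add: o_def)
qed (simp add: id_def)

lemma loc_unif_tendsto_infinityD:
  assumes "loc_unif_tendsto_infinity D g" "compact K" "K \<subseteq> D"
  shows "\<forall>\<^sub>F n in sequentially. \<forall>z\<in>K. norm (g n z) > M"
  using assms unfolding loc_unif_tendsto_infinity_def by simp

lemma normal_on_iterates_if_tendsto_infinity:
  assumes f: "f holomorphic_on UNIV" and inf: "loc_unif_tendsto_infinity D (\<lambda>n. f ^^ n)"
  shows "normal_on D (range (\<lambda>n. f ^^ n))"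
  unfolding normal_on_def
proof (intro allI impI)
  fix g :: "nat \<Rightarrow> complex \<Rightarrow> complex"
  assume "range g \<subseteq> range (\<lambda>n. f ^^ n)"
  then have "\<forall>j. \<exists>n. g j = f ^^ n" by blast
  then obtain s where s: "\<And>j. g j = f ^^ s j" by metis
  obtain r where r: "strict_mono r" "monoseq (\<lambda>j. s (r j))" using seq_monosub by blast
  from monoseq_nat_cases[OF r(2)] show "\<exists>r. strict_mono r \<and>
      ((\<exists>h. h holomorphic_on D \<and> loc_unif_tendsto D (g \<circ> r) h) \<or> loc_unif_tendsto_infinity D (g \<circ> r))"
  proof
    assume "\<exists>N. \<forall>\<^sub>F j in sequentially. s (r j) = N"
    then obtain N where N: "\<forall>\<^sub>F j in sequentially. s (r j) = N" by blast
    have "uniform_limit K (g \<circ> r) (f ^^ N) sequentially" for K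
      by (rule uniform_limitI, rule eventually_mono[OF N]) (simp add: s)
    then have "loc_unif_tendsto D (g \<circ> r) (f ^^ N)" by (simp add: loc_unif_tendsto_def)
    then show ?thesis using r(1) holomorphic_on_funpow[OF f] by blast
  next
    assume N: "\<forall>N. \<forall>\<^sub>F j in sequentially. N \<le> s (r j)"
    have "loc_unif_tendsto_infinity D (g \<circ> r)"
      unfolding loc_unif_tendsto_infinity_def
    proof (intro allI impI)
      fix K M assume "compact K \<and> K \<subseteq> D"
      then have "\<forall>\<^sub>F n in sequentially. \<forall>z\<in>K. norm ((f ^^ n) z) > M"
        by (intro loc_unif_tendsto_infinityD[OF inf]) auto
      then obtain N0 where N0: "\<And>n. n \<ge> N0 \<Longrightarrow> \<forall>z\<in>K. norm ((f ^^ n) z) > M"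
        unfolding eventually_sequentially by blast
      show "\<forall>\<^sub>F n in sequentially. \<forall>z\<in>K. norm ((g \<circ> r) n z) > M"
        by (rule eventually_mono[OF spec[OF N, of N0]]) (use N0 s in auto)
    qed
    then show ?thesis using r(1) by blast
  qed
qed

lemma open_fatou_set: "open (fatou_set f)"
proof (subst open_subopen, intro ballI)
  fix z assume "z \<in> fatou_set f"
  then obtain D where "open D" "connected D" "z \<in> D" "normal_on D (range (\<lambda>n. f ^^ n))"
    by (auto simp: fatou_set_def)
  then show "\<exists>T. open T \<and> z \<in> T \<and> T \<subseteq> fatou_set f"
    by (intro exI[of _ D]) (auto simp: fatou_set_def)
qed

text \<open>On a set of normality, in the sense of the dichotomy in the definition, a single escaping point forces all orbits to escape locally
  uniformly, since a finite limit function is excluded at that point.\<close>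

lemma normal_on_iterates_escape:
  assumes D: "normal_on D (range (\<lambda>n. f ^^ n))" and p: "p \<in> D"
    and esc: "\<And>M. \<forall>\<^sub>F n in sequentially. norm ((f ^^ n) p) > M"
  shows "loc_unif_tendsto_infinity D (\<lambda>n. f ^^ n)"
  unfolding loc_unif_tendsto_infinity_def
proof (intro allI impI, rule ccontr)
  fix K :: "complex set" and M :: real
  assume K: "compact K \<and> K \<subseteq> D" and neg: "\<not> (\<forall>\<^sub>F n in sequentially. \<forall>z\<in>K. norm ((f ^^ n) z) > M)"
  define T where "T = {n. \<not> (\<forall>z\<in>K. norm ((f ^^ n) z) > M)}"
  have "infinite T" unfolding infinite_nat_iff_unbounded_le
    using neg by (auto simp: T_def eventually_sequentially)
  then obtain s :: "nat \<Rightarrow> nat" where s: "strict_mono s" "\<And>n. s n \<in> T"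
    using infinite_enumerate by blast
  define g where "g = (\<lambda>j. f ^^ s j)"
  have "range g \<subseteq> range (\<lambda>n. f ^^ n)" by (auto simp: g_def)
  then obtain r where r: "strict_mono r"
    "(\<exists>h. h holomorphic_on D \<and> loc_unif_tendsto D (g \<circ> r) h) \<or> loc_unif_tendsto_infinity D (g \<circ> r)"
    using D unfolding normal_on_def by blast
  have sr: "strict_mono (s \<circ> r)" using s r by (simp add: strict_mono_o)
  from r(2) show False
  proof
    assume "\<exists>h. h holomorphic_on D \<and> loc_unif_tendsto D (g \<circ> r) h"
    then obtain h where "loc_unif_tendsto D (g \<circ> r) h" by blast
    moreover have "compact {p} \<and> {p} \<subseteq> D" using p by simp
    ultimately have "uniform_limit {p} (g \<circ> r) h sequentially" unfolding loc_unif_tendsto_def by metis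
    then have "(\<lambda>j. (f ^^ s (r j)) p) \<longlonglongrightarrow> h p"
      using tendsto_uniform_limitI[where x = p] by (fastforce simp: g_def)
    then have "(\<lambda>j. norm ((f ^^ s (r j)) p)) \<longlonglongrightarrow> norm (h p)" by (rule tendsto_norm)
    then have "\<forall>\<^sub>F j in sequentially. norm ((f ^^ s (r j)) p) < norm (h p) + 1"
      by (rule order_tendstoD(2)) simp
    moreover have "\<forall>\<^sub>F j in sequentially. norm ((f ^^ s (r j)) p) > norm (h p) + 1"
      using eventually_subseq[OF sr esc[of "norm (h p) + 1"]] by simp
    ultimately have "\<forall>\<^sub>F j in sequentially. False" by eventually_elim simp
    then show False by simp
  next
    assume lu: "loc_unif_tendsto_infinity D (g \<circ> r)"
    have "\<forall>\<^sub>F n in sequentially. \<forall>z\<in>K. norm ((g \<circ> r) n z) > M"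
      using K by (intro loc_unif_tendsto_infinityD[OF lu]) auto
    then obtain n where "\<forall>z\<in>K. norm ((g \<circ> r) n z) > M" by (auto simp: eventually_sequentially)
    then have "s (r n) \<notin> T" by (simp add: T_def g_def)
    then show False using s by blast
  qed
qed

lemma fatou_component_escape:
  assumes U: "connected U" "U \<subseteq> fatou_set f" and p: "p \<in> U"
    and esc: "\<And>M. \<forall>\<^sub>F n in sequentially. norm ((f ^^ n) p) > M"
  shows "loc_unif_tendsto_infinity U (\<lambda>n. f ^^ n)"
proof -
  define Esc where "Esc = {z. \<forall>M. \<forall>\<^sub>F n in sequentially. norm ((f ^^ n) z) > M}"
  have "\<forall>z\<in>U. \<exists>D. open D \<and> z \<in> D \<and> normal_on D (range (\<lambda>n. f ^^ n))"
    using U(2) by (auto simp: fatou_set_def)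
  then obtain D where D: "\<And>z. z \<in> U \<Longrightarrow> open (D z)" "\<And>z. z \<in> U \<Longrightarrow> z \<in> D z"
    "\<And>z. z \<in> U \<Longrightarrow> normal_on (D z) (range (\<lambda>n. f ^^ n))" by metis
  have lu: "loc_unif_tendsto_infinity (D z) (\<lambda>n. f ^^ n)" if "z \<in> U" "D z \<inter> Esc \<noteq> {}" for z
    using that normal_on_iterates_escape[OF D(3)[OF that(1)]] by (auto simp: Esc_def)
  have DE: "D z \<subseteq> Esc" if "z \<in> U" "D z \<inter> Esc \<noteq> {}" for z
  proof
    fix y assume "y \<in> D z"
    then have "\<forall>\<^sub>F n in sequentially. \<forall>x\<in>{y}. norm ((f ^^ n) x) > M" for M
      by (intro loc_unif_tendsto_infinityD[OF lu[OF that]]) auto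
    then show "y \<in> Esc" by (simp add: Esc_def)
  qed
  define A where "A = (\<Union>z\<in>U \<inter> Esc. D z)"
  define B where "B = (\<Union>z\<in>U - Esc. D z)"
  have "A \<inter> U = {} \<or> B \<inter> U = {}"
  proof (rule connectedD[OF U(1)])
    show "open A" "open B" using D by (auto simp: A_def B_def)
    have "A \<subseteq> Esc" using DE D(2) by (force simp: A_def)
    moreover have "B \<inter> Esc = {}" using DE D(2) by (force simp: B_def)
    ultimately show "A \<inter> B \<inter> U = {}" by blast
    show "U \<subseteq> A \<union> B" using D(2) by (auto simp: A_def B_def)
  qed
  moreover have "p \<in> A" using p esc D(2) by (auto simp: A_def Esc_def)
  ultimately have UE: "U \<subseteq> Esc" using p D(2) by (force simp: B_def)
  show ?thesis
    unfolding loc_unif_tendsto_infinity_def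
  proof (intro allI impI)
    fix K :: "complex set" and M :: real
    assume K: "compact K \<and> K \<subseteq> U"
    have "\<forall>z\<in>U. \<exists>e>0. cball z e \<subseteq> D z" using D by (meson open_contains_cball)
    then obtain e where e: "\<And>z. z \<in> U \<Longrightarrow> e z > 0" "\<And>z. z \<in> U \<Longrightarrow> cball z (e z) \<subseteq> D z" by metis
    have "K \<subseteq> (\<Union>z\<in>K. ball z (e z))" using e(1) K by force
    then obtain T where T: "T \<subseteq> K" "finite T" "K \<subseteq> (\<Union>z\<in>T. ball z (e z))"
      using compactE_image[of K K "\<lambda>z. ball z (e z)"] K by (metis open_ball)
    have "\<forall>\<^sub>F n in sequentially. \<forall>z\<in>T. \<forall>y\<in>cball z (e z). norm ((f ^^ n) y) > M"
    proof (rule eventually_ball_finite[OF T(2)], rule ballI)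
      fix z assume "z \<in> T"
      then have z: "z \<in> U" using T K by blast
      then have "D z \<inter> Esc \<noteq> {}" using UE D(2) by blast
      then show "\<forall>\<^sub>F n in sequentially. \<forall>y\<in>cball z (e z). norm ((f ^^ n) y) > M"
        by (intro loc_unif_tendsto_infinityD[OF lu[OF z]] e(2)[OF z]) auto
    qed
    then show "\<forall>\<^sub>F n in sequentially. \<forall>z\<in>K. norm ((f ^^ n) z) > M"
      by eventually_elim (use T(3) in force)
  qed
qed

lemma infinity_not_in_cluster_set:
  assumes \<epsilon>: "\<epsilon> > 0" and bd: "\<And>z. z \<in> ball \<xi> \<epsilon> \<inter> ball 0 1 \<Longrightarrow> norm (\<phi> z) \<le> B"
  shows "None \<notin> cluster_set \<phi> \<xi>"
proof
  assume "None \<in> cluster_set \<phi> \<xi>"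
  then obtain z where z: "\<And>n. z n \<in> ball 0 1" "z \<longlonglongrightarrow> \<xi>"
    and lim: "limitin (Alexandroff_compactification euclidean) (\<lambda>n. Some (\<phi> (z n))) None sequentially"
    unfolding cluster_set_def by blast
  define W where "W = insert None (Some ` (topspace euclidean - cball (0::complex) B))"
  have "openin (Alexandroff_compactification euclidean) W"
    unfolding openin_Alexandroff_compactification W_def
    by (rule disjI2, rule exI[of _ "cball 0 B"]) simp
  then have "\<forall>\<^sub>F n in sequentially. Some (\<phi> (z n)) \<in> W"
    using lim unfolding limitin_def by (auto simp: W_def)
  then have "\<forall>\<^sub>F n in sequentially. norm (\<phi> (z n)) > B"
    by eventually_elim (auto simp: W_def)
  moreover have "\<forall>\<^sub>F n in sequentially. z n \<in> ball \<xi> \<epsilon>"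
    using z(2) \<epsilon> by (auto dest: tendstoD simp: dist_commute)
  ultimately have "\<forall>\<^sub>F n in sequentially. False"
    by eventually_elim (use bd z(1) in force)
  then show False by simp
qed

section \<open>Perturbed translations\<close>

text \<open>The common setting of both examples: an entire function \<open>f z = z + 1 + h z\<close> that is close to the
  translation by \<open>1\<close> in an invariant convex domain \<open>V\<close>. The model domain \<open>E\<close> is convex and
  invariant under integer translations, and compact sets in \<open>E\<close> are eventually translated into \<open>V\<close>
  (\<open>absorb\<close>). Outside the closure of \<open>E\<close>, on a set \<open>Z\<close> that surrounds it, \<open>h\<close> is large along translation
  orbits (\<open>wild\<close>). There are fixed points of \<open>f\<close>, that is, solutions of \<open>h b = -1\<close>, within bounded distance of
  all large integers (\<open>fixed\<close>). The half-disk \<open>\<Omega>\<close> in \<open>E\<close> rests on a boundary line of \<open>E\<close>, and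
  \<open>h\<close> is small enough near the translates of \<open>\<Omega>\<close> for backward iteration; \<open>w1\<close> is an auxiliary
  point of \<open>\<Omega>\<close> deep inside \<open>V\<close>. Finally \<open>R\<close> is a connected set of points with orbits entering
  \<open>V\<close> that joins \<open>V\<close> to a critical point \<open>c0\<close>.\<close>

locale perturbed_translation =
  fixes h f :: "complex \<Rightarrow> complex" and V E Z R \<Omega> :: "complex set"
    and C s a r c :: real and c0 w1 :: complex
  defines "f \<equiv> \<lambda>z. z + 1 + h z"
    and "\<Omega> \<equiv> ball (Complex a (- s)) r \<inter> {w. Im w > - s}"
  assumes hol_h: "h holomorphic_on UNIV"
    and V: "open V" "convex V" and fV: "\<And>z. z \<in> V \<Longrightarrow> f z \<in> V"
    and h_half: "\<And>z. z \<in> V \<Longrightarrow> norm (h z) \<le> 1/2"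
    and h_exp: "\<And>z. z \<in> V \<Longrightarrow> norm (h z) \<le> C * exp (- Re z)"
    and inj_V: "inj_on f V"
    and E: "open E" "convex E" and E_trans: "\<And>w k. w \<in> E \<Longrightarrow> w + of_int k \<in> E"
    and absorb: "\<And>w. w \<in> E \<Longrightarrow> \<exists>e>0. \<forall>\<^sub>F n in sequentially. \<forall>w'\<in>ball w e. w' + of_nat n \<in> V"
    and Z: "open (closure E \<union> Z)"
    and wild: "\<And>w. w \<in> Z \<Longrightarrow>
        \<exists>e>0. \<forall>M. \<forall>\<^sub>F n in sequentially. \<forall>w'\<in>ball w e. norm (h (w' + of_nat n)) > M"
    and fixed: "\<exists>B. \<forall>\<^sub>F n in sequentially. \<exists>b. h b = -1 \<and> norm (b - of_nat n) \<le> B"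
    and E_s: "\<And>w. w \<in> E \<Longrightarrow> Im w > - s" and r: "r > 0" and \<Omega>E: "\<Omega> \<subseteq> E"
    and c: "c > 0"
    and shadow_small: "\<And>k u w. u \<in> \<Omega> \<Longrightarrow> dist u w < c * exp (- real k) \<Longrightarrow>
        norm (h (w + of_nat k)) \<le> c * (exp (- real k) - exp (- real (Suc k)))"
    and shadow_contr: "\<And>k u w. u \<in> \<Omega> \<Longrightarrow> dist u w < c * exp (- real k) \<Longrightarrow>
        norm (deriv h (w + of_nat k)) \<le> 1/2"
    and w1: "w1 \<in> \<Omega>" "cball w1 c \<subseteq> V"
    and R: "connected R" "R \<inter> V \<noteq> {}" "\<And>z. z \<in> R \<Longrightarrow> \<exists>n. (f ^^ n) z \<in> V"
    and c0: "c0 \<in> R" "deriv f c0 = 0"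
begin

lemma hol_f: "f holomorphic_on S"
  unfolding f_def by (intro holomorphic_intros holomorphic_on_subset[OF hol_h]) auto

lemma hol_iter: "(f ^^ n) holomorphic_on S"
  by (rule holomorphic_on_funpow) (rule hol_f)

lemma cont_iter: "continuous_on S (f ^^ n)"
  using hol_iter by (rule holomorphic_on_imp_continuous_on)

lemma iter_V: "z \<in> V \<Longrightarrow> (f ^^ n) z \<in> V"
  by (induction n) (auto intro: fV)

text \<open>The iterates, normalised by the inverse of the translation; their limit is the conjugacy \<open>\<psi>\<close>.\<close>

definition N :: "nat \<Rightarrow> complex \<Rightarrow> complex" where "N n z = (f ^^ n) z - of_nat n"

lemma hol_N: "N n holomorphic_on S"
  unfolding N_def[abs_def] by (intro holomorphic_intros hol_iter)

lemma N_Suc: "N (Suc n) z = N n z + h ((f ^^ n) z)"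
  by (simp add: N_def f_def)

lemma N_eq_sum: "N n z = z + (\<Sum>k<n. h ((f ^^ k) z))"
  by (induction n) (simp_all add: N_Suc, simp add: N_def)

lemma N_f: "N n (f z) = N (Suc n) z + 1"
  by (simp add: N_def funpow_swap1)

lemma iter_eq_N: "(f ^^ n) z = N n z + of_nat n"
  by (simp add: N_def)

lemma Re_iter: "z \<in> V \<Longrightarrow> Re ((f ^^ n) z) \<ge> Re z + real n / 2"
proof (induction n)
  case (Suc n)
  have "norm (h ((f ^^ n) z)) \<le> 1/2" using h_half iter_V Suc by auto
  then have "Re (h ((f ^^ n) z)) \<ge> - 1/2" using abs_Re_le_cmod[of "h ((f ^^ n) z)"] by linarith
  then show ?case using Suc by (simp add: f_def field_simps)
qed simp

lemma V_nonempty: "w1 \<in> V" using w1 c by auto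

lemma C_nonneg: "C \<ge> 0"
proof -
  have "0 \<le> C * exp (- Re w1)" using h_exp[OF V_nonempty] norm_ge_zero order_trans by blast
  then show ?thesis by (simp add: zero_le_mult_iff)
qed

text \<open>The factor by which the bound for \<open>h\<close> on \<open>V\<close> decreases in each step, since the real part grows by at
  least \<open>1/2\<close>.\<close>

definition q :: real where "q = exp (- 1/2)"

text \<open>The resulting constant in the bound for the distance of \<open>\<psi>\<close> from the identity on \<open>V\<close>.\<close>

definition C' :: real where "C' = C / (1 - q)"

lemma q: "0 < q" "q < 1" by (simp_all add: q_def)

lemma q_power: "q ^ k = exp (- real k / 2)"
  unfolding q_def by (subst exp_of_nat_mult[symmetric]) simp

lemma h_iter: "z \<in> V \<Longrightarrow> norm (h ((f ^^ k) z)) \<le> C * exp (- Re z) * q ^ k"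
proof -
  assume z: "z \<in> V"
  have "norm (h ((f ^^ k) z)) \<le> C * exp (- Re ((f ^^ k) z))" by (rule h_exp[OF iter_V[OF z]])
  also have "\<dots> \<le> C * exp (- Re z - real k / 2)"
    using Re_iter[OF z, of k] C_nonneg by (intro mult_left_mono) auto
  also have "\<dots> = C * exp (- Re z) * q ^ k"
    by (simp add: q_power mult_exp_exp)
  finally show ?thesis .
qed

lemma summable_h_iter: "z \<in> V \<Longrightarrow> summable (\<lambda>k. h ((f ^^ k) z))"
  by (rule summable_comparison_test'[of "\<lambda>k. C * exp (- Re z) * q ^ k" 0, OF summable_mult[OF summable_geometric] h_iter])
     (use q in simp_all)

lemma N_convergent: "z \<in> V \<Longrightarrow> (\<lambda>n. N n z) \<longlonglongrightarrow> z + (\<Sum>k. h ((f ^^ k) z))"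
  unfolding N_eq_sum by (rule tendsto_add[OF tendsto_const summable_LIMSEQ[OF summable_h_iter]])

lemma suminf_h_iter_bound: "z \<in> V \<Longrightarrow> norm (\<Sum>k. h ((f ^^ k) z)) \<le> C' * exp (- Re z)"
proof -
  assume z: "z \<in> V"
  have g: "summable (\<lambda>k. q ^ k)" using q by (intro summable_geometric) auto
  have "norm (\<Sum>k. h ((f ^^ k) z)) \<le> (\<Sum>k. C * exp (- Re z) * q ^ k)"
    by (rule norm_suminf_le[OF h_iter[OF z] summable_mult[OF g]])
  also have "\<dots> = C * exp (- Re z) * (1 / (1 - q))"
    using q by (subst suminf_mult[OF g]) (simp add: suminf_geometric)
  finally show ?thesis by (simp add: C'_def)
qed

lemma escape_V: "loc_unif_tendsto_infinity V (\<lambda>n. f ^^ n)"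
  unfolding loc_unif_tendsto_infinity_def
proof (intro allI impI)
  fix K :: "complex set" and M :: real assume K: "compact K \<and> K \<subseteq> V"
  then obtain b where b: "\<And>z. z \<in> K \<Longrightarrow> norm z \<le> b" by (meson bounded_iff compact_imp_bounded)
  have "\<forall>\<^sub>F n in sequentially. real n > 2 * (M + b)"
    using filterlim_real_sequentially by (simp add: filterlim_at_top_dense)
  then show "\<forall>\<^sub>F n in sequentially. \<forall>z\<in>K. norm ((f ^^ n) z) > M"
  proof eventually_elim
    case (elim n)
    show ?case
    proof
      fix z assume z: "z \<in> K"
      have "Re ((f ^^ n) z) \<ge> Re z + real n / 2" using Re_iter K z by blast
      moreover have "- Re z \<le> b" using b[OF z] abs_Re_le_cmod[of z] by linarith
      moreover have "M < real n / 2 - b" using elim by (simp add: field_simps)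
      ultimately show "norm ((f ^^ n) z) > M"
        using complex_Re_le_cmod[of "(f ^^ n) z"] by linarith
    qed
  qed
qed

text \<open>The points whose orbits enter \<open>V\<close>. The Baker domain \<open>U\<close> below is defined as a Fatou component and
  turns out to be contained in \<open>A\<close>.\<close>

definition A :: "complex set" where "A = {z. \<exists>n. (f ^^ n) z \<in> V}"

lemma A_fatou: "A \<subseteq> fatou_set f"
proof
  fix z assume "z \<in> A"
  then obtain m where m: "(f ^^ m) z \<in> V" by (auto simp: A_def)
  have "open ((f ^^ m) -` V)" by (rule open_vimage[OF V(1) cont_iter])
  then obtain e where e: "e > 0" "ball z e \<subseteq> (f ^^ m) -` V"
    using m open_contains_ball by (metis vimageI)
  have "loc_unif_tendsto_infinity (ball z e) (\<lambda>n. f ^^ n)"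
    unfolding loc_unif_tendsto_infinity_def
  proof (intro allI impI)
    fix K :: "complex set" and M :: real assume K: "compact K \<and> K \<subseteq> ball z e"
    have "\<forall>\<^sub>F n in sequentially. \<forall>y\<in>(f ^^ m) ` K. norm ((f ^^ n) y) > M"
    proof (rule loc_unif_tendsto_infinityD[OF escape_V])
      show "compact ((f ^^ m) ` K)" using K cont_iter compact_continuous_image by blast
      show "(f ^^ m) ` K \<subseteq> V" using K e by auto
    qed
    then have "\<forall>\<^sub>F n in sequentially. \<forall>y\<in>(f ^^ m) ` K. norm ((f ^^ (n - m)) y) > M"
      by (rule eventually_compose_filterlim) (rule filterlim_minus_const_nat_at_top)
    then show "\<forall>\<^sub>F n in sequentially. \<forall>y\<in>K. norm ((f ^^ n) y) > M"
      using eventually_ge_at_top[of m]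
    proof eventually_elim
      case (elim n)
      have "(f ^^ n) y = (f ^^ (n - m)) ((f ^^ m) y)" for y
        using elim(2) by (metis comp_apply funpow_add le_add_diff_inverse2)
      then show ?case using elim(1) by simp
    qed
  qed
  then have "normal_on (ball z e) (range (\<lambda>n. f ^^ n))"
    by (rule normal_on_iterates_if_tendsto_infinity[OF hol_f])
  then show "z \<in> fatou_set f" using e(1) unfolding fatou_set_def
    by (intro CollectI exI[of _ "ball z e"]) auto
qed

lemma V_A: "V \<subseteq> A" unfolding A_def by (auto intro: exI[of _ 0])

text \<open>The Baker domain: the Fatou component that contains \<open>V\<close>.\<close>

definition U :: "complex set" where "U = connected_component_set (fatou_set f) w1"

lemma w1_fatou: "w1 \<in> fatou_set f"
  using V_nonempty V_A A_fatou by (meson subsetD)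

lemma U_component: "U \<in> components (fatou_set f)"
  unfolding U_def by (rule componentsI[OF w1_fatou])

lemma open_U: "open U" unfolding U_def by (intro open_connected_component open_fatou_set)

lemma connected_U: "connected U" unfolding U_def by simp

lemma U_fatou: "U \<subseteq> fatou_set f" unfolding U_def by (rule connected_component_subset)

lemma connected_subset_U:
  assumes "connected X" "X \<subseteq> fatou_set f" "X \<inter> U \<noteq> {}"
  shows "X \<subseteq> U"
  using components_maximal[OF U_component assms(1,2)] assms(3) by (simp add: Int_commute)

lemma w1_U: "w1 \<in> U"
  unfolding U_def using w1_fatou by simp

lemma V_U: "V \<subseteq> U"
proof (rule connected_subset_U[OF convex_connected[OF V(2)]])
  show "V \<subseteq> fatou_set f" using V_A A_fatou by (rule order_trans)
  show "V \<inter> U \<noteq> {}" using w1_U V_nonempty by (meson disjoint_iff)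
qed

lemma escape_U: "loc_unif_tendsto_infinity U (\<lambda>n. f ^^ n)"
proof (rule fatou_component_escape[OF connected_U U_fatou w1_U])
  have "\<forall>\<^sub>F n in sequentially. \<forall>z\<in>{w1}. norm ((f ^^ n) z) > M" for M
    by (rule loc_unif_tendsto_infinityD[OF escape_V]) (use V_nonempty in auto)
  then show "\<forall>\<^sub>F n in sequentially. norm ((f ^^ n) w1) > M" for M by simp
qed

lemma iter_not_fixed:
  assumes z: "z \<in> U" and b: "h b = -1"
  shows "(f ^^ n) z \<noteq> b"
proof
  assume eq: "(f ^^ n) z = b"
  have fb: "f b = b" using b by (simp add: f_def)
  have *: "(f ^^ (k + n)) z = b" for k by (induction k) (use eq fb in auto)
  have "\<forall>\<^sub>F m in sequentially. \<forall>y\<in>{z}. norm ((f ^^ m) y) > norm b"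
    by (rule loc_unif_tendsto_infinityD[OF escape_U]) (use z in auto)
  then obtain m where "\<And>k. k \<ge> m \<Longrightarrow> norm ((f ^^ k) z) > norm b" by (auto simp: eventually_sequentially)
  from this[of "m + n"] show False using *[of m] by simp
qed

text \<open>On \<open>U\<close> orbits escape, so iterates omit all fixed points. Hence \<open>N n\<close> omits the fixed points
  near \<open>n + n0\<close> and near \<open>n + n0 + p\<close>, translated back by \<open>n\<close>; for suitable \<open>p\<close> these two values are
  bounded and apart.\<close>

lemma N_locally_bounded:
  assumes K: "compact K" "K \<subseteq> U"
  obtains B where "\<And>n z. z \<in> K \<Longrightarrow> norm (N n z) \<le> B"
proof -
  obtain B n0 where B: "\<And>n. n \<ge> n0 \<Longrightarrow> \<exists>b. h b = -1 \<and> norm (b - of_nat n) \<le> B"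
    using fixed by (auto simp: eventually_sequentially)
  obtain b where b: "\<And>n. n \<ge> n0 \<Longrightarrow> h (b n) = -1" "\<And>n. n \<ge> n0 \<Longrightarrow> norm (b n - of_nat n) \<le> B"
    using B by metis
  define p where "p = nat \<lceil>2 * B + 1\<rceil>"
  have p: "real p \<ge> 2 * B + 1" unfolding p_def by linarith
  define \<alpha> where "\<alpha> = (\<lambda>n. b (n + n0) - of_nat n)"
  define \<beta> where "\<beta> = (\<lambda>n. b (n + n0 + p) - of_nat n)"
  define D where "D = B + real n0 + real p"
  have near: "norm (\<alpha> n - of_nat n0) \<le> B" "norm (\<beta> n - of_nat (n0 + p)) \<le> B" for n
    using b(2)[of "n + n0"] b(2)[of "n + n0 + p"] by (simp_all add: \<alpha>_def \<beta>_def algebra_simps)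
  have nn: "norm (of_nat k :: complex) = real k" for k by simp
  have al: "norm (\<alpha> n) \<le> D" for n
    using norm_triangle_ineq2[of "\<alpha> n" "of_nat n0"] near(1)[of n] nn[of n0] by (simp add: D_def)
  have be: "norm (\<beta> n) \<le> D" for n
    using norm_triangle_ineq2[of "\<beta> n" "of_nat (n0 + p)"] near(2)[of n] nn[of "n0 + p"] by (simp add: D_def)
  have sep: "1 \<le> norm (\<beta> n - \<alpha> n)" for n
  proof -
    have "of_nat p = (\<beta> n - \<alpha> n) - ((\<beta> n - of_nat (n0 + p)) - (\<alpha> n - of_nat n0))" by simp
    then have "norm (of_nat p :: complex) \<le> norm (\<beta> n - \<alpha> n) + norm ((\<beta> n - of_nat (n0 + p)) - (\<alpha> n - of_nat n0))"
      by (metis norm_triangle_ineq4)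
    also have "norm ((\<beta> n - of_nat (n0 + p)) - (\<alpha> n - of_nat n0)) \<le> B + B"
      using norm_triangle_ineq4 near by (meson add_mono order_trans)
    finally show ?thesis using p by simp
  qed
  have "Bseq (\<lambda>n. N n w1)" using N_convergent[OF V_nonempty] by (intro convergent_imp_Bseq) (auto simp: convergent_def)
  then obtain B0 where B0: "\<And>n. norm (N n w1) \<le> B0" by (auto simp: Bseq_def)
  show ?thesis
  proof (rule omitting_two_values_locally_bounded[where N = N, OF open_U connected_U hol_N _ al be sep w1_U B0 K])
    fix n w assume w: "w \<in> U"
    show "N n w \<noteq> \<alpha> n \<and> N n w \<noteq> \<beta> n"
      using iter_not_fixed[OF w b(1), of "n + n0"] iter_not_fixed[OF w b(1), of "n + n0 + p"]
      by (auto simp: N_def \<alpha>_def \<beta>_def)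
  qed (use that in blast)
qed

lemma limit_exists:
  "\<exists>\<psi> \<rho>. \<psi> holomorphic_on U \<and> strict_mono (\<rho> :: nat \<Rightarrow> nat) \<and> (\<forall>z\<in>U. (\<lambda>n. N (\<rho> n) z) \<longlonglongrightarrow> \<psi> z) \<and>
     (\<forall>K. compact K \<and> K \<subseteq> U \<longrightarrow> uniform_limit K (N \<circ> \<rho>) \<psi> sequentially)"
proof -
  obtain \<psi> \<rho> where "\<psi> holomorphic_on U" "strict_mono (\<rho> :: nat \<Rightarrow> nat)"
    "\<And>z. z \<in> U \<Longrightarrow> (\<lambda>n. N (\<rho> n) z) \<longlonglongrightarrow> \<psi> z"
    "\<And>K. compact K \<Longrightarrow> K \<subseteq> U \<Longrightarrow> uniform_limit K (N \<circ> \<rho>) \<psi> sequentially"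
  proof (rule Montel[OF open_U, of "range N" N])
    show "\<exists>B. \<forall>h\<in>range N. \<forall>z\<in>K. norm (h z) \<le> B" if "compact K" "K \<subseteq> U" for K
      using N_locally_bounded[OF that] by (metis imageE)
  qed (use hol_N in auto)
  then show ?thesis by blast
qed

text \<open>The semiconjugacy of \<open>f\<close> on \<open>U\<close> to the translation: a limit function of the normalised iterates
  along a subsequence \<open>\<rho>\<close>. That the whole sequence converges is shown in \<open>N_tendsto\<close>, after \<open>U\<close> is known
  to be absorbed by \<open>V\<close>.\<close>

definition \<psi> :: "complex \<Rightarrow> complex" where
  "\<psi> = (SOME \<psi>. \<exists>\<rho>. \<psi> holomorphic_on U \<and> strict_mono (\<rho> :: nat \<Rightarrow> nat) \<and>
     (\<forall>z\<in>U. (\<lambda>n. N (\<rho> n) z) \<longlonglongrightarrow> \<psi> z) \<and>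
     (\<forall>K. compact K \<and> K \<subseteq> U \<longrightarrow> uniform_limit K (N \<circ> \<rho>) \<psi> sequentially))"

text \<open>A subsequence that realises the limit.\<close>

definition \<rho> :: "nat \<Rightarrow> nat" where
  "\<rho> = (SOME \<rho>. \<psi> holomorphic_on U \<and> strict_mono (\<rho> :: nat \<Rightarrow> nat) \<and>
     (\<forall>z\<in>U. (\<lambda>n. N (\<rho> n) z) \<longlonglongrightarrow> \<psi> z) \<and>
     (\<forall>K. compact K \<and> K \<subseteq> U \<longrightarrow> uniform_limit K (N \<circ> \<rho>) \<psi> sequentially))"

lemma \<psi>_\<rho>: "\<psi> holomorphic_on U \<and> strict_mono \<rho> \<and> (\<forall>z\<in>U. (\<lambda>n. N (\<rho> n) z) \<longlonglongrightarrow> \<psi> z) \<and>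
     (\<forall>K. compact K \<and> K \<subseteq> U \<longrightarrow> uniform_limit K (N \<circ> \<rho>) \<psi> sequentially)"
  using someI_ex[OF someI_ex[OF limit_exists, folded \<psi>_def]] unfolding \<rho>_def .

lemma \<rho>:
  shows "strict_mono \<rho>" "\<And>z. z \<in> U \<Longrightarrow> (\<lambda>n. N (\<rho> n) z) \<longlonglongrightarrow> \<psi> z"
    "\<And>K. compact K \<Longrightarrow> K \<subseteq> U \<Longrightarrow> uniform_limit K (N \<circ> \<rho>) \<psi> sequentially"
  using \<psi>_\<rho> by simp_all

lemma hol_\<psi>: "\<psi> holomorphic_on U"
  using \<psi>_\<rho> by simp

lemma \<psi>_V: "z \<in> V \<Longrightarrow> \<psi> z = z + (\<Sum>k. h ((f ^^ k) z))"
proof -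
  assume z: "z \<in> V"
  have "(\<lambda>n. N (\<rho> n) z) \<longlonglongrightarrow> z + (\<Sum>k. h ((f ^^ k) z))"
    using LIMSEQ_subseq_LIMSEQ[OF N_convergent[OF z] \<rho>(1)] by (simp add: o_def)
  then show ?thesis using \<rho>(2) V_U z LIMSEQ_unique by blast
qed

lemma \<psi>_near: "z \<in> V \<Longrightarrow> norm (\<psi> z - z) \<le> C' * exp (- Re z)"
  using \<psi>_V suminf_h_iter_bound by simp

lemma \<psi>_f_V: "z \<in> V \<Longrightarrow> \<psi> (f z) = \<psi> z + 1"
proof -
  assume z: "z \<in> V"
  have "(\<lambda>n. N (Suc n) z + 1) \<longlonglongrightarrow> \<psi> z + 1"
    using N_convergent[OF z] \<psi>_V[OF z] by (intro tendsto_intros LIMSEQ_Suc) simp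
  moreover have "(\<lambda>n. N n (f z)) \<longlonglongrightarrow> \<psi> (f z)" using N_convergent[OF fV[OF z]] \<psi>_V[OF fV[OF z]] by simp
  ultimately show ?thesis unfolding N_f using LIMSEQ_unique by blast
qed

lemma \<psi>_V_surj:
  assumes w: "w \<in> E"
  obtains n u where "u \<in> V" "\<psi> u = w + of_nat n"
proof -
  obtain e where e: "e > 0" "\<forall>\<^sub>F n in sequentially. \<forall>w'\<in>ball w e. w' + of_nat n \<in> V"
    using absorb[OF w] by blast
  have lim: "(\<lambda>n. C' * exp (- (Re w - e)) * exp (- 1) ^ n) \<longlonglongrightarrow> C' * exp (- (Re w - e)) * 0"
    by (intro tendsto_intros LIMSEQ_realpow_zero) auto
  have ev: "\<forall>\<^sub>F n in sequentially. C' * exp (- (Re w - e)) * exp (- 1) ^ n < e/2"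
    by (rule order_tendstoD(2)[OF lim]) (use e in simp)
  obtain n where n: "\<And>w'. w' \<in> ball w e \<Longrightarrow> w' + of_nat n \<in> V" "C' * exp (- (Re w - e)) * exp (- 1) ^ n < e/2"
    using eventually_happens'[OF sequentially_bot eventually_conj[OF e(2) ev]] by blast
  have sub: "cball (w + of_nat n) (e/2) \<subseteq> V"
  proof
    fix x assume x: "x \<in> cball (w + of_nat n) (e/2)"
    then have "x - of_nat n \<in> ball w e" using e(1) by (auto simp: dist_norm algebra_simps)
    then show "x \<in> V" using n(1)[of "x - of_nat n"] by simp
  qed
  obtain u where "u \<in> cball (w + of_nat n) (e/2)" "\<psi> u = w + of_nat n"
  proof (rule continuous_near_identity_surj[of "e/2" "w + of_nat n" \<psi>])
    show "continuous_on (cball (w + of_nat n) (e/2)) \<psi>"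
      using sub V_U hol_\<psi> by (meson continuous_on_subset holomorphic_on_imp_continuous_on)
    fix z assume z: "z \<in> cball (w + of_nat n) (e/2)"
    have "\<bar>Re w + real n - Re z\<bar> \<le> e/2"
      using z abs_Re_le_cmod[of "w + of_nat n - z"] by (simp add: dist_norm)
    then have Rez: "Re z \<ge> Re w - e + real n" using e(1) by linarith
    have C'n: "C' \<ge> 0" using C_nonneg q by (simp add: C'_def)
    have "norm (\<psi> z - z) \<le> C' * exp (- Re z)" using \<psi>_near sub z by blast
    also have "\<dots> \<le> C' * exp (- (Re w - e) - real n)" using Rez C'n by (intro mult_left_mono) auto
    also have "\<dots> = C' * exp (- (Re w - e)) * exp (- 1) ^ n"
      by (subst exp_of_nat_mult[symmetric]) (simp add: mult_exp_exp)
    finally show "norm (\<psi> z - z) \<le> e/2" using n(2) by simp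
  qed (use e in auto)
  then show thesis using that sub by blast
qed

text \<open>If \<open>\<psi> z\<close> were in \<open>Z\<close>, then \<open>h\<close> would be large on the orbit of \<open>z\<close>; but \<open>h\<close> at the \<open>n\<close>-th iterate is
  the difference of the bounded quantities \<open>N (n + 1) z\<close> and \<open>N n z\<close>.\<close>

lemma \<psi>_not_Z: "z \<in> U \<Longrightarrow> \<psi> z \<notin> Z"
proof
  assume z: "z \<in> U" "\<psi> z \<in> Z"
  obtain e where e: "e > 0" "\<And>M. \<forall>\<^sub>F n in sequentially. \<forall>w'\<in>ball (\<psi> z) e. norm (h (w' + of_nat n)) > M"
    using wild[OF z(2)] by blast
  obtain B where B: "\<And>n. norm (N n z) \<le> B"
    using N_locally_bounded[of "{z}"] z(1) by auto
  have "\<forall>\<^sub>F n in sequentially. dist (N (\<rho> n) z) (\<psi> z) < e" using \<rho>(2)[OF z(1)] e(1) by (rule tendstoD)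
  then obtain n where n: "dist (N (\<rho> n) z) (\<psi> z) < e"
    "\<forall>w'\<in>ball (\<psi> z) e. norm (h (w' + of_nat (\<rho> n))) > 2 * B"
    using eventually_happens'[OF sequentially_bot eventually_conj[OF _ eventually_subseq[OF \<rho>(1) e(2)[of "2 * B"]]]]
    by blast
  have "norm (h ((f ^^ \<rho> n) z)) > 2 * B" using n by (simp add: iter_eq_N dist_commute)
  moreover have "h ((f ^^ \<rho> n) z) = N (Suc (\<rho> n)) z - N (\<rho> n) z" by (simp add: N_Suc)
  then have "norm (h ((f ^^ \<rho> n) z)) \<le> B + B" using norm_triangle_ineq4 B by (metis add_mono order_trans)
  ultimately show False by simp
qed

lemma \<psi>_not_constant: "\<not> \<psi> constant_on X" if VX: "V \<subseteq> X" for X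
proof
  assume "\<psi> constant_on X"
  then obtain y where y: "\<And>x. x \<in> V \<Longrightarrow> \<psi> x = y" using VX unfolding constant_on_def by (metis subsetD)
  have "y = y + 1" using y[OF fV[OF V_nonempty]] y[OF V_nonempty] \<psi>_f_V[OF V_nonempty] by simp
  then show False by simp
qed

text \<open>The image of \<open>\<psi>\<close> is connected, meets the closure of \<open>E\<close> and avoids \<open>Z\<close>, so it is contained in the closure;
  being open, it lies in \<open>E\<close>.\<close>

lemma \<psi>_E: "z \<in> U \<Longrightarrow> \<psi> z \<in> E"
proof -
  assume z: "z \<in> U"
  have cont: "continuous_on U \<psi>" using hol_\<psi> by (rule holomorphic_on_imp_continuous_on)
  have conn: "connected (\<psi> ` U)" by (rule connected_continuous_image[OF cont connected_U])
  obtain w where w: "w \<in> E" using w1 \<Omega>E by blast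
  obtain n u where u: "u \<in> V" "\<psi> u = w + of_nat n" using \<psi>_V_surj[OF w] by metis
  have "w + of_int (int n) \<in> E" by (rule E_trans[OF w])
  then have "\<psi> u \<in> closure E" using u closure_subset by auto
  have sub: "\<psi> ` U \<subseteq> closure E"
  proof -
    have "closedin (top_of_set (\<psi> ` U)) (\<psi> ` U \<inter> closure E)" by (simp add: closedin_closed_Int)
    moreover have "\<psi> ` U \<inter> closure E = \<psi> ` U \<inter> (closure E \<union> Z)" using \<psi>_not_Z by blast
    then have "openin (top_of_set (\<psi> ` U)) (\<psi> ` U \<inter> closure E)" using Z by (simp add: openin_open_Int)
    moreover have "\<psi> ` U \<inter> closure E \<noteq> {}" using u V_U \<open>\<psi> u \<in> closure E\<close> by blast
    ultimately show ?thesis using conn unfolding connected_clopen by blast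
  qed
  have "open (\<psi> ` U)"
    by (rule open_mapping_thm[OF hol_\<psi> open_U connected_U open_U order_refl])
       (rule \<psi>_not_constant, use V_U V_nonempty in auto)
  then have "\<psi> ` U \<subseteq> interior (closure E)" using sub interior_maximal by blast
  also have "interior (closure E) = E" using E by (simp add: convex_interior_closure interior_open)
  finally show ?thesis using z by blast
qed

lemma U_A: "U \<subseteq> A"
proof
  fix z assume z: "z \<in> U"
  obtain e where e: "e > 0" "\<forall>\<^sub>F n in sequentially. \<forall>w'\<in>ball (\<psi> z) e. w' + of_nat n \<in> V"
    using absorb[OF \<psi>_E[OF z]] by blast
  have "\<forall>\<^sub>F n in sequentially. dist (N (\<rho> n) z) (\<psi> z) < e" using \<rho>(2)[OF z] e(1) by (rule tendstoD)
  then obtain n where n: "dist (N (\<rho> n) z) (\<psi> z) < e"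
    "\<forall>w'\<in>ball (\<psi> z) e. w' + of_nat (\<rho> n) \<in> V"
    using eventually_happens'[OF sequentially_bot eventually_conj[OF _ eventually_subseq[OF \<rho>(1) e(2)]]]
    by blast
  then have "(f ^^ \<rho> n) z \<in> V" by (simp add: iter_eq_N dist_commute)
  then show "z \<in> A" by (auto simp: A_def)
qed

lemma f_U: "f ` U \<subseteq> U"
proof (rule connected_subset_U)
  show "connected (f ` U)"
    using connected_U hol_f holomorphic_on_imp_continuous_on connected_continuous_image by blast
  have "f z \<in> A" if zA: "z \<in> A" for z
  proof -
    obtain n where "(f ^^ n) z \<in> V" using zA by (auto simp: A_def)
    then have "(f ^^ n) (f z) \<in> V" using fV by (simp add: funpow_swap1[symmetric])
    then show ?thesis by (auto simp: A_def)
  qed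
  then show "f ` U \<subseteq> fatou_set f" using U_A A_fatou by blast
  show "f ` U \<inter> U \<noteq> {}" using fV[OF V_nonempty] V_U V_nonempty by blast
qed

lemma iter_U: "z \<in> U \<Longrightarrow> (f ^^ n) z \<in> U"
  by (induction n) (simp_all add: f_U[unfolded image_subset_iff, rule_format])

lemma eventually_iter_V: "z \<in> U \<Longrightarrow> \<exists>n0. \<forall>n\<ge>n0. (f ^^ n) z \<in> V"
proof -
  assume "z \<in> U"
  then obtain m where m: "(f ^^ m) z \<in> V" using U_A by (auto simp: A_def)
  have "(f ^^ n) z \<in> V" if "n \<ge> m" for n
    using iter_V[OF m, of "n - m"] that by (metis comp_apply funpow_add le_add_diff_inverse2)
  then show ?thesis by blast
qed

lemma N_tendsto: "z \<in> U \<Longrightarrow> (\<lambda>n. N n z) \<longlonglongrightarrow> \<psi> z"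
proof -
  assume z: "z \<in> U"
  obtain m where "\<forall>n\<ge>m. (f ^^ n) z \<in> V" using eventually_iter_V[OF z] ..
  then have m: "(f ^^ m) z \<in> V" by simp
  have "N n ((f ^^ m) z) = N (n + m) z + of_nat m" for n by (simp add: N_def funpow_add)
  then have "(\<lambda>n. N (n + m) z + of_nat m) \<longlonglongrightarrow> (f ^^ m) z + (\<Sum>k. h ((f ^^ k) ((f ^^ m) z)))"
    using N_convergent[OF m] by simp
  then have "(\<lambda>n. N (n + m) z + of_nat m - of_nat m) \<longlonglongrightarrow> (f ^^ m) z + (\<Sum>k. h ((f ^^ k) ((f ^^ m) z))) - of_nat m"
    by (rule tendsto_diff) (rule tendsto_const)
  then have "(\<lambda>n. N (n + m) z) \<longlonglongrightarrow> (f ^^ m) z + (\<Sum>k. h ((f ^^ k) ((f ^^ m) z))) - of_nat m" by simp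
  then have *: "(\<lambda>n. N n z) \<longlonglongrightarrow> (f ^^ m) z + (\<Sum>k. h ((f ^^ k) ((f ^^ m) z))) - of_nat m" by (rule LIMSEQ_offset)
  have "(\<lambda>n. N (\<rho> n) z) \<longlonglongrightarrow> (f ^^ m) z + (\<Sum>k. h ((f ^^ k) ((f ^^ m) z))) - of_nat m"
    using LIMSEQ_subseq_LIMSEQ[OF * \<rho>(1)] by (simp add: o_def)
  then have eq: "(f ^^ m) z + (\<Sum>k. h ((f ^^ k) ((f ^^ m) z))) - of_nat m = \<psi> z"
    using \<rho>(2)[OF z] by (rule LIMSEQ_unique)
  from * show ?thesis unfolding eq .
qed

lemma \<psi>_f: "z \<in> U \<Longrightarrow> \<psi> (f z) = \<psi> z + 1"
proof -
  assume z: "z \<in> U"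
  have "(\<lambda>n. N (Suc n) z + 1) \<longlonglongrightarrow> \<psi> z + 1"
    by (rule tendsto_add[OF LIMSEQ_Suc[OF N_tendsto[OF z]] tendsto_const])
  moreover have "(\<lambda>n. N n (f z)) \<longlonglongrightarrow> \<psi> (f z)" by (rule N_tendsto) (use f_U z in blast)
  ultimately show ?thesis unfolding N_f by (rule LIMSEQ_unique[symmetric])
qed

lemma \<psi>_iter: "z \<in> U \<Longrightarrow> \<psi> ((f ^^ n) z) = \<psi> z + of_nat n"
  by (induction n) (simp_all add: \<psi>_f iter_U)

text \<open>By Hurwitz's theorem, as \<open>\<psi>\<close> is a nonconstant limit of functions that are injective on \<open>V\<close>.\<close>

lemma inj_\<psi>_V: "inj_on \<psi> V"
proof -
  have inj_iter: "inj_on (f ^^ n) V" for n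
  proof (induction n)
    case (Suc n)
    have "inj_on (f \<circ> f ^^ n) V"
      by (rule comp_inj_on[OF Suc inj_on_subset[OF inj_V]]) (use iter_V in auto)
    then show ?case by (simp add: o_def)
  qed simp
  show ?thesis
  proof (rule Hurwitz_injective[OF V(1) convex_connected[OF V(2)], of "N \<circ> \<rho>"])
    show "(N \<circ> \<rho>) n holomorphic_on V" for n by (simp add: hol_N)
    show "\<psi> holomorphic_on V" using hol_\<psi> V_U holomorphic_on_subset by blast
    show "uniform_limit K (N \<circ> \<rho>) \<psi> sequentially" if "compact K" "K \<subseteq> V" for K
      using \<rho>(3) that V_U by blast
    show "\<not> \<psi> constant_on V" by (rule \<psi>_not_constant) (use V_nonempty in auto)
    show "inj_on ((N \<circ> \<rho>) n) V" for n
      using inj_iter[of "\<rho> n"] by (auto simp: inj_on_def N_def)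
  qed
qed

subsection \<open>The orbit space\<close>

lemma int_translation_equiv: "equiv E (int_translation_rel E)"
proof (rule equivI)
  show "int_translation_rel E \<subseteq> E \<times> E" by (auto simp: int_translation_rel_def)
  show "refl_on E (int_translation_rel E)"
    by (auto simp: int_translation_rel_def refl_on_def intro: exI[of _ 0])
  show "sym (int_translation_rel E)"
    by (rule symI) (auto simp: int_translation_rel_def intro: exI[of _ "- k" for k])
  show "trans (int_translation_rel E)"
    by (rule transI) (auto simp: int_translation_rel_def add.assoc simp flip: of_int_add)
qed

text \<open>Two points of \<open>U\<close> are equivalent under \<open>f\<close> exactly when their images under \<open>\<psi>\<close> differ by an integer: both
  orbits enter \<open>V\<close>, where \<open>\<psi>\<close> is injective.\<close>

lemma orbit_rel_iff:
  assumes u: "u \<in> U" and v: "v \<in> U"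
  shows "(u, v) \<in> orbit_rel f U \<longleftrightarrow> (\<psi> u, \<psi> v) \<in> int_translation_rel E"
proof
  assume "(u, v) \<in> orbit_rel f U"
  then obtain m n where mn: "(f ^^ m) u = (f ^^ n) v" by (auto simp: orbit_rel_def)
  have "\<psi> u + of_nat m = \<psi> v + of_nat n" using \<psi>_iter[OF u, of m] \<psi>_iter[OF v, of n] mn by simp
  then have "\<psi> v = \<psi> u + of_int (int m - int n)" by (simp add: algebra_simps)
  then show "(\<psi> u, \<psi> v) \<in> int_translation_rel E"
    using u v \<psi>_E unfolding int_translation_rel_def by blast
next
  assume "(\<psi> u, \<psi> v) \<in> int_translation_rel E"
  then obtain k where k: "\<psi> v = \<psi> u + of_int k" by (auto simp: int_translation_rel_def)
  obtain nu where nu: "\<forall>n\<ge>nu. (f ^^ n) u \<in> V" using eventually_iter_V[OF u] ..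
  obtain nv where nv: "\<forall>n\<ge>nv. (f ^^ n) v \<in> V" using eventually_iter_V[OF v] ..
  define n where "n = nu + nv + nat \<bar>k\<bar>"
  define m where "m = nat (int n + k)"
  have m: "int m = int n + k" unfolding m_def n_def by simp
  have "m \<ge> nu" unfolding m_def n_def by linarith
  then have Vu: "(f ^^ m) u \<in> V" using nu by simp
  have Vv: "(f ^^ n) v \<in> V" using nv by (simp add: n_def)
  have "of_int (int m) = (of_int (int n + k) :: complex)" using m by simp
  then have mm: "(of_nat m :: complex) = of_nat n + of_int k" by simp
  have "\<psi> ((f ^^ m) u) = \<psi> ((f ^^ n) v)"
    using \<psi>_iter[OF u, of m] \<psi>_iter[OF v, of n] k mm by simp
  then have "(f ^^ m) u = (f ^^ n) v" using inj_\<psi>_V Vu Vv by (meson inj_onD)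
  then show "(u, v) \<in> orbit_rel f U" using u v by (auto simp: orbit_rel_def)
qed

lemma orbit_equiv: "equiv U (orbit_rel f U)"
proof (rule equivI)
  show sub: "orbit_rel f U \<subseteq> U \<times> U" by (auto simp: orbit_rel_def)
  show "refl_on U (orbit_rel f U)"
    by (auto simp: orbit_rel_def refl_on_def)
  show "sym (orbit_rel f U)"
    by (rule symI) (auto simp: orbit_rel_def, metis)
  show "trans (orbit_rel f U)"
  proof (rule transI)
    fix x y z assume xy: "(x, y) \<in> orbit_rel f U" and yz: "(y, z) \<in> orbit_rel f U"
    then have in_U: "x \<in> U" "y \<in> U" "z \<in> U" using sub by auto
    have "trans (int_translation_rel E)" using int_translation_equiv by (simp add: equiv_def)
    then have "(\<psi> x, \<psi> z) \<in> int_translation_rel E"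
      using xy yz in_U orbit_rel_iff by (meson transD)
    then show "(x, z) \<in> orbit_rel f U" using in_U orbit_rel_iff by blast
  qed
qed

lemma orbit_class_eq_iff:
  assumes "u \<in> U" "v \<in> U"
  shows "orbit_rel f U `` {u} = orbit_rel f U `` {v} \<longleftrightarrow>
    int_translation_rel E `` {\<psi> u} = int_translation_rel E `` {\<psi> v}"
  using eq_equiv_class_iff[OF orbit_equiv assms]
    eq_equiv_class_iff[OF int_translation_equiv \<psi>_E[OF assms(1)] \<psi>_E[OF assms(2)]]
    orbit_rel_iff[OF assms] by simp

lemma translation_class_eq:
  assumes "w \<in> E"
  shows "int_translation_rel E `` {w + of_nat n} = int_translation_rel E `` {w}"
proof (rule equiv_class_eq[OF int_translation_equiv])
  have "w + of_int (int n) \<in> E" by (rule E_trans[OF assms])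
  then show "(w + of_nat n, w) \<in> int_translation_rel E"
    using assms by (auto simp: int_translation_rel_def intro!: exI[of _ "- int n"])
qed

lemma class_of_orbit_image:
  assumes u: "u \<in> U"
  shows "int_translation_rel E `` (\<psi> ` (orbit_rel f U `` {u})) = int_translation_rel E `` {\<psi> u}"
proof -
  have "int_translation_rel E `` {\<psi> v} = int_translation_rel E `` {\<psi> u}" if v: "v \<in> orbit_rel f U `` {u}" for v
  proof -
    have uv: "(u, v) \<in> orbit_rel f U" using v by simp
    then have vU: "v \<in> U" by (simp add: orbit_rel_def)
    have "orbit_rel f U `` {u} = orbit_rel f U `` {v}" by (rule equiv_class_eq[OF orbit_equiv uv])
    then show ?thesis using orbit_class_eq_iff[OF u vU] by simp
  qed
  moreover have "u \<in> orbit_rel f U `` {u}" by (rule equiv_class_self[OF orbit_equiv u])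
  ultimately show ?thesis by (fastforce simp: Image_def)
qed

lemma local_inverse:
  assumes W0: "open W0" "W0 \<subseteq> V" and u: "u \<in> W0" "\<psi> u = w + of_nat n"
  obtains T g where "open T" "w \<in> T" "g holomorphic_on T"
    "\<And>x. x \<in> T \<Longrightarrow> g x \<in> W0 \<and> \<psi> (g x) = x + of_nat n"
proof -
  have hol: "\<psi> holomorphic_on W0" using hol_\<psi> W0(2) V_U by (meson holomorphic_on_subset)
  have inj: "inj_on \<psi> W0" by (rule inj_on_subset[OF inj_\<psi>_V W0(2)])
  obtain g0 where g0: "g0 holomorphic_on (\<psi> ` W0)" "\<And>z. z \<in> W0 \<Longrightarrow> g0 (\<psi> z) = z"
    using holomorphic_has_inverse[OF hol W0(1) inj] by metis
  define T where "T = (\<lambda>x. x + of_nat n) -` (\<psi> ` W0)"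
  show ?thesis
  proof
    show "open T" unfolding T_def
      by (rule open_vimage[OF open_mapping_thm3[OF hol W0(1) inj]]) (intro continuous_intros)
    have "w + of_nat n \<in> \<psi> ` W0" using u by (metis imageI)
    then show "w \<in> T" by (simp add: T_def)
    show "(\<lambda>x. g0 (x + of_nat n)) holomorphic_on T"
      by (rule holomorphic_on_compose_gen[OF _ g0(1), unfolded o_def]) (auto simp: T_def intro!: holomorphic_intros)
    fix x assume "x \<in> T"
    then obtain z where "z \<in> W0" "x + of_nat n = \<psi> z" by (auto simp: T_def)
    then show "g0 (x + of_nat n) \<in> W0 \<and> \<psi> (g0 (x + of_nat n)) = x + of_nat n" using g0(2) by simp
  qed
qed

text \<open>The equivalence of the orbit space of \<open>f\<close> on \<open>U\<close> with the quotient of \<open>E\<close> by the integers is induced by \<open>\<psi>\<close>. The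
  inverse branches of \<open>\<psi>\<close> on \<open>V\<close>, translated by integers, serve as charts.\<close>

lemma orbit_space: "conformally_equivalent U (orbit_rel f U) E (int_translation_rel E)"
proof -
  define Q where "Q = orbit_rel f U"
  define S where "S = int_translation_rel E"
  define \<Phi> where "\<Phi> = (\<lambda>X. S `` (\<psi> ` X))"
  have \<Phi>: "\<Phi> (Q `` {u}) = S `` {\<psi> u}" if "u \<in> U" for u
    using class_of_orbit_image[OF that] by (simp add: \<Phi>_def Q_def S_def)
  have pre: "quotient_preimage U Q {X \<in> U // Q. \<Phi> X \<in> W} = U \<inter> \<psi> -` quotient_preimage E S W" for W
  proof -
    have "Q `` {u} \<in> {X \<in> U // Q. \<Phi> X \<in> W} \<longleftrightarrow> \<psi> u \<in> quotient_preimage E S W" if "u \<in> U" for u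
      using that \<Phi>[OF that] \<psi>_E[OF that] by (simp add: quotient_preimage_def quotientI)
    then show ?thesis by (auto simp: quotient_preimage_def)
  qed
  have chart: "\<exists>n u. u \<in> V \<and> \<psi> u = w + of_nat n \<and> S `` {\<psi> u} = S `` {w}" if w: "w \<in> E" for w
  proof -
    obtain n u where "u \<in> V" "\<psi> u = w + of_nat n" by (rule \<psi>_V_surj[OF w])
    then show ?thesis using translation_class_eq[OF w, of n]
      by (intro exI[of _ n] exI[of _ u]) (simp add: S_def)
  qed
  have inv: "\<exists>T g. open T \<and> w \<in> T \<and> T \<subseteq> quotient_preimage E S W \<and> g holomorphic_on T \<and>
      g ` T \<subseteq> U \<inter> \<psi> -` quotient_preimage E S W \<and> (\<forall>x\<in>T. S `` {\<psi> (g x)} = S `` {x})"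
    if op: "open (U \<inter> \<psi> -` quotient_preimage E S W)" and w: "w \<in> quotient_preimage E S W" for W w
  proof -
    have wE: "w \<in> E" "S `` {w} \<in> W" using w by (auto simp: quotient_preimage_def)
    obtain n u where u: "u \<in> V" "\<psi> u = w + of_nat n" "S `` {\<psi> u} = S `` {w}" using chart[OF wE(1)] by blast
    define W0 where "W0 = (U \<inter> \<psi> -` quotient_preimage E S W) \<inter> V"
    have W0: "open W0" "W0 \<subseteq> V" using op V(1) by (auto simp: W0_def)
    have uU: "u \<in> U" using u(1) V_U by blast
    have uO: "u \<in> W0" using u(1,3) wE uU \<psi>_E[OF uU] by (simp add: W0_def quotient_preimage_def)
    obtain T g where T: "open T" "w \<in> T" "g holomorphic_on T"
      "\<And>x. x \<in> T \<Longrightarrow> g x \<in> W0 \<and> \<psi> (g x) = x + of_nat n"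
      using local_inverse[OF W0 uO u(2)] by metis
    have xE: "x \<in> E" and xS: "S `` {\<psi> (g x)} = S `` {x}" if "x \<in> T" for x
    proof -
      have "g x \<in> U" using T(4)[OF that] by (simp add: W0_def)
      then have "x + of_nat n \<in> E" using \<psi>_E[of "g x"] T(4)[OF that] by simp
      then have "x + of_nat n + of_int (- int n) \<in> E" by (rule E_trans)
      then show "x \<in> E" by simp
      then show "S `` {\<psi> (g x)} = S `` {x}" using translation_class_eq[of x n] T(4)[OF that] by (simp add: S_def)
    qed
    have "x \<in> quotient_preimage E S W" if "x \<in> T" for x
    proof -
      have "S `` {\<psi> (g x)} \<in> W"
        using T(4)[OF that, THEN conjunct1] by (simp add: W0_def quotient_preimage_def)
      then show ?thesis unfolding xS[OF that] using xE[OF that] by (simp add: quotient_preimage_def)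
    qed
    moreover have "g ` T \<subseteq> U \<inter> \<psi> -` quotient_preimage E S W" using T(4) by (auto simp: W0_def)
    ultimately show ?thesis using T xS by blast
  qed
  have op_iff: "open (quotient_preimage E S W) \<longleftrightarrow> open (U \<inter> \<psi> -` quotient_preimage E S W)" for W
  proof
    assume "open (quotient_preimage E S W)"
    then show "open (U \<inter> \<psi> -` quotient_preimage E S W)"
      by (rule continuous_open_preimage[OF holomorphic_on_imp_continuous_on[OF hol_\<psi>] open_U])
  next
    assume op: "open (U \<inter> \<psi> -` quotient_preimage E S W)"
    show "open (quotient_preimage E S W)"
    proof (subst open_subopen, intro ballI)
      fix w assume "w \<in> quotient_preimage E S W"
      from inv[OF op this] show "\<exists>T. open T \<and> w \<in> T \<and> T \<subseteq> quotient_preimage E S W" by (elim exE conjE) (intro exI conjI)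
    qed
  qed
  show ?thesis
    unfolding conformally_equivalent_def Q_def[symmetric] S_def[symmetric]
  proof (intro exI[of _ \<Phi>] conjI allI impI)
    show "bij_betw \<Phi> (U // Q) (E // S)"
      unfolding bij_betw_def
    proof
      show "inj_on \<Phi> (U // Q)"
      proof (rule inj_onI)
        fix X Y assume "X \<in> U // Q" "Y \<in> U // Q" and eq: "\<Phi> X = \<Phi> Y"
        then obtain u v where uv: "u \<in> U" "X = Q `` {u}" "v \<in> U" "Y = Q `` {v}" by (meson quotientE)
        then show "X = Y" using eq \<Phi> orbit_class_eq_iff[of u v] by (simp add: Q_def S_def)
      qed
      show "\<Phi> ` (U // Q) = E // S"
      proof (intro equalityI subsetI)
        fix X assume "X \<in> \<Phi> ` (U // Q)"
        then obtain u where "u \<in> U" "X = \<Phi> (Q `` {u})" by (auto elim!: quotientE)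
        then show "X \<in> E // S" using \<Phi> \<psi>_E by (simp add: quotientI)
      next
        fix X assume "X \<in> E // S"
        then obtain w where w: "w \<in> E" "X = S `` {w}" by (auto elim: quotientE)
        obtain n u where "u \<in> V" "S `` {\<psi> u} = S `` {w}" using chart[OF w(1)] by blast
        then show "X \<in> \<Phi> ` (U // Q)" using \<Phi> w V_U by (metis imageI quotientI subsetD)
      qed
    qed
  next
    fix W assume "W \<subseteq> E // S"
    then show "quotient_open E S W \<longleftrightarrow> quotient_open U Q {X \<in> U // Q. \<Phi> X \<in> W}"
      unfolding quotient_open_def pre using op_iff by auto
  next
    fix W and k :: "complex set \<Rightarrow> complex"
    assume "quotient_open E S W"
    then have op: "open (quotient_preimage E S W)" by (simp add: quotient_open_def)
    let ?W' = "quotient_preimage E S W"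
    let ?W'' = "U \<inter> \<psi> -` ?W'"
    have cong: "(\<lambda>z. (k \<circ> \<Phi>) (Q `` {z})) holomorphic_on ?W'' \<longleftrightarrow> (\<lambda>z. k (S `` {\<psi> z})) holomorphic_on ?W''"
      by (rule holomorphic_cong[OF refl]) (simp add: \<Phi>)
    show "quotient_holomorphic_on E S k W \<longleftrightarrow> quotient_holomorphic_on U Q (k \<circ> \<Phi>) {X \<in> U // Q. \<Phi> X \<in> W}"
      unfolding quotient_holomorphic_on_def pre cong
    proof
      assume H: "(\<lambda>z. k (S `` {z})) holomorphic_on ?W'"
      show "(\<lambda>z. k (S `` {\<psi> z})) holomorphic_on ?W''"
        by (rule holomorphic_on_compose_gen[OF holomorphic_on_subset[OF hol_\<psi>] H, unfolded o_def]) auto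
    next
      assume hol: "(\<lambda>z. k (S `` {\<psi> z})) holomorphic_on ?W''"
      have "(\<lambda>z. k (S `` {z})) field_differentiable at w" if w: "w \<in> ?W'" for w
      proof -
        obtain T g where T: "open T" "w \<in> T" "g holomorphic_on T" "g ` T \<subseteq> ?W''"
          "\<forall>x\<in>T. S `` {\<psi> (g x)} = S `` {x}"
          using inv[OF iffD1[OF op_iff op] w] by metis
        have "(\<lambda>x. k (S `` {\<psi> (g x)})) holomorphic_on T"
          by (rule holomorphic_on_compose_gen[OF T(3) hol T(4), unfolded o_def])
        then have "(\<lambda>x. k (S `` {x})) holomorphic_on T"
          using T(5) by (subst holomorphic_cong[OF refl, of _ _ "\<lambda>x. k (S `` {\<psi> (g x)})"]) auto
        then show ?thesis using T(1,2) by (rule holomorphic_on_imp_differentiable_at)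
      qed
      then show "(\<lambda>z. k (S `` {z})) holomorphic_on ?W'"
        unfolding holomorphic_on_def by (blast intro: field_differentiable_at_within)
    qed
  qed
qed

subsection \<open>Simple connectivity\<close>

lemma compact_eventually_V:
  assumes K: "compact K" "K \<subseteq> U"
  obtains n where "(f ^^ n) ` K \<subseteq> V"
proof -
  have op: "open ((f ^^ n) -` V)" for n by (rule open_vimage[OF V(1) cont_iter])
  have "K \<subseteq> A" using K(2) U_A by (rule order_trans)
  also have "A = (\<Union>n\<in>UNIV. (f ^^ n) -` V)" by (simp add: A_def vimage_def UNION_eq)
  finally have "K \<subseteq> (\<Union>n\<in>UNIV. (f ^^ n) -` V)" .
  then obtain T where T: "T \<subseteq> UNIV" "finite T" "K \<subseteq> (\<Union>n\<in>T. (f ^^ n) -` V)"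
    by (rule compactE_image[OF K(1) op])
  define m where "m = (\<Sum>n\<in>T. n)"
  have "(f ^^ m) z \<in> V" if z: "z \<in> K" for z
  proof -
    obtain n where n: "n \<in> T" "(f ^^ n) z \<in> V" using T(3) z by blast
    have "n \<le> m" unfolding m_def using member_le_sum[of n T "\<lambda>n. n"] n(1) T(2) by simp
    then have "(f ^^ m) z = (f ^^ (m - n)) ((f ^^ n) z)" by (metis comp_apply funpow_add le_add_diff_inverse2)
    then show ?thesis using iter_V[OF n(2)] by simp
  qed
  then show ?thesis using that by blast
qed

text \<open>If a loop in \<open>U\<close> surrounded a point outside \<open>U\<close>, then by the maximum principle some iterate would map the whole
  inside of the loop into the convex set \<open>V\<close>, so that the inside would belong to \<open>U\<close> as well.\<close>

lemma simply_connected_U: "simply_connected U"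
  unfolding simply_connected_eq_winding_number_zero[OF open_U]
proof (intro conjI allI impI)
  show "connected U" by (rule connected_U)
  fix \<gamma> z
  assume H: "path \<gamma> \<and> path_image \<gamma> \<subseteq> U \<and> pathfinish \<gamma> = pathstart \<gamma> \<and> z \<notin> U"
  show "winding_number \<gamma> z = 0"
  proof (rule ccontr)
    assume "winding_number \<gamma> z \<noteq> 0"
    then have "z \<notin> outside (path_image \<gamma>)" using winding_number_zero_in_outside H by blast
    then have z: "z \<in> inside (path_image \<gamma>)" using H inside_Un_outside[of "path_image \<gamma>"] by blast
    have comp: "compact (path_image \<gamma>)" and conn: "connected (path_image \<gamma>)"
      using H by (auto intro: compact_path_image connected_path_image)
    obtain n where n: "(f ^^ n) ` path_image \<gamma> \<subseteq> V"
      using compact_eventually_V[OF comp] H by blast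
    have "(f ^^ n) x \<in> V" if x: "x \<in> inside (path_image \<gamma>)" for x
    proof (rule maximum_principle_convex[OF _ _ hol_iter cont_iter V(2,1) _ x])
      show "bounded (inside (path_image \<gamma>))" using comp by (intro bounded_inside compact_imp_bounded)
      show "open (inside (path_image \<gamma>))" using comp by (intro open_inside compact_imp_closed)
      show "(f ^^ n) y \<in> V" if y: "y \<in> frontier (inside (path_image \<gamma>))" for y
        using frontier_inside_subset[OF compact_imp_closed[OF comp]] y n by blast
    qed
    then have "inside (path_image \<gamma>) \<subseteq> fatou_set f" using A_fatou by (auto simp: A_def)
    then have sub: "path_image \<gamma> \<union> inside (path_image \<gamma>) \<subseteq> fatou_set f" using H U_fatou by blast
    have "path_image \<gamma> \<union> inside (path_image \<gamma>) \<subseteq> U"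
    proof (rule connected_subset_U[OF _ sub])
      show "connected (path_image \<gamma> \<union> inside (path_image \<gamma>))"
        by (rule connected_with_inside[OF compact_imp_closed[OF comp] conn])
      show "(path_image \<gamma> \<union> inside (path_image \<gamma>)) \<inter> U \<noteq> {}"
        using H path_image_nonempty[of \<gamma>] by blast
    qed
    then show False using z H by blast
  qed
qed

subsection \<open>Boundary behaviour\<close>

text \<open>The function \<open>G\<close> obtained by backward iteration takes values in \<open>A\<close>; as \<open>G w1\<close> lies in \<open>V\<close>, its connected image
  is contained in \<open>U\<close>.\<close>

lemma right_inverse_of_\<psi>:
  obtains G where "G holomorphic_on \<Omega>"
    "\<And>w. w \<in> \<Omega> \<Longrightarrow> G w \<in> U \<and> \<psi> (G w) = w \<and> norm (G w - w) \<le> c"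
proof -
  have \<Omega>: "open \<Omega>" "convex \<Omega>" unfolding \<Omega>_def
    by (auto intro!: convex_Int open_Int open_halfspace_Im_gt convex_halfspace_Im_gt)
  have D: "\<exists>u\<in>\<Omega>. dist u w < c * exp (- real k)"
    if "w \<in> (\<Union>u\<in>\<Omega>. ball u (c * exp (- real k)))" for k w using that unfolding mem_ball UN_iff .
  obtain G where G: "G holomorphic_on \<Omega>"
    "\<And>w m. w \<in> \<Omega> \<Longrightarrow> norm ((f ^^ m) (G w) - (w + of_nat m)) \<le> c * exp (- real m)"
  proof (rule translation_orbits_shadowed[OF hol_h \<Omega> c])
    show "norm (h (w + of_nat k)) \<le> c * (exp (- real k) - exp (- real (Suc k)))"
      if "w \<in> (\<Union>u\<in>\<Omega>. ball u (c * exp (- real k)))" for k w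
      using D[OF that] shadow_small by blast
    show "norm (deriv h (w + of_nat k)) \<le> 1/2"
      if "w \<in> (\<Union>u\<in>\<Omega>. ball u (c * exp (- real k)))" for k w
      using D[OF that] shadow_contr by blast
  qed (auto simp: f_def[symmetric])
  have lim0: "(\<lambda>m. c * exp (- real m)) \<longlonglongrightarrow> 0"
  proof -
    have "(\<lambda>m. c * exp (- 1) ^ m) \<longlonglongrightarrow> c * 0"
      by (intro tendsto_mult tendsto_const LIMSEQ_realpow_zero) auto
    then show ?thesis by (simp add: exp_of_nat_mult[symmetric])
  qed
  have lim: "(\<lambda>m. N m (G w)) \<longlonglongrightarrow> w" if w: "w \<in> \<Omega>" for w
  proof (rule metric_LIMSEQ_I[OF _])
    fix e :: real assume "e > 0"
    then obtain m0 where "\<And>m. m \<ge> m0 \<Longrightarrow> norm (c * exp (- real m) - 0) < e"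
      using LIMSEQ_D[OF lim0] by blast
    then have "dist (N m (G w)) w < e" if "m \<ge> m0" for m
      using G(2)[OF w, of m] that by (force simp: N_def dist_norm algebra_simps)
    then show "\<exists>m0. \<forall>m\<ge>m0. dist (N m (G w)) w < e" by blast
  qed
  have GA: "G w \<in> A" if w: "w \<in> \<Omega>" for w
  proof -
    have "w \<in> E" using w \<Omega>E by blast
    then obtain e where e: "e > 0" "\<forall>\<^sub>F n in sequentially. \<forall>w'\<in>ball w e. w' + of_nat n \<in> V"
      using absorb by blast
    have "\<forall>\<^sub>F n in sequentially. dist (N n (G w)) w < e" by (rule tendstoD[OF lim[OF w] e(1)])
    then obtain n where n: "dist (N n (G w)) w < e" "\<forall>w'\<in>ball w e. w' + of_nat n \<in> V"
      using eventually_happens'[OF sequentially_bot eventually_conj[OF _ e(2)]] by blast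
    then have "(f ^^ n) (G w) \<in> V" by (simp add: iter_eq_N dist_commute)
    then show ?thesis by (auto simp: A_def)
  qed
  have near: "norm (G w - w) \<le> c" if "w \<in> \<Omega>" for w using G(2)[OF that, of 0] by simp
  have "G ` \<Omega> \<subseteq> U"
  proof (rule connected_subset_U)
    show "connected (G ` \<Omega>)"
      by (rule connected_continuous_image[OF holomorphic_on_imp_continuous_on[OF G(1)] convex_connected[OF \<Omega>(2)]])
    show "G ` \<Omega> \<subseteq> fatou_set f" using GA A_fatou by blast
    have "G w1 \<in> cball w1 c" using near[OF w1(1)] by (simp add: dist_norm norm_minus_commute)
    then show "G ` \<Omega> \<inter> U \<noteq> {}" using w1 V_U by blast
  qed
  then show ?thesis using that[OF G(1)] near lim N_tendsto LIMSEQ_unique by (metis imageI subsetD)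
qed

lemma fixed_exists: "\<exists>b. h b = -1 \<and> norm b > M"
proof -
  obtain B where B: "\<forall>\<^sub>F n in sequentially. \<exists>b. h b = -1 \<and> norm (b - of_nat n) \<le> B" using fixed by blast
  have "\<forall>\<^sub>F n in sequentially. real n > M + B"
    using filterlim_real_sequentially by (simp add: filterlim_at_top_dense)
  then obtain n b where b: "real n > M + B" "h b = -1" "norm (b - of_nat n) \<le> B"
    using eventually_happens'[OF sequentially_bot eventually_conj[OF _ B]] by blast
  have "real n - norm b \<le> B"
    using norm_triangle_ineq2[of "of_nat n" b] b(3) by (simp add: norm_minus_commute)
  then show ?thesis using b by (intro exI[of _ b]) simp
qed

text \<open>For a Riemann map \<open>\<phi>\<close> of \<open>U\<close>, the composition \<open>\<psi> \<circ> \<phi>\<close>, shifted by \<open>\<i> s\<close>, maps the disk into the upper half-plane and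
  has the right inverse \<open>k\<close> built from \<open>G\<close>. So \<open>\<phi>\<close> takes only values of \<open>G\<close>, hence is
  bounded, near some point of the circle.\<close>

lemma bounded_boundary_arc:
  "\<exists>\<phi>. conformal_map_from_disk \<phi> U \<and> infinity_cluster_points \<phi> \<noteq> sphere 0 1"
proof -
  obtain b where "h b = -1" using fixed_exists by blast
  then have "b \<notin> U" using iter_not_fixed[of b b 0] by auto
  then have "U \<noteq> UNIV" "U \<noteq> {}" using w1_U by auto
  then have "\<exists>\<phi>i \<phi>. \<phi>i holomorphic_on U \<and> \<phi> holomorphic_on ball 0 1 \<and>
      (\<forall>z\<in>U. \<phi>i z \<in> ball 0 1 \<and> \<phi> (\<phi>i z) = z) \<and> (\<forall>z\<in>ball 0 1. \<phi> z \<in> U \<and> \<phi>i (\<phi> z) = z)"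
    using Riemann_mapping_theorem[of U] open_U simply_connected_U by simp
  then obtain \<phi>i \<phi> where \<phi>: "\<phi>i holomorphic_on U" "\<phi> holomorphic_on ball 0 1"
    "\<And>z. z \<in> U \<Longrightarrow> \<phi>i z \<in> ball 0 1" "\<And>z. z \<in> U \<Longrightarrow> \<phi> (\<phi>i z) = z"
    "\<And>z. z \<in> ball 0 1 \<Longrightarrow> \<phi> z \<in> U" "\<And>z. z \<in> ball 0 1 \<Longrightarrow> \<phi>i (\<phi> z) = z" by blast
  have conf: "conformal_map_from_disk \<phi> U"
    unfolding conformal_map_from_disk_def
  proof (intro conjI)
    show "inj_on \<phi> (ball 0 1)" using \<phi>(6) by (rule inj_on_inverseI)
    show "\<phi> ` ball 0 1 = U"
    proof (intro equalityI subsetI)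
      fix z assume "z \<in> U"
      then show "z \<in> \<phi> ` ball 0 1" using \<phi>(3,4) by (intro image_eqI[of _ _ "\<phi>i z"]) simp_all
    next
      fix z assume "z \<in> \<phi> ` ball 0 1"
      then show "z \<in> U" using \<phi>(5) by blast
    qed
  qed (rule \<phi>(2))
  obtain G where G: "G holomorphic_on \<Omega>"
    "\<And>w. w \<in> \<Omega> \<Longrightarrow> G w \<in> U \<and> \<psi> (G w) = w \<and> norm (G w - w) \<le> c"
    using right_inverse_of_\<psi> by metis
  define \<Omega>0 where "\<Omega>0 = ball (complex_of_real a) r \<inter> {w. Im w > 0}"
  \<comment> \<open>The shift that moves the upper half-plane, and with it \<open>\<Omega>0\<close>, down to the position of \<open>\<Omega>\<close>.\<close>
  define sh where "sh = (\<lambda>w. w - \<i> * of_real s)"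
  have sh: "sh w \<in> \<Omega>" if "w \<in> \<Omega>0" for w
  proof -
    have "Complex a (- s) - sh w = of_real a - w" by (simp add: sh_def complex_eq_iff)
    then show ?thesis using that by (simp add: \<Omega>0_def \<Omega>_def dist_norm) (simp add: sh_def)
  qed
  define \<beta> where "\<beta> = (\<lambda>z. \<psi> (\<phi> z) + \<i> * of_real s)"
  define k where "k = (\<lambda>w. \<phi>i (G (sh w)))"
  have hol\<beta>: "\<beta> holomorphic_on ball 0 1"
    unfolding \<beta>_def
    by (intro holomorphic_on_add holomorphic_on_const holomorphic_on_compose_gen[OF \<phi>(2) hol_\<psi>, unfolded o_def])
       (use \<phi>(5) in blast)
  have im\<beta>: "Im (\<beta> z) > 0" if "norm z < 1" for z
    using E_s[OF \<psi>_E[OF \<phi>(5)[of z]]] that by (simp add: \<beta>_def)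
  have holG: "(\<lambda>w. G (sh w)) holomorphic_on \<Omega>0"
    by (rule holomorphic_on_compose_gen[OF _ G(1), unfolded o_def])
       (use sh in \<open>auto simp: sh_def intro!: holomorphic_intros\<close>)
  have holk: "k holomorphic_on \<Omega>0"
    unfolding k_def by (rule holomorphic_on_compose_gen[OF holG \<phi>(1), unfolded o_def]) (use sh G(2) in blast)
  have k1: "norm (k w) < 1" if "w \<in> \<Omega>0" for w
    using \<phi>(3)[of "G (sh w)"] G(2)[OF sh[OF that]] by (simp add: k_def)
  have inv: "\<beta> (k w) = w" if "w \<in> \<Omega>0" for w
    using \<phi>(4)[of "G (sh w)"] G(2)[OF sh[OF that]] by (simp add: k_def \<beta>_def) (simp add: sh_def)
  obtain \<xi> \<epsilon> where \<xi>: "norm \<xi> = 1" "\<epsilon> > 0" "ball \<xi> \<epsilon> \<inter> ball 0 1 \<subseteq> k ` \<Omega>0"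
    unfolding \<Omega>0_def
    by (rule half_disc_right_inverse_covers[OF hol\<beta> im\<beta> r holk[unfolded \<Omega>0_def] k1[unfolded \<Omega>0_def] inv[unfolded \<Omega>0_def]])
  have "norm (\<phi> z) \<le> \<bar>a\<bar> + r + \<bar>s\<bar> + c" if z: "z \<in> ball \<xi> \<epsilon> \<inter> ball 0 1" for z
  proof -
    obtain w where w: "w \<in> \<Omega>0" "z = k w" using \<xi>(3) z by blast
    have Gw: "G (sh w) \<in> U" "norm (G (sh w) - sh w) \<le> c" using G(2)[OF sh[OF w(1)]] by auto
    have "\<phi> z = G (sh w)" using \<phi>(4)[OF Gw(1)] by (simp add: w(2) k_def)
    moreover have "norm (G (sh w)) \<le> norm (sh w) + c"
      using norm_triangle_ineq2[of "G (sh w)" "sh w"] Gw(2) by linarith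
    moreover have "norm (sh w) \<le> norm w + \<bar>s\<bar>"
      using norm_triangle_ineq4[of w "\<i> * of_real s"] by (simp add: sh_def norm_mult)
    moreover have "norm w \<le> \<bar>a\<bar> + r"
    proof -
      have "norm (of_real a - w) < r" using w(1) by (simp add: \<Omega>0_def dist_norm)
      moreover have "norm w \<le> norm (complex_of_real a) + norm (of_real a - w)"
        using norm_triangle_ineq4[of "complex_of_real a" "of_real a - w"] by simp
      ultimately show ?thesis by simp
    qed
    ultimately show ?thesis by simp
  qed
  then have "None \<notin> cluster_set \<phi> \<xi>" by (rule infinity_not_in_cluster_set[OF \<xi>(2)])
  then have "\<xi> \<notin> infinity_cluster_points \<phi>" by (simp add: infinity_cluster_points_def)
  moreover have "\<xi> \<in> sphere 0 1" using \<xi>(1) by simp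
  ultimately show ?thesis using conf by metis
qed

subsection \<open>The Baker domain\<close>

text \<open>There are infinitely many solutions of \<open>h b = -1\<close>, whereas \<open>h\<close> is not identically \<open>-1\<close>.\<close>

lemma transcendental: "transcendental_entire f"
  unfolding transcendental_entire_def
proof (intro conjI notI)
  show "f holomorphic_on UNIV" by (rule hol_f)
  assume "\<exists>p. \<forall>z. f z = poly p z"
  then obtain p where p: "\<And>z. f z = poly p z" by blast
  define P where "P = p - [:0, 1:]"
  have P: "poly P z = 1 + h z" for z using p[of z] by (simp add: P_def f_def algebra_simps)
  have "P = 0"
  proof (rule ccontr)
    assume "P \<noteq> 0"
    then have "finite {z. poly P z = 0}" by (rule poly_roots_finite)
    then have "bounded {z. poly P z = 0}" by (rule finite_imp_bounded)
    then obtain M where M: "\<And>z. poly P z = 0 \<Longrightarrow> norm z \<le> M" by (auto simp: bounded_iff)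
    obtain b where "h b = -1" "norm b > M" using fixed_exists by blast
    then show False using M[of b] P[of b] by simp
  qed
  then have "h w1 = -1" using P[of w1] by (simp add: add_eq_0_iff)
  then show False using h_half[OF V_nonempty] by simp
qed

lemma not_injective: "\<not> inj_on f U"
proof
  assume inj: "inj_on f U"
  have "R \<subseteq> U"
  proof (rule connected_subset_U[OF R(1)])
    show "R \<subseteq> fatou_set f" using R(3) A_fatou by (auto simp: A_def)
    show "R \<inter> U \<noteq> {}" using R(2) V_U by blast
  qed
  then have "c0 \<in> U" using c0 by blast
  then show False using holomorphic_injective_imp_regular[OF hol_f open_U inj] c0 by blast
qed

lemma baker_domain_properties:
  "f holomorphic_on UNIV \<and> invariant_baker_domain f U \<and>
   conformally_equivalent U (orbit_rel f U) E (int_translation_rel E) \<and> \<not> inj_on f U \<and>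
   (\<exists>\<phi>. conformal_map_from_disk \<phi> U \<and> infinity_cluster_points \<phi> \<noteq> sphere 0 1)"
proof -
  have "baker_domain f U"
    unfolding baker_domain_def
    using transcendental U_component escape_U f_U by (auto intro!: exI[of _ 1])
  then show ?thesis
    using hol_f f_U orbit_space not_injective bounded_boundary_arc
    by (simp add: invariant_baker_domain_def)
qed

end

section \<open>Elementary estimates\<close>

lemma inj_on_perturbed_translation:
  assumes V: "convex V" and h: "\<And>z. z \<in> V \<Longrightarrow> (h has_field_derivative h' z) (at z)"
    and le: "\<And>z. z \<in> V \<Longrightarrow> norm (h' z) \<le> 1/2"
  shows "inj_on (\<lambda>z::complex. z + 1 + h z) V"
proof (rule inj_onI)
  fix x y assume xy: "x \<in> V" "y \<in> V" "x + 1 + h x = y + 1 + h y"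
  have "norm (h x - h y) \<le> 1/2 * norm (x - y)"
    by (rule field_differentiable_bound[OF V has_field_derivative_at_within[OF h] le xy(1,2)])
  moreover have "h x - h y = - (x - y)" using xy(3) by (simp add: algebra_simps)
  ultimately have "norm (x - y) \<le> 1/2 * norm (x - y)" by (metis norm_minus_cancel)
  then show "x = y" by simp
qed

lemma sqrt2_bound: "3 - 2 * sqrt 2 \<ge> (1/6::real)"
proof -
  have "sqrt 2 \<le> sqrt ((17/12)\<^sup>2)" by (rule real_sqrt_le_mono) (simp add: power2_eq_square)
  then show ?thesis by simp
qed

lemma two_power_le_exp: "2 ^ n \<le> exp (real n)"
proof -
  have "2 ^ n \<le> (exp 1 :: real) ^ n" using exp_ge_add_one_self[of 1] by (intro power_mono) auto
  then show ?thesis by (simp add: exp_of_nat_mult[symmetric])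
qed

lemma exp_step: "exp (- real k) - exp (- real (Suc k)) \<ge> exp (- real k) / 2"
proof -
  have "exp (- real (Suc k)) = exp (- real k) * exp (- 1)" by (simp add: mult_exp_exp)
  moreover have "exp (- 1 :: real) \<le> 1/2"
    using exp_ge_add_one_self[of 1] by (simp add: exp_minus field_simps)
  ultimately show ?thesis using mult_left_mono[of "exp (- 1)" "1/2" "exp (- real k)"] by simp
qed

lemma dist_Re_Im:
  assumes "dist u w < e"
  shows "\<bar>Re w - Re u\<bar> < e" "\<bar>Im w - Im u\<bar> < e"
  using assms abs_Re_le_cmod[of "w - u"] abs_Im_le_cmod[of "w - u"]
  by (auto simp: dist_norm norm_minus_commute)

section \<open>The simply parabolic example\<close>

text \<open>The constant is chosen so that \<open>2 + \<i>\<close> is a critical point of \<open>z \<mapsto> z + 1 + h z\<close>: there the exponent vanishes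
  and its derivative \<open>3 \<i> z\<^sup>2 - 1\<close> has the value \<open>-13 + 9 \<i>\<close>. On the real axis \<open>h\<close> decays like
  \<open>exp (- x)\<close>, and the cubic term makes it even smaller in the sector \<open>0 < arg z < pi/3\<close> and very large
  just below the real axis.\<close>

definition h_par :: "complex \<Rightarrow> complex" where
  "h_par z = exp (\<i> * z ^ 3 - z + 13 - \<i>) / (13 - 9 * \<i>)"

text \<open>A convex domain, invariant under \<open>z \<mapsto> z + 1 + h z\<close>. The critical point \<open>2 + \<i>\<close> lies outside it but is mapped
  into it.\<close>

definition V_par :: "complex set" where
  "V_par = {z. 5/2 < Re z \<and> 2 < Re z * Im z \<and> Im z < Re z}"

lemma h_par_deriv: "(h_par has_field_derivative (3 * \<i> * z\<^sup>2 - 1) * h_par z) (at z)"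
  unfolding h_par_def by (auto intro!: derivative_eq_intros simp: field_simps)

lemma norm_h_par: "norm (h_par z) = exp (13 - Re z - 3 * (Re z)\<^sup>2 * Im z + (Im z) ^ 3) / sqrt 250"
proof -
  have "norm (13 - 9 * \<i>) = sqrt 250" by (simp add: cmod_def)
  moreover have "Re (\<i> * z ^ 3 - z + 13 - \<i>) = 13 - Re z - 3 * (Re z)\<^sup>2 * Im z + (Im z) ^ 3"
    by (simp add: power3_eq_cube power2_eq_square algebra_simps)
  ultimately show ?thesis by (simp add: h_par_def norm_divide)
qed

lemma sqrt250: "15 \<le> sqrt (250::real)" "sqrt (250::real) \<le> 16"
  by (auto intro: real_le_rsqrt real_le_lsqrt)

lemma norm_h_par_le: "norm (h_par z) \<le> exp (13 - Re z - 3 * (Re z)\<^sup>2 * Im z + (Im z) ^ 3) / 15"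
  unfolding norm_h_par using sqrt250 by (intro divide_left_mono) auto

lemma V_par_bound:
  assumes x: "2 \<le> Re z" and xy: "2 \<le> Re z * Im z" and yx: "Im z \<le> Re z"
  shows "norm (h_par z) \<le> exp (14 - 7 * Re z) / 15"
proof -
  define x where "x = Re z"
  define y where "y = Im z"
  have A: "2 \<le> x" "2 \<le> x * y" "y \<le> x" using assms by (auto simp: x_def y_def)
  have y0: "y > 0" using A by (smt (verit) mult_nonneg_nonpos)
  have "y ^ 3 - 1 \<le> 3 * x * (x * y - 2)"
  proof (cases "y \<le> 1")
    case True
    then have "y ^ 3 \<le> 1" using y0 by (simp add: power_le_one)
    moreover have "0 \<le> 3 * x * (x * y - 2)" using A by simp
    ultimately show ?thesis by linarith
  next
    case False
    have "y * y \<le> x * x" "y \<le> x * x" "1 \<le> x * x"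
      using A y0 False mult_mono[of y x y x] mult_mono[of 1 x y x] mult_mono[of 1 x 1 x] by auto
    then have "(y * y + y + 1) * (y - 1) \<le> (3 * x * x) * (y - 1)"
      using False by (intro mult_right_mono) auto
    also have "\<dots> = 3 * x * (x * y - x)" by (simp add: algebra_simps)
    also have "\<dots> \<le> 3 * x * (x * y - 2)" using A by (intro mult_left_mono) auto
    finally show ?thesis by (simp add: power3_eq_cube algebra_simps)
  qed
  then have "13 - x - 3 * x\<^sup>2 * y + y ^ 3 \<le> 14 - 7 * x" by (simp add: power2_eq_square algebra_simps)
  then have "exp (13 - x - 3 * x\<^sup>2 * y + y ^ 3) / 15 \<le> exp (14 - 7 * x) / 15" by simp
  with norm_h_par_le[of z] show ?thesis unfolding x_def y_def by (rule order.trans)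
qed

lemma V_par_bound2:
  assumes "2 \<le> Re z" "2 \<le> Re z * Im z" "Im z \<le> Re z"
  shows "norm (h_par z) * (Re z)\<^sup>2 \<le> 4/15" "norm (h_par z) \<le> 1/15"
    "5/2 \<le> Re z \<Longrightarrow> norm (h_par z) * (6 * (Re z)\<^sup>2 + 1) \<le> 1/2"
proof -
  define x where "x = Re z"
  define t where "t = 7 * (x - 2)"
  have t: "t \<ge> 0" "x = 2 + t / 7"
    using assms by (simp add: t_def x_def, simp add: t_def field_simps)
  have e: "1 + t + t\<^sup>2 / 2 \<le> exp t" by (rule exp_lower_Taylor_quadratic[OF t(1)])
  have b: "norm (h_par z) \<le> exp (- t) / 15" using V_par_bound[OF assms] by (simp add: t_def x_def algebra_simps)
  have "x\<^sup>2 = 4 + 4 * t / 7 + t\<^sup>2 / 49" by (simp add: t(2) power2_eq_square field_simps)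
  also have "\<dots> \<le> 4 * (1 + t + t\<^sup>2 / 2)"
  proof -
    have "4 * (1 + t + t\<^sup>2 / 2) - (4 + 4 * t / 7 + t\<^sup>2 / 49) = 24 * t / 7 + 97 * t\<^sup>2 / 49"
      by (simp add: field_simps)
    moreover have "24 * t / 7 + 97 * t\<^sup>2 / 49 \<ge> 0" using t(1) by simp
    ultimately show ?thesis by linarith
  qed
  also have "\<dots> \<le> 4 * exp t" using e by simp
  finally have x2: "x\<^sup>2 \<le> 4 * exp t" .
  have "norm (h_par z) * x\<^sup>2 \<le> exp (- t) / 15 * (4 * exp t)" by (rule mult_mono[OF b x2]) auto
  also have "\<dots> = 4/15" by (simp add: exp_minus)
  finally show "norm (h_par z) * (Re z)\<^sup>2 \<le> 4/15" by (simp add: x_def)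
  have "exp (- t) \<le> 1" using t by simp
  then show "norm (h_par z) \<le> 1/15" using b by linarith
  assume "5/2 \<le> Re z"
  then have t2: "7/2 \<le> t" by (simp add: t_def x_def)
  then have tt: "7/2 * t \<le> t\<^sup>2" by (simp add: power2_eq_square)
  have "6 * x\<^sup>2 + 1 = 25 + 24 * t / 7 + 6 * t\<^sup>2 / 49" by (simp add: t(2) power2_eq_square field_simps)
  also have "\<dots> \<le> 15 / 2 * (1 + t + t\<^sup>2 / 2)" using t2 tt by simp
  also have "\<dots> \<le> 15 / 2 * exp t" using e by simp
  finally have "6 * x\<^sup>2 + 1 \<le> 15 / 2 * exp t" .
  then have "norm (h_par z) * (6 * x\<^sup>2 + 1) \<le> exp (- t) / 15 * (15 / 2 * exp t)"
    by (intro mult_mono b) auto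
  also have "\<dots> = 1/2" by (simp add: exp_minus)
  finally show "norm (h_par z) * (6 * (Re z)\<^sup>2 + 1) \<le> 1/2" by (simp add: x_def)
qed

lemma V_par_step:
  assumes "2 \<le> Re z" "2 \<le> Re z * Im z" "Im z \<le> Re z"
  shows "z + 1 + h_par z \<in> V_par"
proof -
  define x where "x = Re z"
  define y where "y = Im z"
  define e where "e = norm (h_par z)"
  have A: "2 \<le> x" "2 \<le> x * y" "y \<le> x" using assms by (auto simp: x_def y_def)
  have y0: "y > 0" using A by (smt (verit) mult_nonneg_nonpos)
  have e: "0 \<le> e" "e \<le> 1/15" "e * x\<^sup>2 \<le> 4/15" using V_par_bound2[OF assms] by (auto simp: e_def x_def)
  have Rh: "\<bar>Re (h_par z)\<bar> \<le> e" "\<bar>Im (h_par z)\<bar> \<le> e"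
    unfolding e_def by (rule abs_Re_le_cmod, rule abs_Im_le_cmod)
  define X where "X = x + 1 + Re (h_par z)"
  define Y where "Y = y + Im (h_par z)"
  have X: "X \<ge> x + 14/15" and Y: "Y \<ge> y - e" "Y \<le> y + e" using Rh e by (auto simp: X_def Y_def)
  have ex: "e * x \<le> 2/15"
  proof -
    have "e * x * 2 \<le> e * x * x" using A e by (intro mult_left_mono) auto
    then show ?thesis using e(3) by (simp add: power2_eq_square mult.assoc)
  qed
  have "x * (e * x + 14/15 * e) \<le> 4/15 + 14/15 * (2/15)"
    using e(3) ex by (simp add: power2_eq_square algebra_simps)
  also have "\<dots> < 14/15 * (x * y)" using A by simp
  finally have "x * (e * x + 14/15 * e) < x * (14/15 * y)" by (simp add: algebra_simps)
  then have k: "e * x + 14/15 * e < 14/15 * y" using A by (simp add: mult_less_cancel_left)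
  have "e * x \<ge> 0" using e A by simp
  then have ye: "y - e > 0" using k by (simp add: field_simps)
  have "(x + 14/15) * (y - e) = x * y - e * x + 14/15 * y - 14/15 * e" by (simp add: field_simps)
  then have "2 < (x + 14/15) * (y - e)" using k A(2) by linarith
  also have "\<dots> \<le> X * Y" using X Y ye A by (intro mult_mono) auto
  finally have "2 < X * Y" .
  moreover have "Y < X" using X Y e A by linarith
  moreover have "5/2 < X" using X A by linarith
  ultimately show ?thesis by (simp add: V_par_def X_def Y_def x_def y_def)
qed

lemma V_par_in: "z \<in> V_par \<Longrightarrow> 5/2 \<le> Re z \<and> 2 \<le> Re z \<and> 2 \<le> Re z * Im z \<and> Im z \<le> Re z"
  by (auto simp: V_par_def)

lemma convex_V_par: "convex V_par"
proof -
  have "convex {z. 2 < Re z * Im z \<and> 0 < Re z}"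
  proof (rule convexI)
    fix z w :: complex and u v :: real
    assume H: "z \<in> {z. 2 < Re z * Im z \<and> 0 < Re z}" "w \<in> {z. 2 < Re z * Im z \<and> 0 < Re z}"
      and uv: "0 \<le> u" "0 \<le> v" "u + v = 1"
    define a b c d where abcd: "a = Re z" "b = Im z" "c = Re w" "d = Im w"
    have p: "a > 0" "c > 0" "a * b > 2" "c * d > 2" using H by (auto simp: abcd)
    have "b > 2 / a" "d > 2 / c" using p by (simp_all add: field_simps)
    have "a * d + c * b \<ge> 4"
    proof -
      have "a * d \<ge> a * (2 / c)" "c * b \<ge> c * (2 / a)"
        using mult_left_mono[of "2 / c" d a] mult_left_mono[of "2 / a" b c] \<open>b > 2 / a\<close> \<open>d > 2 / c\<close> p by simp_all
      moreover have "a * (2 / c) + c * (2 / a) \<ge> 4"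
      proof -
        have "4 * (a * c) \<le> 2 * (a * a) + 2 * (c * c)" using sum_squares_ge_zero[of "a - c" 0] by (simp add: algebra_simps)
        then show ?thesis using p by (simp add: field_simps)
      qed
      ultimately show ?thesis by linarith
    qed
    then have "u * v * (a * d + c * b) \<ge> u * v * 4" using uv by (intro mult_left_mono) auto
    moreover have "u * u * (a * b) \<ge> u * u * 2" "v * v * (c * d) \<ge> v * v * 2"
      using p by (auto intro!: mult_left_mono)
    moreover have "u * u * (a * b) > u * u * 2 \<or> v * v * (c * d) > v * v * 2"
    proof (cases "u = 0")
      case False
      then show ?thesis using p uv by (auto intro!: mult_strict_left_mono)
    qed (use uv p in auto)
    ultimately have "(u * a + v * c) * (u * b + v * d) > u * u * 2 + v * v * 2 + u * v * 4"
      by (auto simp: algebra_simps)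
    also have "u * u * 2 + v * v * 2 + u * v * 4 = 2 * (u + v) * (u + v)" by (simp add: algebra_simps)
    finally have "(u * a + v * c) * (u * b + v * d) > 2" using uv(3) by simp
    moreover have "u * a + v * c > 0"
      using p uv by (metis add_nonneg_pos add_pos_nonneg less_eq_real_def mult_nonneg_nonneg mult_pos_pos add_0 zero_neq_one)
    ultimately show "u *\<^sub>R z + v *\<^sub>R w \<in> {z. 2 < Re z * Im z \<and> 0 < Re z}"
      by (simp add: abcd)
  qed
  moreover have "convex {z. 5/2 < Re z}" by (rule convex_halfspace_Re_gt)
  moreover have "convex {z. Im z < Re z}"
    using convex_halfspace_lt[of "Complex (-1) 1" 0] by (simp add: inner_complex_def)
  moreover have "V_par = {z. 2 < Re z * Im z \<and> 0 < Re z} \<inter> {z. 5/2 < Re z} \<inter> {z. Im z < Re z}"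
    by (auto simp: V_par_def)
  ultimately show ?thesis by (metis convex_Int)
qed

lemma open_V_par: "open V_par"
proof -
  have "open {z. 5/2 < Re z}" "open {z. 2 < Re z * Im z}" "open {z. Im z < Re z}"
    by (rule open_Collect_less; intro continuous_intros)+
  moreover have "V_par = {z. 5/2 < Re z} \<inter> {z. 2 < Re z * Im z} \<inter> {z. Im z < Re z}" by (auto simp: V_par_def)
  ultimately show ?thesis by (metis open_Int)
qed

lemma cubic_growth:
  fixes L :: real
  shows "\<forall>\<^sub>F n::nat in sequentially. \<bar>13 - real n - L\<bar> + pi < 1/6 * (1/2) * (3 * real n ^ 2)"
  by real_asymp

lemma h_par_fixed: "\<exists>B. \<forall>\<^sub>F n in sequentially. \<exists>b. h_par b = -1 \<and> norm (b - of_nat n) \<le> B"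
proof -
  define q where "q = (\<lambda>z. \<i> * z ^ 3 - z + 13 - \<i>)"
  define d where "d = - (13 - 9 * \<i>)"
  have d0: "d \<noteq> 0" by (simp add: d_def complex_eq_iff)
  have dq: "deriv q z = 3 * \<i> * z\<^sup>2 - 1" for z
    unfolding q_def by (rule DERIV_imp_deriv) (auto intro!: derivative_eq_intros)
  have "\<forall>\<^sub>F n in sequentially. \<exists>b. h_par b = -1 \<and> norm (b - of_nat n) \<le> 1/2"
    using cubic_growth[of "ln (norm d)"] eventually_ge_at_top[of 2]
  proof eventually_elim
    case (elim n)
    have n2: "real n \<ge> 2" using elim by simp
    have "norm (3 * \<i> * (of_nat n)\<^sup>2 - 1 :: complex) \<ge> \<bar>Im (3 * \<i> * (of_nat n)\<^sup>2 - 1)\<bar>" by (rule abs_Im_le_cmod)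
    moreover have "Im (3 * \<i> * (of_nat n)\<^sup>2 - 1) = 3 * (real n)\<^sup>2" by (simp add: power2_eq_square)
    ultimately have lo: "norm (deriv q (of_nat n)) \<ge> 3 * (real n)\<^sup>2" unfolding dq by simp
    have "q (of_nat n) = Complex (13 - real n) (real n ^ 3 - 1)"
      by (simp add: q_def complex_eq_iff power3_eq_cube)
    then have Re: "Re (q (of_nat n)) = 13 - real n" by simp
    have up: "norm (deriv q z) \<le> 2 * norm (deriv q (of_nat n))" if "z \<in> ball (of_nat n) (1/2)" for z
    proof -
      have "norm z \<le> norm (of_nat n :: complex) + norm (z - of_nat n)" using norm_triangle_ineq[of "of_nat n" "z - of_nat n"] by simp
      then have nz: "norm z \<le> real n + 1/2" using that by (simp add: dist_norm norm_minus_commute)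
      have "norm (3 * \<i> * z\<^sup>2 - 1) \<le> norm (3 * \<i> * z\<^sup>2) + 1" using norm_triangle_ineq4[of "3 * \<i> * z\<^sup>2" 1] by simp
      also have "\<dots> = 3 * (norm z)\<^sup>2 + 1" by (simp add: norm_mult norm_power)
      also have "\<dots> \<le> 3 * (real n + 1/2)\<^sup>2 + 1" using nz by (intro add_mono mult_left_mono power_mono) auto
      also have "\<dots> \<le> 2 * (3 * (real n)\<^sup>2)"
      proof -
        have "(real n + 1/2)\<^sup>2 = (real n)\<^sup>2 + real n + 1/4" by (simp add: power2_eq_square algebra_simps)
        moreover have "2 * real n \<le> (real n)\<^sup>2" using n2 by (simp add: power2_eq_square)
        ultimately show ?thesis using n2 by linarith
      qed
      finally show ?thesis using lo by (simp add: dq)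
    qed
    have big: "\<bar>Re (q (of_nat n)) - ln (norm d)\<bar> + pi < (3 - 2 * sqrt 2) * (1/2) * norm (deriv q (of_nat n))"
    proof -
      have "1/6 * (1/2) * (3 * real n ^ 2) \<le> (3 - 2 * sqrt 2) * (1/2) * norm (deriv q (of_nat n))"
        using lo sqrt2_bound by (intro mult_mono) auto
      then show ?thesis using elim(1) Re by linarith
    qed
    have hol: "q holomorphic_on cball (of_nat n) (1/2)" unfolding q_def by (intro holomorphic_intros)
    obtain b where b: "b \<in> ball (of_nat n) (1/2)" "exp (q b) = d"
      by (rule exp_composite_surj_on_ball[OF hol _ up d0 big]) simp
    have "h_par b = -1" using b(2) d0 by (simp add: h_par_def q_def d_def divide_eq_eq)
    then show ?case using b(1) by (intro exI[of _ b]) (simp add: dist_norm norm_minus_commute)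
  qed
  then show ?thesis by blast
qed

lemma h_par_absorb:
  assumes w: "Im w > 0"
  shows "\<exists>e>0. \<forall>\<^sub>F n in sequentially. \<forall>w'\<in>ball w e. w' + of_nat n \<in> V_par"
proof -
  define y where "y = Im w"
  define t where "t = (\<lambda>n::nat. Re w - y/2 + real n)"
  have y: "y > 0" using w by (simp add: y_def)
  have "\<forall>\<^sub>F n in sequentially. t n > max (5/2) (max (4 / y) (2 * y))"
    unfolding t_def by real_asymp
  then have "\<forall>\<^sub>F n in sequentially. \<forall>w'\<in>ball w (y/2). w' + of_nat n \<in> V_par"
  proof eventually_elim
    case (elim n)
    show ?case
    proof
      fix w' assume "w' \<in> ball w (y/2)"
      then have "\<bar>Re w' - Re w\<bar> < y/2" "\<bar>Im w' - y\<bar> < y/2"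
        using dist_Re_Im[of w w' "y/2"] by (auto simp: y_def)
      then have b: "Re (w' + of_nat n) > t n" "Im (w' + of_nat n) > y/2" "Im (w' + of_nat n) < 2 * y"
        by (auto simp: t_def abs_if split: if_splits)
      have tn: "t n > 5/2" "t n > 4 / y" "t n > 2 * y" using elim by auto
      have "2 = 4 / y * (y/2)" using y by simp
      also have "\<dots> < Re (w' + of_nat n) * Im (w' + of_nat n)"
        using b tn y by (intro mult_strict_mono) auto
      finally show "w' + of_nat n \<in> V_par" using b tn by (simp add: V_par_def)
    qed
  qed
  then show ?thesis using y by (intro exI[of _ "y/2"]) auto
qed

lemma h_par_wild:
  assumes w: "Im w < 0"
  shows "\<exists>e>0. \<forall>M. \<forall>\<^sub>F n in sequentially. \<forall>w'\<in>ball w e. norm (h_par (w' + of_nat n)) > M"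
proof -
  define e where "e = - Im w / 2"
  define t where "t = (\<lambda>n::nat. Re w - e + real n)"
  have e: "e > 0" using w by (simp add: e_def)
  have "\<forall>\<^sub>F n in sequentially. \<forall>w'\<in>ball w e. norm (h_par (w' + of_nat n)) > M" for M
  proof -
    have "filterlim (\<lambda>n::nat. exp (13 - (Re w - e + real n + 2 * e) + 3 * (Re w - e + real n)\<^sup>2 * e - 27 * e ^ 3) / 16) at_top sequentially"
      using e by real_asymp
    then have "\<forall>\<^sub>F n in sequentially. exp (13 - (t n + 2 * e) + 3 * (t n)\<^sup>2 * e - 27 * e ^ 3) / 16 > M"
      unfolding t_def filterlim_at_top_dense by blast
    moreover have "\<forall>\<^sub>F n in sequentially. t n > 0" unfolding t_def by real_asymp
    ultimately show ?thesis
    proof eventually_elim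
      case (elim n)
      show ?case
      proof
        fix w' assume "w' \<in> ball w e"
        then have "\<bar>Re w' - Re w\<bar> < e" "\<bar>Im w' + 2 * e\<bar> < e"
          using dist_Re_Im[of w w' e] by (auto simp: e_def)
        define x where "x = Re (w' + of_nat n)"
        define y where "y = - Im (w' + of_nat n)"
        have x: "t n \<le> x" "x \<le> t n + 2 * e"
          using \<open>\<bar>Re w' - Re w\<bar> < e\<close> by (auto simp: x_def t_def abs_if split: if_splits)
        have y: "e \<le> y" "y \<le> 3 * e"
          using \<open>\<bar>Im w' + 2 * e\<bar> < e\<close> by (auto simp: y_def abs_if split: if_splits)
        have "(t n)\<^sup>2 * e \<le> x\<^sup>2 * y" using x y e elim by (intro mult_mono power_mono) auto
        moreover have "y ^ 3 \<le> (3 * e) ^ 3" using y e by (intro power_mono) auto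
        ultimately have "13 - (t n + 2 * e) + 3 * (t n)\<^sup>2 * e - 27 * e ^ 3 \<le> 13 - x + 3 * x\<^sup>2 * y - y ^ 3"
          using x by (simp add: power_mult_distrib)
        also have "\<dots> = 13 - x - 3 * x\<^sup>2 * (- y) + (- y) ^ 3" by (simp add: power3_eq_cube)
        finally have "exp (13 - (t n + 2 * e) + 3 * (t n)\<^sup>2 * e - 27 * e ^ 3) / 16 \<le> norm (h_par (w' + of_nat n))"
          unfolding norm_h_par using sqrt250 by (intro frac_le) (auto simp: x_def y_def)
        then show "norm (h_par (w' + of_nat n)) > M" using elim by linarith
      qed
    qed
  qed
  then show ?thesis using e by blast
qed

text \<open>The radii decrease like \<open>exp (- k)\<close>, so in the part below the real axis \<open>x\<^sup>2 |y|\<close> stays bounded and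
  the cubic term does no harm.\<close>

lemma h_par_shadow:
  assumes u: "u \<in> ball (Complex 30 (- 0)) 1 \<inter> {w. Im w > - 0}"
    and d: "dist u w < 1/4096 * exp (- real k)"
  shows "norm (h_par (w + of_nat k)) \<le> 1/4096 * (exp (- real k) - exp (- real (Suc k)))"
    and "norm (deriv h_par (w + of_nat k)) \<le> 1/2"
proof -
  define x where "x = Re (w + of_nat k)"
  define y where "y = Im (w + of_nat k)"
  have u1: "\<bar>Re u - 30\<bar> < 1" "\<bar>Im u\<bar> < 1" "Im u > 0"
    using u dist_Re_Im[of "Complex 30 0" u 1] by (auto simp: complex_eq_iff zero_complex_def)
  have d1: "\<bar>Re w - Re u\<bar> < 1/4096 * exp (- real k)" "\<bar>Im w - Im u\<bar> < 1/4096 * exp (- real k)"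
    using dist_Re_Im[OF d] by auto
  have ek: "exp (- real k) \<le> 1" "exp (- real k) > 0" by auto
  have xy: "x = Re w + real k" "y = Im w" by (simp_all add: x_def y_def)
  have x: "28 + real k \<le> x" "x \<le> 32 + real k" unfolding xy using u1 d1 ek by linarith+
  have y: "- (1/4096 * exp (- real k)) \<le> y" "y \<le> 2" unfolding xy using u1 d1 ek by linarith+
  have xk: "x\<^sup>2 \<le> 1024 * exp (real k)"
  proof -
    have "x \<le> 32 * (1 + real k / 2)" using x by simp
    also have "\<dots> \<le> 32 * exp (real k / 2)" by (intro mult_left_mono exp_ge_add_one_self) auto
    finally have "x\<^sup>2 \<le> (32 * exp (real k / 2))\<^sup>2" using x by (intro power_mono) auto
    also have "\<dots> = 1024 * exp (real k)" by (simp add: power2_eq_square mult_exp_exp)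
    finally show ?thesis .
  qed
  have "- 3 * x\<^sup>2 * y + y ^ 3 \<le> 1"
  proof (cases "y \<ge> 0")
    case True
    have "y * y \<le> x * x" using True x y by (intro mult_mono) auto
    then have "y * y \<le> 3 * (x * x)" using zero_le_square[of x] by linarith
    then have "y * (y * y) \<le> y * (3 * (x * x))" using True by (rule mult_left_mono)
    then show ?thesis by (simp add: power3_eq_cube power2_eq_square algebra_simps)
  next
    case False
    have "x\<^sup>2 * (- y) \<le> 1024 * exp (real k) * (1/4096 * exp (- real k))"
      using xk y False by (intro mult_mono) auto
    also have "\<dots> = 1/4" by (simp add: exp_minus)
    finally have "- 3 * x\<^sup>2 * y \<le> 3/4" by simp
    moreover have "y ^ 3 \<le> 0" using False by (simp add: power3_eq_cube mult_nonneg_nonpos zero_le_mult_iff mult_le_0_iff)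
    ultimately show ?thesis by linarith
  qed
  then have "13 - x - 3 * x\<^sup>2 * y + y ^ 3 \<le> - 14 - real k" using x by linarith
  then have "norm (h_par (w + of_nat k)) \<le> exp (- 14 - real k) / 15"
    by (intro order.trans[OF norm_h_par_le]) (simp add: x_def y_def)
  moreover have "exp (- 14 - real k) = exp (- 14) * exp (- real k)" by (simp add: mult_exp_exp)
  moreover have "exp (- 14 :: real) \<le> 1 / 16384" using two_power_le_exp[of 14] by (simp add: exp_minus field_simps)
  then have "exp (- 14) * exp (- real k) \<le> 1 / 16384 * exp (- real k)" by (rule mult_right_mono) simp
  ultimately have b: "norm (h_par (w + of_nat k)) \<le> 1 / 16384 * exp (- real k) / 15" by linarith
  also have "\<dots> \<le> 1/4096 * (exp (- real k) / 2)" by simp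
  also have "\<dots> \<le> 1/4096 * (exp (- real k) - exp (- real (Suc k)))"
    by (intro mult_left_mono exp_step) simp
  finally show "norm (h_par (w + of_nat k)) \<le> 1/4096 * (exp (- real k) - exp (- real (Suc k)))" .
  have "deriv h_par (w + of_nat k) = (3 * \<i> * (w + of_nat k)\<^sup>2 - 1) * h_par (w + of_nat k)"
    by (rule DERIV_imp_deriv[OF h_par_deriv])
  moreover have "norm (3 * \<i> * (w + of_nat k)\<^sup>2 - 1) \<le> 8192 * exp (real k)"
  proof -
    have "norm (3 * \<i> * (w + of_nat k)\<^sup>2 - 1) \<le> norm (3 * \<i> * (w + of_nat k)\<^sup>2) + 1"
      using norm_triangle_ineq4[of "3 * \<i> * (w + of_nat k)\<^sup>2" 1] by simp
    also have "\<dots> = 3 * (x\<^sup>2 + y\<^sup>2) + 1" by (simp add: norm_mult norm_power cmod_power2 x_def y_def)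
    also have "\<dots> \<le> 8192 * exp (real k)"
    proof -
      have "1/4096 * exp (- real k) \<le> 1" using ek(1) by linarith
      then have "- 2 \<le> y" using y(1) by linarith
      then have "y\<^sup>2 \<le> 2\<^sup>2" using y(2) by (intro power2_le_iff_abs_le[THEN iffD2]) auto
      then have "y\<^sup>2 \<le> 4" by simp
      moreover have "1 \<le> exp (real k)" by simp
      ultimately show ?thesis using xk by argo
    qed
    finally show ?thesis .
  qed
  ultimately have "norm (deriv h_par (w + of_nat k)) \<le> 8192 * exp (real k) * (1 / 16384 * exp (- real k) / 15)"
    using b by (simp only: norm_mult) (intro mult_mono, auto)
  also have "\<dots> \<le> 1/2" by (simp add: exp_minus)
  finally show "norm (deriv h_par (w + of_nat k)) \<le> 1/2" .
qed

lemma closure_upper_half_plane: "closure {w. Im w > 0} = {w. Im w \<ge> 0}"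
proof -
  have "closure {w. \<i> \<bullet> w > 0} = {w. \<i> \<bullet> w \<ge> 0}" by (rule closure_halfspace_gt) simp
  moreover have "\<i> \<bullet> w = Im w" for w by (simp add: inner_complex_def)
  ultimately show ?thesis by (simp only:)
qed

lemma perturbed_translation_h_par:
  "perturbed_translation h_par V_par {w. Im w > 0} {w. Im w < 0} ((\<lambda>t. Complex t 1) ` {2..})
     (exp 14) 0 30 1 (1/4096) (Complex 2 1) (Complex 30 (1/2))"
proof (rule perturbed_translation.intro)
  show "h_par holomorphic_on UNIV" using h_par_deriv by (auto simp: holomorphic_on_def field_differentiable_def intro: has_field_derivative_at_within)
  show "open V_par" "convex V_par" by (rule open_V_par convex_V_par)+
  show "z + 1 + h_par z \<in> V_par" if "z \<in> V_par" for z using V_par_step V_par_in[OF that] by blast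
  show "norm (h_par z) \<le> 1/2" if "z \<in> V_par" for z using V_par_bound2(2)[of z] V_par_in[OF that] by auto
  show "norm (h_par z) \<le> exp 14 * exp (- Re z)" if "z \<in> V_par" for z
  proof -
    have "norm (h_par z) \<le> exp (14 - 7 * Re z) / 15" using V_par_bound[of z] V_par_in[OF that] by blast
    also have "\<dots> \<le> exp (14 - 7 * Re z)" by simp
    also have "\<dots> \<le> exp (14 - Re z)" using V_par_in[OF that] by simp
    finally show ?thesis by (simp add: mult_exp_exp)
  qed
  show "inj_on (\<lambda>z. z + 1 + h_par z) V_par"
  proof (rule inj_on_perturbed_translation[OF convex_V_par h_par_deriv])
    fix z assume z: "z \<in> V_par"
    have V: "5/2 \<le> Re z" "2 \<le> Re z" "2 \<le> Re z * Im z" "Im z \<le> Re z" using V_par_in[OF z] by auto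
    have "Im z > 0" using V by (smt (verit) mult_nonneg_nonpos)
    then have "(Im z)\<^sup>2 \<le> (Re z)\<^sup>2" using V by (intro power_mono) auto
    then have n2: "(norm z)\<^sup>2 \<le> 2 * (Re z)\<^sup>2" by (simp add: cmod_power2)
    have "norm (3 * \<i> * z\<^sup>2 - 1) \<le> norm (3 * \<i> * z\<^sup>2) + 1" using norm_triangle_ineq4[of "3 * \<i> * z\<^sup>2" 1] by simp
    also have "\<dots> = 3 * (norm z)\<^sup>2 + 1" by (simp add: norm_mult norm_power)
    also have "\<dots> \<le> 6 * (Re z)\<^sup>2 + 1" using n2 by simp
    finally have "norm ((3 * \<i> * z\<^sup>2 - 1) * h_par z) \<le> (6 * (Re z)\<^sup>2 + 1) * norm (h_par z)"
      unfolding norm_mult by (rule mult_right_mono) auto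
    also have "\<dots> \<le> 1/2" using V_par_bound2(3)[OF V(2,3,4,1)] by (simp add: mult.commute)
    finally show "norm ((3 * \<i> * z\<^sup>2 - 1) * h_par z) \<le> 1/2" .
  qed
  show "open {w. Im w > 0}" "convex {w. Im w > 0}" by (rule open_halfspace_Im_gt convex_halfspace_Im_gt)+
  show "w + of_int k \<in> {w. Im w > 0}" if "w \<in> {w. Im w > 0}" for w k using that by simp
  show "\<exists>e>0. \<forall>\<^sub>F n in sequentially. \<forall>w'\<in>ball w e. w' + of_nat n \<in> V_par" if "w \<in> {w. Im w > 0}" for w
    using h_par_absorb that by simp
  show "open (closure {w. Im w > 0} \<union> {w. Im w < 0})"
  proof -
    have "closure {w. Im w > 0} \<union> {w. Im w < 0} = UNIV" unfolding closure_upper_half_plane by auto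
    then show ?thesis by simp
  qed
  show "\<exists>e>0. \<forall>M. \<forall>\<^sub>F n in sequentially. \<forall>w'\<in>ball w e. norm (h_par (w' + of_nat n)) > M"
    if "w \<in> {w. Im w < 0}" for w using h_par_wild that by simp
  show "\<exists>B. \<forall>\<^sub>F n in sequentially. \<exists>b. h_par b = -1 \<and> norm (b - of_nat n) \<le> B" by (rule h_par_fixed)
  show "norm (h_par (w + of_nat k)) \<le> 1/4096 * (exp (- real k) - exp (- real (Suc k)))"
    if "u \<in> ball (Complex 30 (- 0)) 1 \<inter> {w. Im w > - 0}" "dist u w < 1/4096 * exp (- real k)" for k u w
    by (rule h_par_shadow[OF that])
  show "norm (deriv h_par (w + of_nat k)) \<le> 1/2"
    if "u \<in> ball (Complex 30 (- 0)) 1 \<inter> {w. Im w > - 0}" "dist u w < 1/4096 * exp (- real k)" for k u w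
    by (rule h_par_shadow[OF that])
  show "Complex 30 (1/2) \<in> ball (Complex 30 (- 0)) 1 \<inter> {w. Im w > - 0}"
    by (simp add: dist_norm cmod_def)
  show "cball (Complex 30 (1/2)) (1/4096) \<subseteq> V_par"
  proof
    fix z assume "z \<in> cball (Complex 30 (1/2)) (1/4096)"
    then have "dist (Complex 30 (1/2)) z < 1/4" by simp
    from dist_Re_Im[OF this] have b: "29 \<le> Re z" "1/4 \<le> Im z" "Im z \<le> 1" by (auto simp: abs_if split: if_splits)
    have "29 * (1/4) \<le> Re z * Im z" using b by (intro mult_mono) auto
    then show "z \<in> V_par" using b by (simp add: V_par_def)
  qed
  show "connected ((\<lambda>t. Complex t 1) ` {2..})"
    by (intro connected_continuous_image convex_connected) (auto simp: Complex_eq intro!: continuous_intros)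
  show "(\<lambda>t. Complex t 1) ` {2..} \<inter> V_par \<noteq> {}"
  proof -
    have "Complex 3 1 \<in> (\<lambda>t. Complex t 1) ` {2..} \<inter> V_par" by (auto simp: V_par_def)
    then show ?thesis by blast
  qed
  show "\<exists>n. ((\<lambda>z. z + 1 + h_par z) ^^ n) z \<in> V_par" if "z \<in> (\<lambda>t. Complex t 1) ` {2..}" for z
    using that V_par_step[of z] by (intro exI[of _ 1]) auto
  show "Complex 2 1 \<in> (\<lambda>t. Complex t 1) ` {2..}" by auto
  show "deriv (\<lambda>z. z + 1 + h_par z) (Complex 2 1) = 0"
  proof -
    have sq: "(Complex 2 1)\<^sup>2 = Complex 3 4" by (simp add: power2_eq_square complex_eq_iff)
    have cube: "(Complex 2 1) ^ 3 = Complex 2 11" by (simp add: power3_eq_cube complex_eq_iff)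
    have "\<i> * (Complex 2 1) ^ 3 - Complex 2 1 + 13 - \<i> = 0" unfolding cube by (simp add: complex_eq_iff)
    then have "h_par (Complex 2 1) = 1 / (13 - 9 * \<i>)" by (simp add: h_par_def)
    moreover have "3 * \<i> * (Complex 2 1)\<^sup>2 - 1 = - (13 - 9 * \<i>)" unfolding sq by (simp add: complex_eq_iff)
    moreover have "- d * (1 / d) = -1" if "d \<noteq> 0" for d :: complex using that by simp
    moreover have "13 - 9 * \<i> \<noteq> 0" by (simp add: complex_eq_iff)
    ultimately have "(3 * \<i> * (Complex 2 1)\<^sup>2 - 1) * h_par (Complex 2 1) = -1" by metis
    then have "((\<lambda>z. z + 1 + h_par z) has_field_derivative 1 + 0 + -1) (at (Complex 2 1))"
      using h_par_deriv[of "Complex 2 1"] by (intro DERIV_add DERIV_ident DERIV_const) simp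
    then show ?thesis by (simp add: DERIV_imp_deriv)
  qed
qed (auto)

section \<open>The hyperbolic example\<close>

text \<open>Here \<open>exp (- exp z)\<close> is small for \<open>|Im z| < pi/2\<close> and large just beyond, while the factor \<open>exp (- 2 z)\<close> provides
  decay on the boundary of the strip. The constant makes \<open>ln 4\<close> a critical point of \<open>z \<mapsto> z + 1 + h z\<close>.\<close>

definition h_hyp :: "complex \<Rightarrow> complex" where
  "h_hyp z = 8/3 * exp (4 - 2 * z - exp z)"

text \<open>A convex domain in the strip, invariant under \<open>z \<mapsto> z + 1 + h z\<close>: it
  consists of the points with \<open>Re z > ln 6 - ln (cos y)\<close> for \<open>y = Im z\<close>, and \<open>- ln (cos y)\<close> is convex.\<close>

definition V_hyp :: "complex set" where
  "V_hyp = {z. \<bar>Im z\<bar> < pi/2 \<and> 6 < Re (exp z)}"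

lemma h_hyp_deriv: "(h_hyp has_field_derivative - (2 + exp z) * h_hyp z) (at z)"
  unfolding h_hyp_def by (auto intro!: derivative_eq_intros simp: field_simps)

lemma norm_h_hyp: "norm (h_hyp z) = 8/3 * exp (4 - 2 * Re z - Re (exp z))"
  by (simp add: h_hyp_def norm_mult)

lemma norm_exp_minus_one_le:
  assumes "norm z \<le> 1/2"
  shows "norm (exp z - 1) \<le> 2 * norm (z::complex)"
proof -
  have "norm (exp z - exp 0) \<le> 2 * norm (z - 0)"
  proof (rule field_differentiable_bound[of "cball 0 (1/2)" exp exp])
    show "(exp has_field_derivative exp x) (at x within cball 0 (1/2))" for x :: complex
      by (rule has_field_derivative_at_within) (rule DERIV_exp)
    show "norm (exp x) \<le> 2" if "x \<in> cball 0 (1/2)" for x :: complex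
    proof -
      have "Re x \<le> 1/2" using that complex_Re_le_cmod[of x] by simp
      then have "exp (Re x) ^ 2 \<le> exp 1" by (simp flip: exp_of_nat_mult)
      also have "\<dots> \<le> 2 ^ 2" using exp_le by simp
      finally have "exp (Re x) \<le> 2" by (rule power2_le_imp_le) simp
      then show ?thesis by simp
    qed
  qed (use assms in auto)
  then show ?thesis by simp
qed

lemma V_hyp_facts:
  assumes "z \<in> V_hyp"
  shows "6 < exp (Re z)" "norm (h_hyp z) \<le> exp (- Re z) ^ 2"
proof -
  have "6 < exp (Re z) * cos (Im z)" using assms by (simp add: V_hyp_def Re_exp)
  also have "\<dots> \<le> exp (Re z)" by (simp add: mult_left_le)
  finally show "6 < exp (Re z)" .
  have "norm (h_hyp z) \<le> 8/3 * exp (- 2 * Re z + - 2)"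
    unfolding norm_h_hyp using assms by (simp add: V_hyp_def)
  also have "\<dots> = 8/3 * exp (- 2) * exp (- 2 * Re z)" by (simp add: mult_exp_exp)
  also have "8/3 * exp (- 2) \<le> (1::real)"
    using two_power_le_exp[of 2] by (simp add: exp_minus field_simps)
  then have "8/3 * exp (- 2) * exp (- 2 * Re z) \<le> 1 * exp (- 2 * Re z)" by (rule mult_right_mono) simp
  also have "\<dots> = exp (- Re z) ^ 2" by (simp flip: exp_of_nat_mult)
  finally show "norm (h_hyp z) \<le> exp (- Re z) ^ 2" .
qed

lemma V_hyp_facts2:
  assumes "z \<in> V_hyp"
  shows "exp (Re z) * norm (h_hyp z) \<le> 1/6" "norm (h_hyp z) \<le> 1/36" "norm (h_hyp z) \<le> exp (- Re z)"
proof -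
  define e where "e = exp (- Re z)"
  have e: "0 < e" "e \<le> 1/6" "exp (Re z) * e = 1" using V_hyp_facts(1)[OF assms] by (auto simp: e_def exp_minus field_simps)
  have b: "norm (h_hyp z) \<le> e * e" using V_hyp_facts(2)[OF assms] by (simp add: e_def power2_eq_square)
  have "exp (Re z) * norm (h_hyp z) \<le> exp (Re z) * (e * e)" using b by (rule mult_left_mono) simp
  also have "\<dots> = e" using e(3) by (simp flip: mult.assoc)
  finally show "exp (Re z) * norm (h_hyp z) \<le> 1/6" using e by linarith
  have "e * e \<le> 1/6 * (1/6)" using e by (intro mult_mono) auto
  then show "norm (h_hyp z) \<le> 1/36" using b by simp
  have "e * e \<le> e" using e by (simp add: mult_left_le)
  with b show "norm (h_hyp z) \<le> exp (- Re z)" unfolding e_def by (rule order_trans)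
qed

lemma V_hyp_step:
  assumes z: "z \<in> V_hyp"
  shows "z + 1 + h_hyp z \<in> V_hyp"
proof -
  define w where "w = z + 1 + h_hyp z"
  have hh: "norm (h_hyp z) \<le> 1/36" by (rule V_hyp_facts2(2)[OF z])
  have "norm (exp z * (exp (h_hyp z) - 1)) \<le> exp (Re z) * (2 * norm (h_hyp z))"
    unfolding norm_mult norm_exp_eq_Re using hh by (intro mult_left_mono norm_exp_minus_one_le) auto
  also have "\<dots> \<le> 1" using V_hyp_facts2(1)[OF z] by simp
  finally have "\<bar>Re (exp z * (exp (h_hyp z) - 1))\<bar> \<le> 1" using abs_Re_le_cmod order_trans by blast
  moreover have "exp z * exp (h_hyp z) = exp z + exp z * (exp (h_hyp z) - 1)" by (simp add: algebra_simps)
  then have "Re (exp z * exp (h_hyp z)) = Re (exp z) + Re (exp z * (exp (h_hyp z) - 1))" by (metis plus_complex.simps(1))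
  moreover have "6 < Re (exp z)" using z by (simp add: V_hyp_def)
  ultimately have "Re (exp z * exp (h_hyp z)) > 5" by argo
  then have "2 * 5 < exp 1 * Re (exp z * exp (h_hyp z))"
    using exp_ge_add_one_self[of 1] by (intro mult_le_less_imp_less) auto
  moreover have "exp w = of_real (exp 1) * (exp z * exp (h_hyp z))"
    by (simp add: w_def exp_add algebra_simps flip: exp_of_real)
  then have "Re (exp w) = exp 1 * Re (exp z * exp (h_hyp z))" by (metis scaleR_complex.sel(1) scaleR_conv_of_real)
  ultimately have R: "Re (exp w) > 10" by simp
  have "\<bar>Im (h_hyp z)\<bar> \<le> 1/36" using hh abs_Im_le_cmod[of "h_hyp z"] by linarith
  then have "\<bar>Im w\<bar> < 3/2 * pi" using z pi_gt3 by (auto simp: w_def V_hyp_def abs_if split: if_splits)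
  moreover have "0 < exp (Re w) * cos (Im w)" using R unfolding Re_exp by (rule order_less_trans[rotated]) simp
  then have "cos (Im w) > 0" by (rule zero_less_mult_pos) simp
  ultimately have "\<bar>Im w\<bar> < pi/2"
  proof -
    assume a: "\<bar>Im w\<bar> < 3/2 * pi" "cos (Im w) > 0"
    have "cos \<bar>Im w\<bar> > 0" using a(2) by (simp add: abs_if)
    moreover have "cos t \<le> 0" if "pi/2 \<le> t" "t < 3/2 * pi" for t
    proof -
      have "cos t = - sin (t - pi/2)" by (simp add: sin_diff)
      moreover have "sin (t - pi/2) \<ge> 0" using that by (intro sin_ge_zero) auto
      ultimately show ?thesis by simp
    qed
    ultimately show ?thesis using a(1) by (meson not_le)
  qed
  then show ?thesis using R by (simp add: V_hyp_def w_def)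
qed

lemma open_V_hyp: "open V_hyp"
proof -
  have "V_hyp = {z. \<bar>Im z\<bar> < pi/2} \<inter> {z. 6 < Re (exp z)}" by (auto simp: V_hyp_def)
  moreover have "open {z. \<bar>Im z\<bar> < pi/2}" "open {z. 6 < Re (exp z)}"
    by (rule open_Collect_less; intro continuous_intros)+
  ultimately show ?thesis by (metis open_Int)
qed

lemma convex_V_hyp: "convex V_hyp"
proof -
  define I where "I = {- (pi/2) <..< pi/2}"
  have cpos: "cos y > 0" if "y \<in> I" for y using that by (auto simp: I_def intro: cos_gt_zero_pi)
  have conv: "convex_on I (\<lambda>y. - ln (cos y))"
  proof (rule f''_ge0_imp_convex[where f' = tan and f'' = "\<lambda>y. inverse ((cos y)\<^sup>2)"])
    show "convex I" by (simp add: I_def)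
    show "((\<lambda>y. - ln (cos y)) has_real_derivative tan y) (at y)" if "y \<in> I" for y
      using cpos[OF that] by (auto intro!: derivative_eq_intros simp: tan_def field_simps)
    show "(tan has_real_derivative inverse ((cos y)\<^sup>2)) (at y)" if "y \<in> I" for y
      using cpos[OF that] by (intro DERIV_tan) simp
  qed simp
  have iff: "z \<in> V_hyp \<longleftrightarrow> Im z \<in> I \<and> ln 6 + - ln (cos (Im z)) < Re z" for z
  proof -
    have "6 < exp (Re z) * cos (Im z) \<longleftrightarrow> ln 6 + - ln (cos (Im z)) < Re z" if "Im z \<in> I"
    proof -
      have "6 < exp (Re z) * cos (Im z) \<longleftrightarrow> ln 6 < ln (exp (Re z) * cos (Im z))"
        using cpos[OF that] by simp
      also have "\<dots> \<longleftrightarrow> ln 6 + - ln (cos (Im z)) < Re z" using cpos[OF that] by (simp add: ln_mult) linarith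
      finally show ?thesis .
    qed
    moreover have "Im z \<in> I \<longleftrightarrow> \<bar>Im z\<bar> < pi/2" unfolding I_def by (simp only: greaterThanLessThan_iff abs_less_iff) argo
    ultimately show ?thesis unfolding V_hyp_def mem_Collect_eq Re_exp by blast
  qed
  show ?thesis
  proof (rule convexI)
    fix z w :: complex and u v :: real
    assume H: "z \<in> V_hyp" "w \<in> V_hyp" and uv: "0 \<le> u" "0 \<le> v" "u + v = 1"
    define y where "y = u * Im z + v * Im w"
    have zI: "Im z \<in> I" "Im w \<in> I" and lt: "ln 6 + - ln (cos (Im z)) < Re z" "ln 6 + - ln (cos (Im w)) < Re w"
      using H iff by auto
    have "convex I" by (simp add: I_def)
    then have yI: "y \<in> I" unfolding y_def using convexD[of I "Im z" "Im w" u v] zI uv by simp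
    have "- ln (cos y) \<le> u * - ln (cos (Im z)) + v * - ln (cos (Im w))"
    proof -
      have u: "u = 1 - v" using uv(3) by simp
      show ?thesis using convex_onD[OF conv, of v "Im z" "Im w"] uv(1,2) zI unfolding y_def u by simp
    qed
    moreover have "u * (ln 6 + - ln (cos (Im z))) + v * (ln 6 + - ln (cos (Im w))) < u * Re z + v * Re w"
    proof (cases "u = 0")
      case False
      then show ?thesis using lt uv by (intro add_less_le_mono mult_strict_left_mono mult_left_mono) auto
    qed (use lt uv in auto)
    moreover have "u * (ln 6 + - ln (cos (Im z))) + v * (ln 6 + - ln (cos (Im w)))
       = (u + v) * ln 6 + (u * - ln (cos (Im z)) + v * - ln (cos (Im w)))" by (simp add: algebra_simps)
    ultimately have "ln 6 + - ln (cos y) < u * Re z + v * Re w" using uv(3) by simp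
    then show "u *\<^sub>R z + v *\<^sub>R w \<in> V_hyp" using yI iff by (simp add: y_def)
  qed
qed

text \<open>The fixed points are found near \<open>n + \<i> pi/2\<close>, where \<open>exp z\<close> is imaginary.\<close>

lemma h_hyp_fixed: "\<exists>B. \<forall>\<^sub>F n in sequentially. \<exists>b. h_hyp b = -1 \<and> norm (b - of_nat n) \<le> B"
proof -
  define q where "q = (\<lambda>z::complex. 4 - 2 * z - exp z)"
  define d where "d = (- 3 / 8 :: complex)"
  have d0: "d \<noteq> 0" by (simp add: d_def)
  have dq: "deriv q z = - 2 - exp z" for z
    unfolding q_def by (rule DERIV_imp_deriv) (auto intro!: derivative_eq_intros)
  have ev: "\<forall>\<^sub>F n::nat in sequentially. \<bar>4 - 2 * real n - L\<bar> + pi < 1/6 * (1/2) * exp (real n)" for L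
    by real_asymp
  have "\<forall>\<^sub>F n in sequentially. \<exists>b. h_hyp b = -1 \<and> norm (b - of_nat n) \<le> 3"
    using ev[of "ln (norm d)"] eventually_ge_at_top[of 3]
  proof eventually_elim
    case (elim n)
    define a where "a = Complex (real n) (pi/2)"
    have ea: "exp a = \<i> * of_real (exp (real n))"
      by (simp add: a_def complex_eq_iff Re_exp Im_exp)
    have "2 ^ 3 \<le> exp (real n)" using order.trans[OF power_increasing[of 3 n 2] two_power_le_exp[of n]] elim by simp
    then have e8: "8 \<le> exp (real n)" by simp
    have "exp (real n) = \<bar>Im (- 2 - exp a)\<bar>" by (simp add: ea)
    also have "\<dots> \<le> norm (- 2 - exp a)" by (rule abs_Im_le_cmod)
    finally have lo: "exp (real n) \<le> norm (deriv q a)" by (simp only: dq)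
    have Re: "Re (q a) = 4 - 2 * real n" by (simp add: q_def ea) (simp add: a_def)
    have up: "norm (deriv q z) \<le> 2 * norm (deriv q a)" if "z \<in> ball a (1/2)" for z
    proof -
      have "dist a z < 1/2" using that by simp
      moreover have "Re a = real n" by (simp add: a_def)
      ultimately have "Re z \<le> real n + 1/2" using dist_Re_Im(1)[of a z "1/2"] by linarith
      then have "exp (Re z) \<le> exp (real n) * exp (1/2)" by (simp add: mult_exp_exp)
      also have "exp (1/2 :: real) \<le> 7/4"
      proof (rule power2_le_imp_le)
        have "exp (1/2 :: real) ^ 2 = exp 1" by (simp flip: exp_of_nat_mult)
        then show "exp (1/2 :: real) ^ 2 \<le> (7/4) ^ 2" using exp_le by (simp add: power2_eq_square)
      qed simp
      then have "exp (real n) * exp (1/2) \<le> exp (real n) * (7/4)" by (rule mult_left_mono) simp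
      finally have "2 + exp (Re z) \<le> 2 * exp (real n)" using e8 by simp
      moreover have "norm (- 2 - exp z) \<le> 2 + exp (Re z)" using norm_triangle_ineq4[of "- 2" "exp z"] by simp
      ultimately show ?thesis using lo by (simp add: dq)
    qed
    have big: "\<bar>Re (q a) - ln (norm d)\<bar> + pi < (3 - 2 * sqrt 2) * (1/2) * norm (deriv q a)"
    proof -
      have "1/6 * (1/2) * exp (real n) \<le> (3 - 2 * sqrt 2) * (1/2) * norm (deriv q a)"
        using lo sqrt2_bound by (intro mult_mono) auto
      then show ?thesis using elim(1) Re by linarith
    qed
    have hol: "q holomorphic_on cball a (1/2)" unfolding q_def by (intro holomorphic_intros)
    obtain b where b: "b \<in> ball a (1/2)" "exp (q b) = d"
      by (rule exp_composite_surj_on_ball[OF hol _ up d0 big]) simp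
    have "h_hyp b = -1" using b(2) by (simp add: h_hyp_def q_def d_def)
    moreover have "norm (b - of_nat n) \<le> norm (b - a) + norm (a - of_nat n)"
      using norm_triangle_ineq[of "b - a" "a - of_nat n"] by simp
    moreover have "a - of_nat n = \<i> * of_real (pi/2)" by (simp add: a_def complex_eq_iff)
    then have "norm (a - of_nat n) = norm (\<i> * complex_of_real (pi/2))" by (simp only:)
    then have "norm (a - of_nat n) = pi/2" by (simp add: norm_mult)
    ultimately show ?case using b(1) pi_less_4 by (intro exI[of _ b]) (simp add: dist_norm norm_minus_commute)
  qed
  then show ?thesis by blast
qed

lemma h_hyp_absorb:
  assumes w: "\<bar>Im w\<bar> < pi/2"
  shows "\<exists>e>0. \<forall>\<^sub>F n in sequentially. \<forall>w'\<in>ball w e. w' + of_nat n \<in> V_hyp"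
proof -
  define e where "e = (pi/2 - \<bar>Im w\<bar>) / 2"
  have e: "e > 0" using w by (simp add: e_def)
  have in_strip: "\<bar>Im w'\<bar> < pi/2" if "w' \<in> cball w e" for w'
    using that abs_Im_le_cmod[of "w - w'"] w by (auto simp: dist_norm e_def abs_if split: if_splits)
  obtain m where m: "m \<in> cball w e" "\<And>w'. w' \<in> cball w e \<Longrightarrow> cos (Im m) \<le> cos (Im w')"
    using continuous_attains_inf[of "cball w e" "\<lambda>w. cos (Im w)"] e by (force intro!: continuous_intros)
  define \<delta> where "\<delta> = cos (Im m)"
  have \<delta>: "\<delta> > 0" unfolding \<delta>_def using in_strip[OF m(1)] by (intro cos_gt_zero_pi) auto
  have "\<forall>\<^sub>F n::nat in sequentially. exp (Re w - e + real n) * \<delta> > 6"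
    using \<delta> by real_asymp
  then have "\<forall>\<^sub>F n in sequentially. \<forall>w'\<in>ball w e. w' + of_nat n \<in> V_hyp"
  proof eventually_elim
    case (elim n)
    show ?case
    proof
      fix w' assume w': "w' \<in> ball w e"
      then have c: "w' \<in> cball w e" by simp
      have "\<bar>Re w' - Re w\<bar> < e" using dist_Re_Im(1)[of w w' e] w' by simp
      then have "exp (Re w - e + real n) * \<delta> \<le> exp (Re w' + real n) * cos (Im w')"
        using m(2)[OF c] \<delta> by (intro mult_mono) (auto simp: \<delta>_def)
      then show "w' + of_nat n \<in> V_hyp" using elim in_strip[OF c] by (simp add: V_hyp_def Re_exp)
    qed
  qed
  then show ?thesis using e by blast
qed

lemma h_hyp_wild:
  assumes w: "pi/2 < \<bar>Im w\<bar>" "\<bar>Im w\<bar> < 3/2 * pi"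
  shows "\<exists>e>0. \<forall>M. \<forall>\<^sub>F n in sequentially. \<forall>w'\<in>ball w e. norm (h_hyp (w' + of_nat n)) > M"
proof -
  define e where "e = min (\<bar>Im w\<bar> - pi/2) (3/2 * pi - \<bar>Im w\<bar>) / 2"
  have e: "e > 0" using w by (simp add: e_def)
  have neg: "cos (Im w') < 0" if "w' \<in> cball w e" for w'
  proof -
    define t where "t = \<bar>Im w'\<bar>"
    have "\<bar>Im w - Im w'\<bar> \<le> e" using that abs_Im_le_cmod[of "w - w'"] by (simp add: dist_norm)
    then have "\<bar>Im w\<bar> - e \<le> t" "t \<le> \<bar>Im w\<bar> + e" by (auto simp: t_def)
    moreover have "e \<le> (\<bar>Im w\<bar> - pi/2) / 2" "e \<le> (3/2 * pi - \<bar>Im w\<bar>) / 2" by (simp_all add: e_def)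
    ultimately have t: "pi/2 < t" "t < 3/2 * pi" using w by argo+
    have "cos t = - sin (t - pi/2)" by (simp add: sin_diff)
    moreover have "sin (t - pi/2) > 0" using t by (intro sin_gt_zero) auto
    ultimately have "cos t < 0" by simp
    then show ?thesis by (simp add: t_def abs_if split: if_splits)
  qed
  obtain m where m: "m \<in> cball w e" "\<And>w'. w' \<in> cball w e \<Longrightarrow> cos (Im w') \<le> cos (Im m)"
    using continuous_attains_sup[of "cball w e" "\<lambda>w. cos (Im w)"] e by (force intro!: continuous_intros)
  define \<delta> where "\<delta> = - cos (Im m)"
  have \<delta>: "\<delta> > 0" unfolding \<delta>_def using neg[OF m(1)] by simp
  have "\<forall>\<^sub>F n in sequentially. \<forall>w'\<in>ball w e. norm (h_hyp (w' + of_nat n)) > M" for M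
  proof -
    have "filterlim (\<lambda>n::nat. 8/3 * exp (4 - 2 * (Re w + e + real n) + exp (Re w - e + real n) * \<delta>)) at_top sequentially"
      using \<delta> by real_asymp
    then have "\<forall>\<^sub>F n::nat in sequentially. 8/3 * exp (4 - 2 * (Re w + e + real n) + exp (Re w - e + real n) * \<delta>) > M"
      unfolding filterlim_at_top_dense by blast
    then show ?thesis
    proof eventually_elim
      case (elim n)
      show ?case
      proof
        fix w' assume w': "w' \<in> ball w e"
        then have c: "w' \<in> cball w e" by simp
        have r: "\<bar>Re w' - Re w\<bar> < e" using dist_Re_Im(1)[of w w' e] w' by simp
        have "exp (Re w - e + real n) * \<delta> \<le> exp (Re w' + real n) * (- cos (Im w'))"
          using m(2)[OF c] \<delta> r by (intro mult_mono) (auto simp: \<delta>_def)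
        then have "8/3 * exp (4 - 2 * (Re w + e + real n) + exp (Re w - e + real n) * \<delta>)
            \<le> norm (h_hyp (w' + of_nat n))"
          unfolding norm_h_hyp using r by (simp add: Re_exp)
        then show "norm (h_hyp (w' + of_nat n)) > M" using elim by linarith
      qed
    qed
  qed
  then show ?thesis using e by blast
qed

lemma closure_strip: "closure {w. - (pi/2) < Im w \<and> Im w < pi/2} = {w. - (pi/2) \<le> Im w \<and> Im w \<le> pi/2}"
proof -
  have "{w. - (pi/2) < Im w \<and> Im w < pi/2} = interior {w. - (pi/2) \<le> Im w \<and> Im w \<le> pi/2}"
  proof -
    have 1: "interior {w. Im w \<le> pi/2} = {w. Im w < pi/2}"
      using interior_halfspace_le[of \<i> "pi/2"] by (simp only: inner_complex_def) simp
    have 2: "interior {w. Im w \<ge> - (pi/2)} = {w. Im w > - (pi/2)}"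
      using interior_halfspace_ge[of \<i> "- (pi/2)"] by (simp only: inner_complex_def) simp
    show ?thesis unfolding Collect_conj_eq interior_Int 1 2 ..
  qed
  moreover have "closure (interior {w. - (pi/2) \<le> Im w \<and> Im w \<le> pi/2}) = closure {w. - (pi/2) \<le> Im w \<and> Im w \<le> pi/2}"
  proof (rule convex_closure_interior)
    show "convex {w. - (pi/2) \<le> Im w \<and> Im w \<le> pi/2}"
      unfolding Collect_conj_eq by (intro convex_Int convex_halfspace_Im_ge convex_halfspace_Im_le)
    have "0 \<in> interior {w. - (pi/2) \<le> Im w \<and> Im w \<le> pi/2}"
      unfolding calculation[symmetric] by simp
    then show "interior {w. - (pi/2) \<le> Im w \<and> Im w \<le> pi/2} \<noteq> {}" by blast
  qed
  moreover have "closed {w. - (pi/2) \<le> Im w \<and> Im w \<le> pi/2}"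
    unfolding Collect_conj_eq by (intro closed_Int closed_halfspace_Im_ge closed_halfspace_Im_le)
  ultimately show ?thesis by simp
qed

text \<open>Close to the lower boundary line of the strip, \<open>t = y + pi/2\<close> may be negative, but then
  \<open>exp x |sin t| \<le> exp x c exp (- k) \<le> 1\<close> by the choice of \<open>c = exp (- 23)\<close>.\<close>

lemma h_hyp_shadow:
  assumes u: "u \<in> ball (Complex 20 (- (pi/2))) 2 \<inter> {w. Im w > - (pi/2)}"
    and d: "dist u w < exp (- 23) * exp (- real k)"
  shows "norm (h_hyp (w + of_nat k)) \<le> exp (- 23) * (exp (- real k) - exp (- real (Suc k)))"
    and "norm (deriv h_hyp (w + of_nat k)) \<le> 1/2"
proof -
  define \<epsilon> where "\<epsilon> = exp (- 23) * exp (- real k)"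
  define x where "x = Re w + real k"
  define t where "t = Im w + pi/2"
  have \<epsilon>: "0 < \<epsilon>" "\<epsilon> \<le> 1" "\<epsilon> = exp (- (23 + real k))" by (auto simp: \<epsilon>_def mult_exp_exp)
  have "dist (Complex 20 (- (pi/2))) u < 2" using u by simp
  from dist_Re_Im[OF this] have u1: "\<bar>Re u - 20\<bar> < 2" "\<bar>Im u + pi/2\<bar> < 2" by simp_all
  have u2: "Im u > - (pi/2)" using u by simp
  have d1: "\<bar>Re w - Re u\<bar> < \<epsilon>" "\<bar>Im w - Im u\<bar> < \<epsilon>" using dist_Re_Im[OF d] by (auto simp: \<epsilon>_def)
  have x: "17 + real k \<le> x" "x \<le> 23 + real k" unfolding x_def using u1 d1 \<epsilon> by argo+
  have t: "- \<epsilon> < t" "t \<le> 3" unfolding t_def using u1 u2 d1 \<epsilon> by argo+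
  have "- 1 \<le> exp x * sin t"
  proof (cases "t \<ge> 0")
    case True
    then have "sin t \<ge> 0" using t pi_gt3 by (intro sin_ge_zero) auto
    then have "0 \<le> exp x * sin t" by simp
    then show ?thesis by linarith
  next
    case False
    have "\<bar>sin t\<bar> \<le> \<bar>t\<bar>" by (rule abs_sin_x_le_abs_x)
    then have "- sin t \<le> \<epsilon>" using t False by argo
    then have "exp x * (- sin t) \<le> exp x * \<epsilon>" by (rule mult_left_mono) simp
    also have "\<dots> \<le> exp (23 + real k) * \<epsilon>" using x(2) \<epsilon>(1) by (intro mult_right_mono) auto
    also have "\<dots> = 1" unfolding \<epsilon>(3) by (simp add: mult_exp_exp)
    finally show ?thesis by simp
  qed
  moreover have "cos (Im w) = sin t" by (simp add: t_def sin_add)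
  ultimately have e1: "- 1 \<le> Re (exp (w + of_nat k))" by (simp add: Re_exp x_def)
  have "norm (h_hyp (w + of_nat k)) \<le> 8/3 * exp (- 29 - 2 * real k)"
    unfolding norm_h_hyp using e1 x by (simp add: x_def)
  also have "\<dots> = (8/3 * exp (- 6)) * (exp (- real k) * \<epsilon>)"
    unfolding \<epsilon>(3) by (simp add: mult_exp_exp)
  also have "8/3 * exp (- 6) \<le> (1/16 :: real)"
    using two_power_le_exp[of 6] by (simp add: exp_minus field_simps)
  then have "(8/3 * exp (- 6)) * (exp (- real k) * \<epsilon>) \<le> 1/16 * (exp (- real k) * \<epsilon>)"
    by (rule mult_right_mono) (use \<epsilon> in simp)
  finally have b: "norm (h_hyp (w + of_nat k)) \<le> 1/16 * (exp (- real k) * \<epsilon>)" .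
  have ek: "exp (- real k) \<le> 1" by simp
  have "1/16 * (exp (- real k) * \<epsilon>) \<le> 1/16 * (1 * \<epsilon>)"
    using \<epsilon>(1) by (intro mult_left_mono mult_right_mono ek) auto
  also have "\<dots> \<le> exp (- 23) * (exp (- real k) / 2)" by (simp add: \<epsilon>_def)
  also have "\<dots> \<le> exp (- 23) * (exp (- real k) - exp (- real (Suc k)))"
    by (intro mult_left_mono exp_step) simp
  finally show "norm (h_hyp (w + of_nat k)) \<le> exp (- 23) * (exp (- real k) - exp (- real (Suc k)))"
    using b by linarith
  have "deriv h_hyp (w + of_nat k) = - (2 + exp (w + of_nat k)) * h_hyp (w + of_nat k)"
    by (rule DERIV_imp_deriv[OF h_hyp_deriv])
  then have "norm (deriv h_hyp (w + of_nat k)) = norm (2 + exp (w + of_nat k)) * norm (h_hyp (w + of_nat k))"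
    by (simp only: norm_mult norm_minus_cancel)
  also have "\<dots> \<le> (3 * exp (23 + real k)) * (1/16 * (exp (- real k) * \<epsilon>))"
  proof (rule mult_mono[OF _ b])
    have "norm (2 + exp (w + of_nat k)) \<le> 2 + exp x"
      using norm_triangle_ineq[of 2 "exp (w + of_nat k)"] by (simp add: x_def)
    also have "\<dots> \<le> 3 * exp (23 + real k)"
    proof -
      have "exp x \<le> exp (23 + real k)" "1 \<le> exp (23 + real k)" using x by simp_all
      then show ?thesis by argo
    qed
    finally show "norm (2 + exp (w + of_nat k)) \<le> 3 * exp (23 + real k)" .
  qed auto
  also have "\<dots> = 3/16 * exp (- real k)" unfolding \<epsilon>(3) by (simp add: mult_exp_exp)
  also have "\<dots> \<le> 1/2" using ek by argo
  finally show "norm (deriv h_hyp (w + of_nat k)) \<le> 1/2" .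
qed

lemma perturbed_translation_h_hyp:
  "perturbed_translation h_hyp V_hyp {w. - (pi/2) < Im w \<and> Im w < pi/2}
     {w. pi/2 < \<bar>Im w\<bar> \<and> \<bar>Im w\<bar> < 3/2 * pi} (of_real ` {ln 4..})
     1 (pi/2) 20 2 (exp (- 23)) (of_real (ln 4)) 20"
proof (rule perturbed_translation.intro)
  show "h_hyp holomorphic_on UNIV" using h_hyp_deriv by (auto simp: holomorphic_on_def field_differentiable_def intro: has_field_derivative_at_within)
  show "open V_hyp" "convex V_hyp" by (rule open_V_hyp convex_V_hyp)+
  show "z + 1 + h_hyp z \<in> V_hyp" if "z \<in> V_hyp" for z using V_hyp_step[OF that] .
  show "norm (h_hyp z) \<le> 1/2" if "z \<in> V_hyp" for z using V_hyp_facts2(2)[OF that] by simp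
  show "norm (h_hyp z) \<le> 1 * exp (- Re z)" if "z \<in> V_hyp" for z using V_hyp_facts2(3)[OF that] by simp
  show "inj_on (\<lambda>z. z + 1 + h_hyp z) V_hyp"
  proof (rule inj_on_perturbed_translation[OF convex_V_hyp h_hyp_deriv])
    fix z assume z: "z \<in> V_hyp"
    have "norm (- (2 + exp z) * h_hyp z) = norm (2 + exp z) * norm (h_hyp z)" by (simp only: norm_mult norm_minus_cancel)
    also have "\<dots> \<le> (2 + exp (Re z)) * norm (h_hyp z)"
      using norm_triangle_ineq[of 2 "exp z"] by (intro mult_right_mono) auto
    also have "\<dots> = 2 * norm (h_hyp z) + exp (Re z) * norm (h_hyp z)" by (simp add: algebra_simps)
    also have "\<dots> \<le> 1/2" using V_hyp_facts2(1,2)[OF z] by simp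
    finally show "norm (- (2 + exp z) * h_hyp z) \<le> 1/2" .
  qed
  show "open {w. - (pi/2) < Im w \<and> Im w < pi/2}" "convex {w. - (pi/2) < Im w \<and> Im w < pi/2}"
    unfolding Collect_conj_eq
    by (intro open_Int convex_Int open_halfspace_Im_gt open_halfspace_Im_lt convex_halfspace_Im_gt convex_halfspace_Im_lt)+
  show "w + of_int k \<in> {w. - (pi/2) < Im w \<and> Im w < pi/2}" if "w \<in> {w. - (pi/2) < Im w \<and> Im w < pi/2}" for w k using that by simp
  show "\<exists>e>0. \<forall>\<^sub>F n in sequentially. \<forall>w'\<in>ball w e. w' + of_nat n \<in> V_hyp"
    if "w \<in> {w. - (pi/2) < Im w \<and> Im w < pi/2}" for w
    by (rule h_hyp_absorb) (use that[unfolded mem_Collect_eq] in argo)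
  show "open (closure {w. - (pi/2) < Im w \<and> Im w < pi/2} \<union> {w. pi/2 < \<bar>Im w\<bar> \<and> \<bar>Im w\<bar> < 3/2 * pi})"
  proof -
    have "closure {w. - (pi/2) < Im w \<and> Im w < pi/2} \<union> {w. pi/2 < \<bar>Im w\<bar> \<and> \<bar>Im w\<bar> < 3/2 * pi}
        = {w. \<bar>Im w\<bar> < 3/2 * pi}"
    proof -
      have "(- (pi/2) \<le> y \<and> y \<le> pi/2) \<or> (pi/2 < \<bar>y\<bar> \<and> \<bar>y\<bar> < 3/2 * pi) \<longleftrightarrow> \<bar>y\<bar> < 3/2 * pi" for y
        using pi_gt_zero by argo
      then show ?thesis unfolding closure_strip by blast
    qed
    moreover have "open {w. \<bar>Im w\<bar> < 3/2 * pi}" by (rule open_Collect_less; intro continuous_intros)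
    ultimately show ?thesis by simp
  qed
  show "\<exists>e>0. \<forall>M. \<forall>\<^sub>F n in sequentially. \<forall>w'\<in>ball w e. norm (h_hyp (w' + of_nat n)) > M"
    if "w \<in> {w. pi/2 < \<bar>Im w\<bar> \<and> \<bar>Im w\<bar> < 3/2 * pi}" for w
    by (rule h_hyp_wild) (use that in auto)
  show "\<exists>B. \<forall>\<^sub>F n in sequentially. \<exists>b. h_hyp b = -1 \<and> norm (b - of_nat n) \<le> B" by (rule h_hyp_fixed)
  show "norm (h_hyp (w + of_nat k)) \<le> exp (- 23) * (exp (- real k) - exp (- real (Suc k)))"
    if "u \<in> ball (Complex 20 (- (pi/2))) 2 \<inter> {w. Im w > - (pi/2)}" "dist u w < exp (- 23) * exp (- real k)" for k u w
    by (rule h_hyp_shadow[OF that])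
  show "norm (deriv h_hyp (w + of_nat k)) \<le> 1/2"
    if "u \<in> ball (Complex 20 (- (pi/2))) 2 \<inter> {w. Im w > - (pi/2)}" "dist u w < exp (- 23) * exp (- real k)" for k u w
    by (rule h_hyp_shadow[OF that])
  show "ball (Complex 20 (- (pi/2))) 2 \<inter> {w. Im w > - (pi/2)} \<subseteq> {w. - (pi/2) < Im w \<and> Im w < pi/2}"
  proof
    fix w assume w: "w \<in> ball (Complex 20 (- (pi/2))) 2 \<inter> {w. Im w > - (pi/2)}"
    then have "\<bar>Im w + pi/2\<bar> < 2" using dist_Re_Im(2)[of "Complex 20 (- (pi/2))" w 2] by simp
    then show "w \<in> {w. - (pi/2) < Im w \<and> Im w < pi/2}" using w pi_gt3 by simp
  qed
  show "20 \<in> ball (Complex 20 (- (pi/2))) 2 \<inter> {w. Im w > - (pi/2)}"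
  proof -
    have "20 - Complex 20 (- (pi/2)) = \<i> * of_real (pi/2)" by (simp add: complex_eq_iff)
    then have "norm (20 - Complex 20 (- (pi/2))) = norm (\<i> * complex_of_real (pi/2))" by (simp only:)
    then have "norm (20 - Complex 20 (- (pi/2))) = pi/2" by (simp add: norm_mult)
    then show ?thesis using pi_less_4 by (simp add: dist_norm norm_minus_commute)
  qed
  show "cball 20 (exp (- 23)) \<subseteq> V_hyp"
  proof
    fix z :: complex assume "z \<in> cball 20 (exp (- 23))"
    moreover have "exp (- 23) < (1::real)" by simp
    ultimately have "dist 20 z < 1" by (meson le_less_trans mem_cball)
    from dist_Re_Im[OF this] have b: "19 \<le> Re z" "\<bar>Im z\<bar> \<le> 1" by (auto simp: abs_if split: if_splits)
    have "cos \<bar>Im z\<bar> \<ge> cos (pi/3)" using b pi_gt3 by (subst cos_mono_le_eq) auto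
    then have c: "cos (Im z) \<ge> 1/2" by (simp add: cos_60)
    have "1 + 19 \<le> exp (Re z)" using exp_ge_add_one_self[of "Re z"] b by linarith
    then have "20 * (1/2) \<le> exp (Re z) * cos (Im z)" using c by (intro mult_mono) auto
    then show "z \<in> V_hyp" using b pi_gt3 by (simp add: V_hyp_def Re_exp)
  qed
  show "connected ((of_real :: real \<Rightarrow> complex) ` {ln 4..})"
    by (intro connected_continuous_image convex_connected) (auto intro!: continuous_intros)
  show "of_real ` {ln 4..} \<inter> V_hyp \<noteq> {}"
  proof -
    have "of_real (ln 8) \<in> of_real ` {ln 4..} \<inter> V_hyp" by (auto simp: V_hyp_def Re_exp)
    then show ?thesis by blast
  qed
  show "\<exists>n. ((\<lambda>z. z + 1 + h_hyp z) ^^ n) z \<in> V_hyp" if z: "z \<in> of_real ` {ln 4..}" for z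
  proof -
    obtain x where x: "z = of_real x" "ln 4 \<le> x" using z by auto
    define y where "y = 8/3 * exp (4 - 2 * x - exp x)"
    have "h_hyp z = of_real y" by (simp add: h_hyp_def x(1) y_def flip: exp_of_real)
    then have "z + 1 + h_hyp z = of_real (x + 1 + y)" by (simp add: x(1))
    moreover have "8 \<le> exp (x + 1 + y)"
    proof -
      have "exp (ln 4) \<le> exp x" using x(2) by (simp only: exp_le_cancel_iff)
      then have "4 * 2 \<le> exp x * exp 1" using exp_ge_add_one_self[of 1] by (intro mult_mono) auto
      also have "\<dots> \<le> exp (x + 1 + y)" by (simp add: mult_exp_exp y_def)
      finally show ?thesis by simp
    qed
    then have "of_real (x + 1 + y) \<in> V_hyp" by (simp add: V_hyp_def Re_exp)
    ultimately have "z + 1 + h_hyp z \<in> V_hyp" by (simp only:)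
    then show ?thesis by (intro exI[of _ 1]) simp
  qed
  show "of_real (ln 4) \<in> (of_real :: real \<Rightarrow> complex) ` {ln 4..}" by auto
  show "deriv (\<lambda>z. z + 1 + h_hyp z) (of_real (ln 4)) = 0"
  proof -
    have e4: "exp (of_real (ln 4)) = (4 :: complex)" by (simp add: exp_of_real)
    have "h_hyp (of_real (ln 4)) = 8/3 * (exp (- of_real (ln 4)) * exp (- of_real (ln 4)))"
      unfolding h_hyp_def e4 by (simp add: mult_exp_exp)
    also have "\<dots> = 1/6" unfolding exp_minus e4 by simp
    finally have v: "h_hyp (of_real (ln 4)) = 1/6" .
    have "- (2 + exp (of_real (ln 4))) * h_hyp (of_real (ln 4)) = -1" unfolding e4 v by simp
    then have "((\<lambda>z. z + 1 + h_hyp z) has_field_derivative 1 + 0 + -1) (at (of_real (ln 4)))"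
      using h_hyp_deriv[of "of_real (ln 4)"] by (intro DERIV_add DERIV_ident DERIV_const) simp
    then show ?thesis by (simp add: DERIV_imp_deriv)
  qed
qed (auto)

section \<open>Non-univalent Baker domains\<close>

theorem theorem1p2:
  shows "(\<exists>f U \<phi>. f holomorphic_on UNIV \<and> invariant_baker_domain f U \<and>
            simply_parabolic_type f U \<and> \<not> inj_on f U \<and>
            conformal_map_from_disk \<phi> U \<and>
            infinity_cluster_points \<phi> \<noteq> sphere 0 1) \<and>
         (\<exists>f U \<phi>. f holomorphic_on UNIV \<and> invariant_baker_domain f U \<and>
            hyperbolic_type f U \<and> \<not> inj_on f U \<and>
            conformal_map_from_disk \<phi> U \<and>
            infinity_cluster_points \<phi> \<noteq> sphere 0 1)"
proof (rule conjI)
  obtain f U where fU: "f holomorphic_on UNIV \<and> invariant_baker_domain f U \<and>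
      conformally_equivalent U (orbit_rel f U) {z. Im z > 0} (int_translation_rel {z. Im z > 0}) \<and> \<not> inj_on f U \<and>
      (\<exists>\<phi>. conformal_map_from_disk \<phi> U \<and> infinity_cluster_points \<phi> \<noteq> sphere 0 1)"
    using perturbed_translation.baker_domain_properties[OF perturbed_translation_h_par] by iprover
  then show "\<exists>f U \<phi>. f holomorphic_on UNIV \<and> invariant_baker_domain f U \<and>
      simply_parabolic_type f U \<and> \<not> inj_on f U \<and>
      conformal_map_from_disk \<phi> U \<and> infinity_cluster_points \<phi> \<noteq> sphere 0 1"
    unfolding simply_parabolic_type_def Let_def by iprover
next
  obtain f U where fU: "f holomorphic_on UNIV \<and> invariant_baker_domain f U \<and>
      conformally_equivalent U (orbit_rel f U) {z. - (pi/2) < Im z \<and> Im z < pi/2}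
        (int_translation_rel {z. - (pi/2) < Im z \<and> Im z < pi/2}) \<and> \<not> inj_on f U \<and>
      (\<exists>\<phi>. conformal_map_from_disk \<phi> U \<and> infinity_cluster_points \<phi> \<noteq> sphere 0 1)"
    using perturbed_translation.baker_domain_properties[OF perturbed_translation_h_hyp] by iprover
  moreover have "(0::real) < pi/2" by simp
  ultimately show "\<exists>f U \<phi>. f holomorphic_on UNIV \<and> invariant_baker_domain f U \<and>
      hyperbolic_type f U \<and> \<not> inj_on f U \<and>
      conformal_map_from_disk \<phi> U \<and> infinity_cluster_points \<phi> \<noteq> sphere 0 1"
    unfolding hyperbolic_type_def Let_def by iprover
qed

end
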